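(* Let $d=2m$ with $m\ge1$ an integer, and let $0<\theta\le\pi$. There exists a nonzero real-valued isotropic positive definite function $F\in C_c^\infty(\mathbb{R}^{2m})$ such that $F(0)>0$, $\operatorname{supp}F\subset\{x\in\mathbb{R}^{2m}:|x|\le\theta\}$, and such that its normalized univariate representative $$f(r):=\frac{F(re_1)}{F(0)},\qquad r\ge0,$$ belongs to $\Phi_{2m}$ but satisfies $$\int_0^\theta f(t)\,R_2^{m-\frac12}(\cos t)\,(\sin t)^{2m-1}\,dt<0.$$ Consequently $f|_{[0,\pi]}\notin\Psi_{2m}$.
   Context: $e_1$ is the first standard basis vector. A function $F$ on $\mathbb{R}^d$ is isotropic if $F(x)$ depends only on $|x|$, and positive definite if $\sum_{i,j=1}^N\overline{c_i}c_jF(x_i-x_j)\ge0$ for all $N\ge1$, $x_i\in\mathbb{R}^d$, $c_i\in\mathbb{C}$. $\Phi_d$ is the class of continuous $\phi:[0,\infty)\to\mathbb{R}$ with $\phi(0)=1$ such that $x\mapsto\phi(|x|)$ is positive definite on $\mathbb{R}^d$. $\Psi_d$ is the class of continuous $\psi:[0,\pi]\to\mathbb{R}$ with $\psi(0)=1$ such that $\sum_{i,j=1}^N\overline{c_i}c_j\,\psi(\arccos(\xi_i\cdot\xi_j))\ge0$ for all $N\ge1$, $\xi_i\in\mathbb{S}^d=\{x\in\mathbb{R}^{d+1}:|x|=1\}$, $c_i\in\mathbb{C}$. For $\lambda>0$, $R_n^\lambda(t)=C_n^\lambda(t)/C_n^\lambda(1)$, where $C_n^\lambda$ is the Gegenbauer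 polynomial of degree $n$; in particular $R_2^{m-\frac12}(x)=\dfrac{(2m+1)x^2-1}{2m}$. *)

theory Defs
  imports "HOL-Analysis.Analysis"
begin

definition isotropic :: "('a::real_normed_vector \<Rightarrow> 'b) \<Rightarrow> bool" where
  "isotropic F \<longleftrightarrow> (\<forall>x y. norm x = norm y \<longrightarrow> F x = F y)"

definition positive_definite :: "('a::real_normed_vector \<Rightarrow> complex) \<Rightarrow> bool" where
  "positive_definite F \<longleftrightarrow>
     (\<forall>N\<ge>1. \<forall>(x :: nat \<Rightarrow> 'a) (c :: nat \<Rightarrow> complex).
        (\<Sum>i<N. \<Sum>j<N. cnj (c i) * c j * F (x i - x j)) \<in> \<real>\<^sub>\<ge>\<^sub>0)"

text \<open>
  The space \<open>\<real>\<^sup>d\<close> is \<^typ>\<open>real^'n\<close> with \<open>d = CARD('n)\<close>, so the classes \<open>\<Phi>\<^sub>d\<close> and \<open>\<Psi>\<^sub>d\<close>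
  are indexed by the type \<^typ>\<open>'n\<close>. The ambient space \<open>\<real>\<^bsup>d+1\<^esup>\<close> of the sphere \<open>\<S>\<^sup>d\<close> is
  \<^typ>\<open>real^('n option)\<close>. Members of the classes are total functions, but membership only depends
  on their values on \<open>[0,\<infinity>)\<close> and \<open>[0,\<pi>]\<close> respectively.
\<close>

definition Phi :: "'n::finite itself \<Rightarrow> (real \<Rightarrow> real) set" where
  "Phi d = {\<phi>. continuous_on {0..} \<phi> \<and> \<phi> 0 = 1 \<and>
     positive_definite (\<lambda>x :: real^'n. complex_of_real (\<phi> (norm x)))}"

definition Psi :: "'n::finite itself \<Rightarrow> (real \<Rightarrow> real) set" where
  "Psi d = {\<psi>. continuous_on {0..pi} \<psi> \<and> \<psi> 0 = 1 \<and>
     (\<forall>N\<ge>1. \<forall>(\<xi> :: nat \<Rightarrow> real^('n option)) (c :: nat \<Rightarrow> complex).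
        (\<forall>i<N. \<xi> i \<in> sphere 0 1) \<longrightarrow>
        (\<Sum>i<N. \<Sum>j<N. cnj (c i) * c j * complex_of_real (\<psi> (arccos (\<xi> i \<bullet> \<xi> j)))) \<in> \<real>\<^sub>\<ge>\<^sub>0)}"

primrec Ck :: "nat \<Rightarrow> ('a::euclidean_space \<Rightarrow> real) \<Rightarrow> bool" where
  "Ck 0 f \<longleftrightarrow> continuous_on UNIV f"
| "Ck (Suc k) f \<longleftrightarrow> (\<forall>x. f differentiable (at x)) \<and>
     (\<forall>b\<in>Basis. Ck k (\<lambda>x. frechet_derivative f (at x) b))"

definition smooth :: "('a::euclidean_space \<Rightarrow> real) \<Rightarrow> bool" where
  "smooth f \<longleftrightarrow> (\<forall>k. Ck k f)"

definition supp :: "('a::topological_space \<Rightarrow> real) \<Rightarrow> 'a set" where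
  "supp f = closure {x. f x \<noteq> 0}"

definition Cc_infinity :: "('a::euclidean_space \<Rightarrow> real) set" where
  "Cc_infinity = {f. smooth f \<and> compact (supp f)}"

text \<open>The explicit power-sum form of the Gegenbauer polynomial \<open>C\<^sub>n\<^sup>\<lambda>\<close>, with
  \<open>\<Gamma>(n - k + \<lambda>) / \<Gamma>(\<lambda>)\<close> written as a Pochhammer symbol.\<close>

definition gegenbauer :: "real \<Rightarrow> nat \<Rightarrow> real \<Rightarrow> real" where
  "gegenbauer l n t =
     (\<Sum>k\<le>n div 2. (-1) ^ k * pochhammer l (n - k) / (fact k * fact (n - 2 * k)) * (2 * t) ^ (n - 2 * k))"

definition gegenbauer_normalized :: "real \<Rightarrow> nat \<Rightarrow> real \<Rightarrow> real" where
  "gegenbauer_normalized l n t = gegenbauer l n t / gegenbauer l n 1"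

lemma gegenbauer_normalized_2:
  assumes "m \<ge> 1"
  shows "gegenbauer_normalized (real m - 1/2) 2 x = ((2 * real m + 1) * x\<^sup>2 - 1) / (2 * real m)"
proof -
  define l where "l = real m - 1/2"
  have l: "l > 0" using assms by (simp add: l_def)
  have C: "gegenbauer l 2 t = l * (2 * (l + 1) * t\<^sup>2 - 1)" for t
    by (simp add: gegenbauer_def atMost_Suc pochhammer_Suc numeral_2_eq_2 field_simps power2_eq_square)
  have "gegenbauer_normalized l 2 x = (l * (2 * (l + 1) * x\<^sup>2 - 1)) / (l * (2 * l + 1))"
    unfolding gegenbauer_normalized_def C by (simp add: algebra_simps)
  also have "\<dots> = (2 * (l + 1) * x\<^sup>2 - 1) / (2 * l + 1)"
    using l by simp
  finally show ?thesis
    by (simp add: l_def algebra_simps)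
qed

end

theory Submission
  imports Defs
begin

text \<open>
  Write \<open>w t = R\<^sub>2 (cos t) * sin t ^ (2 * m - 1)\<close>, with \<open>R\<^sub>2\<close> the normalised Gegenbauer polynomial of degree
  two; this is \<open>zonal_weight m\<close> below.

  A function in \<open>\<Psi>\<^sub>2\<^sub>m\<close> has a nonnegative integral against \<open>w\<close>
  (\<open>Psi_imp_zonal_integral_nonneg\<close>). Indeed \<open>R\<^sub>2 (\<xi> \<bullet> \<eta>)\<close> is, up to a positive factor, a sum of
  products \<open>Y \<xi> * Y \<eta>\<close>, so \<open>\<psi> (arccos (\<xi> \<bullet> \<eta>)) * R\<^sub>2 (\<xi> \<bullet> \<eta>)\<close> is again a positive semidefinite kernel on
  the sphere. Its double integral is nonnegative, and by rotation invariance that double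
  integral is a positive multiple of \<open>\<integral> \<psi> t * w t\<close>. So it suffices to find a smooth isotropic
  positive definite \<open>F\<close>, supported in the ball of radius \<open>\<theta>\<close>, whose integral against \<open>w\<close> along a ray
  is negative.

  Without the restriction on the support this is an asymptotic computation
  (\<open>dilate_zonal_integral_negative\<close>). The weight is the second derivative of
  \<open>sin t ^ (2 * m + 1) / (2 * m * (2 * m + 1))\<close>, and \<open>sin t ^ (2 * m + 1)\<close> is itself the second
  derivative of a bounded function \<open>p\<close>, because \<open>2 * m + 1\<close> is odd. For the radial profile \<open>f\<close> of a
  fixed positive definite bump, four integrations by parts give
  \<open>\<integral> f t * w (\<rho> * t) = - \<kappa>\<^sup>-\<^sup>1 * f'' 0 * p' 0 / \<rho> ^ 3 + O (\<rho> ^ (- 4))\<close> with \<open>\<kappa> > 0\<close>. Here \<open>p' 0 < 0\<close>, and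
  \<open>f'' 0 < 0\<close> because a nonconstant positive definite function cannot be flat to second order at
  the origin. So the integral is negative for large \<open>\<rho>\<close>.

  A large \<open>\<rho>\<close> means a large support, and the remaining idea transports the sign to small supports
  by analyticity. In polar coordinates, \<open>\<integral> F (t * e) * w t\<close> is a positive multiple of the integral of
  \<open>F x * G (norm x ^ 2)\<close> over \<open>\<real>\<^sup>2\<^sup>m\<close>, where \<open>G\<close> is entire. If \<open>h\<^sub>\<rho>\<close> are the normalised dilates of a
  radial bump \<open>h\<close>, the functional takes on \<open>h\<^sub>\<rho> * h\<^sub>\<sigma>\<close> (a convolution) the value
  \<open>B \<rho> \<sigma> = \<integral>\<integral> h y * h z * G (norm (\<rho> y + \<sigma> z) ^ 2)\<close>, an entire function of \<open>(\<rho>, \<sigma>)\<close>. An entire function is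
  determined by its values near the origin, so \<open>B \<rho> \<rho>\<close> for one large \<open>\<rho>\<close> is approximated by
  \<open>\<Sum> c i * c j * B (\<rho> i) (\<rho> j)\<close> with arbitrarily small nodes \<open>\<rho> i\<close> and suitable, wildly oscillating,
  coefficients. That sum is the value of the functional on \<open>H * H\<close> (again a convolution) with
  \<open>H = \<Sum> c i h\<^bsub>\<rho> i\<^esub>\<close>, and an autoconvolution is positive definite whatever the coefficients are. The
  coefficients come from Newton's forward difference formula, for which all the error bounds are
  elementary (\<open>entire_extrapolation\<close>).
\<close>

section \<open>Newton extrapolation from small nodes\<close>

text \<open>
  The \<open>k\<close>-th forward difference, with step one, of \<open>x ^ p\<close> at \<open>x = 1\<close>; it equals \<open>k! * S (p + 1) (k + 1)\<close>
  with Stirling numbers of the second kind. The base point is \<open>1\<close> rather than \<open>0\<close> because the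
  nodes will serve as dilation factors and must not vanish.
\<close>

definition power_difference :: "nat \<Rightarrow> nat \<Rightarrow> real" where
  "power_difference k p = (\<Sum>j\<le>k. (-1) ^ (k - j) * real (k choose j) * (real j + 1) ^ p)"

text \<open>
  The Stirling recurrence. It carries the whole section: nonnegativity, the vanishing of high
  differences, and Newton's formula all follow from it by induction on the exponent.
\<close>

lemma power_difference_Suc:
  "power_difference k (Suc p) = (real k + 1) * power_difference k p + real k * power_difference (k - 1) p"
proof (cases k)
  case 0
  then show ?thesis by (simp add: power_difference_def)
next
  case (Suc l)
  \<comment> \<open>This identity trades the extra factor \<open>j + 1\<close> for a lower binomial coefficient.\<close>
  have absorb: "real (Suc l choose j) * (real j + 1) = (real l + 2) * real (Suc l choose j) - (real l + 1) * real (l choose j)"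
    if "j \<le> Suc l" for j
  proof -
    have "(Suc l - j) * (Suc l choose j) = Suc l * (l choose j)"
      using binomial_absorb_comp[of "Suc l" j] by simp
    then have "real (Suc l - j) * real (Suc l choose j) = real (Suc l) * real (l choose j)"
      by (metis of_nat_mult)
    with that show ?thesis by (simp add: of_nat_diff algebra_simps)
  qed
  have "power_difference k (Suc p) =
      (\<Sum>j\<le>Suc l. (-1) ^ (Suc l - j) * (real (Suc l choose j) * (real j + 1)) * (real j + 1) ^ p)"
    unfolding power_difference_def Suc by (intro sum.cong) (auto simp: mult_ac)
  also have "\<dots> = (\<Sum>j\<le>Suc l. (real l + 2) * ((-1) ^ (Suc l - j) * real (Suc l choose j) * (real j + 1) ^ p)
      - (real l + 1) * ((-1) ^ (Suc l - j) * real (l choose j) * (real j + 1) ^ p))"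
    by (intro sum.cong refl, subst absorb) (auto simp: algebra_simps)
  also have "\<dots> = (real l + 2) * power_difference (Suc l) p
      - (real l + 1) * (\<Sum>j\<le>Suc l. (-1) ^ (Suc l - j) * real (l choose j) * (real j + 1) ^ p)"
    by (simp only: sum_subtractf power_difference_def sum_distrib_left)
  also have "(\<Sum>j\<le>Suc l. (-1) ^ (Suc l - j) * real (l choose j) * (real j + 1) ^ p) = - power_difference l p"
    unfolding power_difference_def sum_negf[symmetric]
    by (simp add: Suc_diff_le)
  finally show ?thesis by (simp add: Suc algebra_simps)
qed

lemma power_difference_0: "power_difference k 0 = (if k = 0 then 1 else 0)"
proof (cases k)
  case (Suc l)
  have "power_difference k 0 = (\<Sum>j\<le>k. real (k choose j) * 1 ^ j * (-1) ^ (k - j))"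
    by (simp add: power_difference_def mult.commute)
  also have "\<dots> = (1 + (-1)) ^ k"
    by (subst binomial_ring) (simp add: mult_ac)
  finally show ?thesis using Suc by simp
qed (simp add: power_difference_def)

lemma power_difference_nonneg: "power_difference k p \<ge> 0"
  by (induction p arbitrary: k) (simp_all add: power_difference_0 power_difference_Suc)

lemma power_difference_eq_0: "p < k \<Longrightarrow> power_difference k p = 0"
  by (induction p arbitrary: k) (simp_all add: power_difference_0 power_difference_Suc)

text \<open>
  Induction on \<open>p\<close>: the two terms of the recurrence recombine through
  \<open>(k + 1) * (n choose k + n choose (k + 1)) = (n + 1) * (n choose k)\<close>.
\<close>

lemma newton_forward: "(\<Sum>k\<le>n. real (n choose k) * power_difference k p) = (real n + 1) ^ p"
proof (induction p)
  case 0
  show ?case by (simp add: power_difference_0 if_distrib cong: if_cong)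
next
  case (Suc p)
  have shift: "(\<Sum>k\<le>n. real (n choose k) * (real k * power_difference (k - 1) p))
      = (\<Sum>k\<le>n. (real k + 1) * real (n choose Suc k) * power_difference k p)"
  proof -
    have "(\<Sum>k\<le>n. real (n choose k) * (real k * power_difference (k - 1) p))
      = (\<Sum>k\<le>Suc n. real (n choose k) * (real k * power_difference (k - 1) p))"
      by simp
    also have "\<dots> = (\<Sum>k\<le>n. real (n choose Suc k) * (real (Suc k) * power_difference k p))"
      by (subst sum.atMost_Suc_shift) simp
    finally show ?thesis by (simp add: algebra_simps)
  qed
  have pascal: "(real k + 1) * (real (n choose k) + real (n choose Suc k)) = (real n + 1) * real (n choose k)" for k
  proof -
    have "Suc k * (Suc n choose Suc k) = Suc n * (n choose k)"
      by (rule Suc_times_binomial)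
    then have "real (Suc k) * real (Suc n choose Suc k) = real (Suc n) * real (n choose k)"
      by (metis of_nat_mult)
    then show ?thesis by (simp add: algebra_simps)
  qed
  have "(\<Sum>k\<le>n. real (n choose k) * power_difference k (Suc p))
      = (\<Sum>k\<le>n. (real k + 1) * real (n choose k) * power_difference k p)
      + (\<Sum>k\<le>n. real (n choose k) * (real k * power_difference (k - 1) p))"
    by (simp add: power_difference_Suc sum.distrib[symmetric] algebra_simps)
  also have "\<dots> = (\<Sum>k\<le>n. ((real k + 1) * (real (n choose k) + real (n choose Suc k))) * power_difference k p)"
    unfolding shift by (simp add: sum.distrib[symmetric] algebra_simps)
  also have "\<dots> = (real n + 1) * (\<Sum>k\<le>n. real (n choose k) * power_difference k p)"
    unfolding pascal by (simp add: sum_distrib_left mult_ac)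
  finally show ?case by (simp add: Suc)
qed

text \<open>
  The coefficient of the value at the node \<open>j + 1\<close> in the Newton series for the point \<open>n + 1\<close>,
  truncated to differences of order below \<open>K\<close>. Only the nodes \<open>1, \<dots>, K\<close> occur, although the point
  may lie far beyond them.
\<close>

definition extrapolation_weight :: "nat \<Rightarrow> nat \<Rightarrow> nat \<Rightarrow> real" where
  "extrapolation_weight n K j = (\<Sum>k<K. if j \<le> k then real (n choose k) * ((-1) ^ (k - j) * real (k choose j)) else 0)"

lemma extrapolation_weight_power:
  "(\<Sum>j<K. extrapolation_weight n K j * (real j + 1) ^ p) = (\<Sum>k<K. real (n choose k) * power_difference k p)"
proof -
  have "(\<Sum>j<K. extrapolation_weight n K j * (real j + 1) ^ p)
     = (\<Sum>k<K. \<Sum>j<K. if j \<le> k then real (n choose k) * ((-1) ^ (k - j) * real (k choose j)) * (real j + 1) ^ p else 0)"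
    unfolding extrapolation_weight_def sum_distrib_right
    by (subst sum.swap) (intro sum.cong refl, auto)
  also have "\<dots> = (\<Sum>k<K. real (n choose k) * power_difference k p)"
  proof (intro sum.cong refl)
    fix k assume k: "k \<in> {..<K}"
    have "(\<Sum>j<K. if j \<le> k then real (n choose k) * ((-1) ^ (k - j) * real (k choose j)) * (real j + 1) ^ p else 0)
      = (\<Sum>j\<in>{..<K} \<inter> {j. j \<le> k}. real (n choose k) * ((-1) ^ (k - j) * real (k choose j)) * (real j + 1) ^ p)"
      by (subst sum.inter_restrict) auto
    also have "{..<K} \<inter> {j. j \<le> k} = {..k}" using k by auto
    finally show "(\<Sum>j<K. if j \<le> k then real (n choose k) * ((-1) ^ (k - j) * real (k choose j)) * (real j + 1) ^ p else 0)
      = real (n choose k) * power_difference k p"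
      by (simp add: power_difference_def sum_distrib_left mult_ac)
  qed
  finally show ?thesis .
qed

lemma extrapolation_nonneg: "0 \<le> (\<Sum>j<K. extrapolation_weight n K j * (real j + 1) ^ p)"
  unfolding extrapolation_weight_power by (intro sum_nonneg mult_nonneg_nonneg power_difference_nonneg) auto

lemma newton_forward_upto: "n \<le> N \<Longrightarrow> (\<Sum>k\<le>N. real (n choose k) * power_difference k p) = (real n + 1) ^ p"
  by (subst newton_forward[symmetric], rule sum.mono_neutral_right) auto

text \<open>
  The truncation drops nonnegative terms from a sum that equals \<open>(n + 1) ^ p\<close>. Thus the individual
  weights are huge, but the extrapolated value of a monomial never exceeds its true value; this
  uniform domination makes the convergence argument below work.
\<close>

lemma extrapolation_le: "(\<Sum>j<K. extrapolation_weight n K j * (real j + 1) ^ p) \<le> (real n + 1) ^ p"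
proof -
  have "(\<Sum>k<K. real (n choose k) * power_difference k p) \<le> (\<Sum>k\<le>max n K. real (n choose k) * power_difference k p)"
    by (intro sum_mono2 mult_nonneg_nonneg power_difference_nonneg) auto
  then show ?thesis
    by (simp add: extrapolation_weight_power newton_forward_upto)
qed

lemma extrapolation_exact:
  assumes "p < K"
  shows "(\<Sum>j<K. extrapolation_weight n K j * (real j + 1) ^ p) = (real n + 1) ^ p"
proof -
  have "(\<Sum>k<K. real (n choose k) * power_difference k p) = (\<Sum>k\<le>max n K. real (n choose k) * power_difference k p)"
    using assms by (intro sum.mono_neutral_left) (auto simp: power_difference_eq_0)
  then show ?thesis
    by (simp add: extrapolation_weight_power newton_forward_upto)
qed

text \<open>
  A homogeneous polynomial of degree \<open>N\<close> in two variables whose coefficients have absolute sum at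
  most \<open>M\<close>. This bound survives the extrapolation in both variables.
\<close>

definition homogeneous_bounded :: "nat \<Rightarrow> real \<Rightarrow> (real \<Rightarrow> real \<Rightarrow> real) \<Rightarrow> bool" where
  "homogeneous_bounded N M f \<longleftrightarrow>
     (\<exists>\<gamma>. (\<forall>\<rho> \<sigma>. f \<rho> \<sigma> = (\<Sum>a\<le>N. \<gamma> a * \<rho> ^ a * \<sigma> ^ (N - a))) \<and> (\<Sum>a\<le>N. \<bar>\<gamma> a\<bar>) \<le> M)"

lemma homogeneous_bounded_add:
  assumes "homogeneous_bounded N M f" "homogeneous_bounded N M' f'"
  shows "homogeneous_bounded N (M + M') (\<lambda>\<rho> \<sigma>. f \<rho> \<sigma> + f' \<rho> \<sigma>)"
proof -
  obtain \<gamma> where g: "\<And>\<rho> \<sigma>. f \<rho> \<sigma> = (\<Sum>a\<le>N. \<gamma> a * \<rho> ^ a * \<sigma> ^ (N - a))" "(\<Sum>a\<le>N. \<bar>\<gamma> a\<bar>) \<le> M"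
    using assms(1) unfolding homogeneous_bounded_def by blast
  obtain \<gamma>' where g': "\<And>\<rho> \<sigma>. f' \<rho> \<sigma> = (\<Sum>a\<le>N. \<gamma>' a * \<rho> ^ a * \<sigma> ^ (N - a))" "(\<Sum>a\<le>N. \<bar>\<gamma>' a\<bar>) \<le> M'"
    using assms(2) unfolding homogeneous_bounded_def by blast
  have "(\<Sum>a\<le>N. \<bar>\<gamma> a + \<gamma>' a\<bar>) \<le> (\<Sum>a\<le>N. \<bar>\<gamma> a\<bar>) + (\<Sum>a\<le>N. \<bar>\<gamma>' a\<bar>)"
    unfolding sum.distrib[symmetric] by (intro sum_mono) auto
  then show ?thesis unfolding homogeneous_bounded_def
    using g g' by (intro exI[of _ "\<lambda>a. \<gamma> a + \<gamma>' a"]) (auto simp: algebra_simps sum.distrib)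
qed

lemma homogeneous_bounded_scale:
  assumes "homogeneous_bounded N M f" "\<bar>c\<bar> \<le> C"
  shows "homogeneous_bounded N (C * M) (\<lambda>\<rho> \<sigma>. c * f \<rho> \<sigma>)"
proof -
  obtain \<gamma> where g: "\<And>\<rho> \<sigma>. f \<rho> \<sigma> = (\<Sum>a\<le>N. \<gamma> a * \<rho> ^ a * \<sigma> ^ (N - a))" "(\<Sum>a\<le>N. \<bar>\<gamma> a\<bar>) \<le> M"
    using assms(1) unfolding homogeneous_bounded_def by blast
  have "(\<Sum>a\<le>N. \<bar>c * \<gamma> a\<bar>) = \<bar>c\<bar> * (\<Sum>a\<le>N. \<bar>\<gamma> a\<bar>)"
    by (simp add: abs_mult sum_distrib_left)
  also have "\<dots> \<le> C * M"
    using g(2) assms(2) by (intro mult_mono) (auto intro: sum_nonneg)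
  finally show ?thesis unfolding homogeneous_bounded_def
    using g by (intro exI[of _ "\<lambda>a. c * \<gamma> a"]) (auto simp: sum_distrib_left algebra_simps)
qed

lemma homogeneous_bounded_mult_left:
  assumes "homogeneous_bounded N M f"
  shows "homogeneous_bounded (Suc N) M (\<lambda>\<rho> \<sigma>. \<rho> * f \<rho> \<sigma>)"
proof -
  obtain \<gamma> where g: "\<And>\<rho> \<sigma>. f \<rho> \<sigma> = (\<Sum>a\<le>N. \<gamma> a * \<rho> ^ a * \<sigma> ^ (N - a))" "(\<Sum>a\<le>N. \<bar>\<gamma> a\<bar>) \<le> M"
    using assms(1) unfolding homogeneous_bounded_def by blast
  show ?thesis unfolding homogeneous_bounded_def
    by (rule exI[of _ "\<lambda>a. case a of 0 \<Rightarrow> 0 | Suc b \<Rightarrow> \<gamma> b"])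
      (auto simp: sum.atMost_Suc_shift g sum_distrib_left mult_ac simp del: sum.atMost_Suc)
qed

lemma homogeneous_bounded_mult_right:
  assumes "homogeneous_bounded N M f"
  shows "homogeneous_bounded (Suc N) M (\<lambda>\<rho> \<sigma>. \<sigma> * f \<rho> \<sigma>)"
proof -
  obtain \<gamma> where g: "\<And>\<rho> \<sigma>. f \<rho> \<sigma> = (\<Sum>a\<le>N. \<gamma> a * \<rho> ^ a * \<sigma> ^ (N - a))" "(\<Sum>a\<le>N. \<bar>\<gamma> a\<bar>) \<le> M"
    using assms(1) unfolding homogeneous_bounded_def by blast
  have "\<sigma> * f \<rho> \<sigma> = (\<Sum>a\<le>N. \<gamma> a * \<rho> ^ a * \<sigma> ^ (Suc N - a))" for \<rho> \<sigma>
    unfolding g sum_distrib_left by (intro sum.cong) (auto simp: Suc_diff_le)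
  moreover have "(\<Sum>a\<le>N. if a \<le> N then \<bar>\<gamma> a\<bar> else 0) = (\<Sum>a\<le>N. \<bar>\<gamma> a\<bar>)" by (intro sum.cong) auto
  ultimately show ?thesis unfolding homogeneous_bounded_def
    using g(2) by (intro exI[of _ "\<lambda>a. if a \<le> N then \<gamma> a else 0"]) (auto simp: if_distrib cong: if_cong)
qed

text \<open>
  The squared norm is the quadratic form \<open>(y \<bullet> y) \<rho>\<^sup>2 + 2 (y \<bullet> z) \<rho> \<sigma> + (z \<bullet> z) \<sigma>\<^sup>2\<close>, whose coefficients
  have absolute sum at most \<open>4\<close>.
\<close>

lemma homogeneous_bounded_norm_power:
  fixes y z :: "'a::real_inner"
  assumes y: "norm y \<le> 1" and z: "norm z \<le> 1"
  shows "homogeneous_bounded (2 * k) (4 ^ k) (\<lambda>\<rho> \<sigma>. ((norm (\<rho> *\<^sub>R y + \<sigma> *\<^sub>R z))\<^sup>2) ^ k)"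
proof (induction k)
  case 0
  show ?case unfolding homogeneous_bounded_def by (intro exI[of _ "\<lambda>_. 1"]) auto
next
  case (Suc k)
  let ?f = "\<lambda>\<rho> \<sigma>. ((norm (\<rho> *\<^sub>R y + \<sigma> *\<^sub>R z))\<^sup>2) ^ k"
  have q: "(norm (\<rho> *\<^sub>R y + \<sigma> *\<^sub>R z))\<^sup>2 = (y \<bullet> y) * \<rho>\<^sup>2 + (2 * (y \<bullet> z)) * (\<rho> * \<sigma>) + (z \<bullet> z) * \<sigma>\<^sup>2" for \<rho> \<sigma>
    by (simp add: power2_norm_eq_inner inner_add inner_commute[of z y]) (simp add: power2_eq_square algebra_simps)
  have yz: "\<bar>y \<bullet> y\<bar> \<le> 1" "\<bar>2 * (y \<bullet> z)\<bar> \<le> 2" "\<bar>z \<bullet> z\<bar> \<le> 1"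
    using y z Cauchy_Schwarz_ineq2[of y z] mult_mono[of "norm y" 1 "norm z" 1]
    by (auto simp: abs_mult power2_norm_eq_inner[symmetric] abs_square_le_1)
  have "homogeneous_bounded (Suc (Suc (2 * k))) (1 * 4 ^ k + 2 * 4 ^ k + 1 * 4 ^ k)
    (\<lambda>\<rho> \<sigma>. (y \<bullet> y) * (\<rho> * (\<rho> * ?f \<rho> \<sigma>)) + (2 * (y \<bullet> z)) * (\<rho> * (\<sigma> * ?f \<rho> \<sigma>)) + (z \<bullet> z) * (\<sigma> * (\<sigma> * ?f \<rho> \<sigma>)))"
    by (intro homogeneous_bounded_add homogeneous_bounded_scale homogeneous_bounded_mult_left
      homogeneous_bounded_mult_right Suc yz)
  moreover have "((norm (\<rho> *\<^sub>R y + \<sigma> *\<^sub>R z))\<^sup>2) ^ Suc k =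
      (y \<bullet> y) * (\<rho> * (\<rho> * ?f \<rho> \<sigma>)) + (2 * (y \<bullet> z)) * (\<rho> * (\<sigma> * ?f \<rho> \<sigma>)) + (z \<bullet> z) * (\<sigma> * (\<sigma> * ?f \<rho> \<sigma>))" for \<rho> \<sigma>
    unfolding power_Suc by (subst q) (simp add: distrib_right distrib_left power2_eq_square mult_ac)
  ultimately show ?case by simp
qed

text \<open>
  By homogeneity, extrapolating in both variables replaces \<open>\<rho> ^ a * \<sigma> ^ (N - a)\<close> by a product of two
  one-variable extrapolations. Both are exact for \<open>N < K\<close> and dominated by the true powers otherwise.
\<close>

lemma homogeneous_bounded_extrapolation:
  fixes K n N :: nat and \<epsilon> R M :: real
  assumes f: "homogeneous_bounded N M f" and \<epsilon>: "\<epsilon> \<ge> 0" and R: "(real n + 1) * \<epsilon> = R"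
  defines "S \<equiv> \<Sum>i<K. \<Sum>j<K. extrapolation_weight n K i * extrapolation_weight n K j * f (\<epsilon> * (real i + 1)) (\<epsilon> * (real j + 1))"
  shows "N < K \<Longrightarrow> S = f R R" and "\<bar>S\<bar> \<le> M * R ^ N"
proof -
  obtain \<gamma> where g: "\<And>\<rho> \<sigma>. f \<rho> \<sigma> = (\<Sum>a\<le>N. \<gamma> a * \<rho> ^ a * \<sigma> ^ (N - a))" "(\<Sum>a\<le>N. \<bar>\<gamma> a\<bar>) \<le> M"
    using f unfolding homogeneous_bounded_def by blast
  define w where "w = extrapolation_weight n K"
  define L where "L p = (\<Sum>j<K. w j * (real j + 1) ^ p)" for p
  have "S = (\<Sum>i<K. \<Sum>j<K. \<Sum>a\<le>N. \<epsilon> ^ N * \<gamma> a * (w i * (real i + 1) ^ a) * (w j * (real j + 1) ^ (N - a)))"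
    unfolding S_def g sum_distrib_left w_def
  proof (intro sum.cong refl)
    fix i j a assume "a \<in> {..N}"
    then have "\<epsilon> ^ N = \<epsilon> ^ a * \<epsilon> ^ (N - a)" by (simp flip: power_add)
    then show "extrapolation_weight n K i * extrapolation_weight n K j * (\<gamma> a * (\<epsilon> * (real i + 1)) ^ a * (\<epsilon> * (real j + 1)) ^ (N - a)) =
       \<epsilon> ^ N * \<gamma> a * (extrapolation_weight n K i * (real i + 1) ^ a) * (extrapolation_weight n K j * (real j + 1) ^ (N - a))"
      by (simp add: power_mult_distrib mult_ac)
  qed
  also have "\<dots> = (\<Sum>a\<le>N. \<Sum>i<K. \<Sum>j<K. \<epsilon> ^ N * \<gamma> a * (w i * (real i + 1) ^ a) * (w j * (real j + 1) ^ (N - a)))"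
    by (subst sum.swap[of _ "{..N}"], subst sum.swap[of _ "{..N}"]) (rule refl)
  also have "\<dots> = (\<Sum>a\<le>N. \<epsilon> ^ N * \<gamma> a * L a * L (N - a))"
    unfolding L_def by (simp add: sum_distrib_left sum_distrib_right mult_ac)
  finally have S: "S = (\<Sum>a\<le>N. \<epsilon> ^ N * \<gamma> a * L a * L (N - a))" .
  have RN: "R ^ N = \<epsilon> ^ N * ((real n + 1) ^ a * (real n + 1) ^ (N - a))" if "a \<le> N" for a
    unfolding R[symmetric] using that by (simp add: power_mult_distrib mult.commute flip: power_add)
  show "S = f R R" if "N < K"
  proof -
    have "S = (\<Sum>a\<le>N. \<gamma> a * R ^ N)"
      unfolding S using that
      by (intro sum.cong refl) (auto simp: L_def w_def extrapolation_exact RN)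
    also have "\<dots> = f R R"
      unfolding g by (intro sum.cong refl) (simp add: mult.assoc flip: power_add)
    finally show ?thesis .
  qed
  have "\<bar>S\<bar> \<le> (\<Sum>a\<le>N. \<bar>\<gamma> a\<bar> * R ^ N)"
    unfolding S
  proof (rule sum_abs[THEN order_trans], rule sum_mono)
    fix a assume a: "a \<in> {..N}"
    have "\<bar>\<epsilon> ^ N * \<gamma> a * L a * L (N - a)\<bar> = \<bar>\<gamma> a\<bar> * (\<epsilon> ^ N * (L a * L (N - a)))"
      using \<epsilon> extrapolation_nonneg[of n K a] extrapolation_nonneg[of n K "N - a"]
      by (simp add: abs_mult L_def w_def)
    also have "\<dots> \<le> \<bar>\<gamma> a\<bar> * (\<epsilon> ^ N * ((real n + 1) ^ a * (real n + 1) ^ (N - a)))"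
      using \<epsilon> unfolding L_def w_def
      by (intro mult_left_mono mult_mono extrapolation_le extrapolation_nonneg) auto
    also have "\<dots> = \<bar>\<gamma> a\<bar> * R ^ N" using a by (simp add: RN)
    finally show "\<bar>\<epsilon> ^ N * \<gamma> a * L a * L (N - a)\<bar> \<le> \<bar>\<gamma> a\<bar> * R ^ N" .
  qed
  also have "\<dots> \<le> M * R ^ N"
    unfolding sum_distrib_right[symmetric] using g(2) R \<epsilon> by (intro mult_right_mono zero_le_power) auto
  finally show "\<bar>S\<bar> \<le> M * R ^ N" .
qed

section \<open>Even entire functions\<close>

text \<open>
  Absolute convergence is part of the definition so that products reduce to Cauchy products.
\<close>

definition entire_on_reals :: "(real \<Rightarrow> real) \<Rightarrow> bool" where
  "entire_on_reals f \<longleftrightarrow> (\<exists>a. \<forall>s. summable (\<lambda>k. \<bar>a k * s ^ k\<bar>) \<and> f s = (\<Sum>k. a k * s ^ k))"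

lemma entire_on_reals_const: "entire_on_reals (\<lambda>s. c)"
  unfolding entire_on_reals_def
proof (intro exI[of _ "\<lambda>k. if k = 0 then c else 0"] allI conjI)
  fix s :: real
  have eq: "(\<lambda>k. (if k = 0 then c else 0) * s ^ k) = (\<lambda>k. if k = 0 then c else 0)" by auto
  show "summable (\<lambda>k. \<bar>(if k = 0 then c else 0) * s ^ k\<bar>)"
    by (rule summable_finite[of "{0}"]) auto
  show "c = (\<Sum>k. (if k = 0 then c else 0) * s ^ k)"
    unfolding eq by (subst suminf_finite[of "{0}"]) auto
qed

lemma entire_on_reals_add:
  assumes "entire_on_reals f" "entire_on_reals g"
  shows "entire_on_reals (\<lambda>s. f s + g s)"
proof -
  obtain a where a: "\<And>s. summable (\<lambda>k. \<bar>a k * s ^ k\<bar>)" "\<And>s. f s = (\<Sum>k. a k * s ^ k)"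
    using assms(1) unfolding entire_on_reals_def by blast
  obtain b where b: "\<And>s. summable (\<lambda>k. \<bar>b k * s ^ k\<bar>)" "\<And>s. g s = (\<Sum>k. b k * s ^ k)"
    using assms(2) unfolding entire_on_reals_def by blast
  show ?thesis unfolding entire_on_reals_def
  proof (intro exI[of _ "\<lambda>k. a k + b k"] allI conjI)
    fix s :: real
    show "summable (\<lambda>k. \<bar>(a k + b k) * s ^ k\<bar>)"
    proof (rule summable_comparison_test'[of _ 0])
      show "summable (\<lambda>k. \<bar>a k * s ^ k\<bar> + \<bar>b k * s ^ k\<bar>)" by (rule summable_add[OF a(1) b(1)])
    qed (simp add: distrib_right abs_triangle_ineq del: abs_mult)
    show "f s + g s = (\<Sum>k. (a k + b k) * s ^ k)"
      unfolding a(2) b(2) distrib_right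
      by (rule suminf_add[OF summable_rabs_cancel[OF a(1)] summable_rabs_cancel[OF b(1)]])
  qed
qed

lemma entire_on_reals_mult:
  assumes "entire_on_reals f" "entire_on_reals g"
  shows "entire_on_reals (\<lambda>s. f s * g s)"
proof -
  obtain a where a: "\<And>s. summable (\<lambda>k. \<bar>a k * s ^ k\<bar>)" "\<And>s. f s = (\<Sum>k. a k * s ^ k)"
    using assms(1) unfolding entire_on_reals_def by blast
  obtain b where b: "\<And>s. summable (\<lambda>k. \<bar>b k * s ^ k\<bar>)" "\<And>s. g s = (\<Sum>k. b k * s ^ k)"
    using assms(2) unfolding entire_on_reals_def by blast
  have split: "(\<Sum>i\<le>k. a i * b (k - i)) * s ^ k = (\<Sum>i\<le>k. (a i * s ^ i) * (b (k - i) * s ^ (k - i)))" for k s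
    unfolding sum_distrib_right
  proof (intro sum.cong refl)
    fix i assume "i \<in> {..k}"
    then have "s ^ k = s ^ i * s ^ (k - i)" by (simp flip: power_add)
    then show "a i * b (k - i) * s ^ k = a i * s ^ i * (b (k - i) * s ^ (k - i))" by simp
  qed
  show ?thesis unfolding entire_on_reals_def
  proof (intro exI[of _ "\<lambda>k. \<Sum>i\<le>k. a i * b (k - i)"] allI conjI)
    fix s :: real
    have "summable (\<lambda>k. \<Sum>i\<le>k. \<bar>a i * s ^ i\<bar> * \<bar>b (k - i) * s ^ (k - i)\<bar>)"
      using a(1)[of s] b(1)[of s] by (intro summable_Cauchy_product) auto
    then show "summable (\<lambda>k. \<bar>(\<Sum>i\<le>k. a i * b (k - i)) * s ^ k\<bar>)"
    proof (rule summable_comparison_test'[of _ 0])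
      fix k
      show "norm \<bar>(\<Sum>i\<le>k. a i * b (k - i)) * s ^ k\<bar> \<le> (\<Sum>i\<le>k. \<bar>a i * s ^ i\<bar> * \<bar>b (k - i) * s ^ (k - i)\<bar>)"
        unfolding split real_norm_def abs_abs by (rule order_trans[OF sum_abs]) (simp add: abs_mult)
    qed
    show "f s * g s = (\<Sum>k. (\<Sum>i\<le>k. a i * b (k - i)) * s ^ k)"
      unfolding a(2) b(2) split using a(1)[of s] b(1)[of s] by (intro Cauchy_product) auto
  qed
qed

lemma entire_on_reals_power: "entire_on_reals f \<Longrightarrow> entire_on_reals (\<lambda>s. f s ^ n)"
  by (induction n) (auto intro: entire_on_reals_const entire_on_reals_mult)

lemma entire_on_reals_factorial:
  assumes "\<And>k. \<bar>a k\<bar> \<le> 1 / fact k"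
  shows "entire_on_reals (\<lambda>s. \<Sum>k. a k * s ^ k)"
  unfolding entire_on_reals_def
proof (intro exI[of _ a] allI conjI refl)
  fix s :: real
  have "summable (\<lambda>k. inverse (fact k) * \<bar>s\<bar> ^ k)" by (rule summable_exp)
  then show "summable (\<lambda>k. \<bar>a k * s ^ k\<bar>)"
  proof (rule summable_comparison_test'[of _ 0])
    fix k
    show "norm \<bar>a k * s ^ k\<bar> \<le> inverse (fact k) * \<bar>s\<bar> ^ k"
      using mult_right_mono[OF assms[of k], of "\<bar>s\<bar> ^ k"] by (simp add: abs_mult power_abs inverse_eq_divide)
  qed
qed

lemma entire_cos: obtains C where "entire_on_reals C" "\<And>t. cos t = C (t\<^sup>2)"
proof (rule that)
  show "entire_on_reals (\<lambda>s. \<Sum>k. (-1) ^ k / fact (2 * k) * s ^ k)"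
    by (intro entire_on_reals_factorial) (auto simp: abs_mult intro!: divide_left_mono fact_mono)
  show "cos t = (\<Sum>k. (-1) ^ k / fact (2 * k) * (t\<^sup>2) ^ k)" for t :: real
    using cos_paired[of t] by (simp add: sums_iff power_mult)
qed

lemma entire_sinc: obtains S where "entire_on_reals S" "\<And>t. sin t = t * S (t\<^sup>2)"
proof (rule that)
  let ?S = "\<lambda>s. \<Sum>k. (-1) ^ k / fact (2 * k + 1) * s ^ k"
  show S: "entire_on_reals ?S"
    by (intro entire_on_reals_factorial) (auto simp: abs_mult intro!: divide_left_mono fact_mono simp del: fact_Suc)
  fix t :: real
  have "summable (\<lambda>k. (-1) ^ k / fact (2 * k + 1) * (t\<^sup>2) ^ k)"
  proof -
    have "summable (\<lambda>k. inverse (fact k) * \<bar>t\<^sup>2\<bar> ^ k)" by (rule summable_exp)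
    then show ?thesis
    proof (rule summable_comparison_test'[of _ 0])
      fix k
      have "(fact k :: real) \<le> fact (2 * k + 1)" by (intro fact_mono) auto
      then show "norm ((-1) ^ k / fact (2 * k + 1) * (t\<^sup>2) ^ k :: real) \<le> inverse (fact k) * \<bar>t\<^sup>2\<bar> ^ k"
        by (auto simp: abs_mult power_abs inverse_eq_divide intro!: mult_right_mono divide_left_mono simp del: fact_Suc)
    qed
  qed
  then have "t * ?S (t\<^sup>2) = (\<Sum>k. t * ((-1) ^ k / fact (2 * k + 1) * (t\<^sup>2) ^ k))"
    by (rule suminf_mult[symmetric])
  also have "\<dots> = (\<Sum>k. (-1) ^ k / fact (2 * k + 1) * t ^ (2 * k + 1))"
    by (simp add: power_mult[symmetric] mult_ac del: fact_Suc)
  also have "\<dots> = sin t"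
    using sums_unique[OF sin_paired[of t]] by simp
  finally show "sin t = t * ?S (t\<^sup>2)" by simp
qed

text \<open>
  Expand \<open>G\<close> in its power series. The terms of degree below \<open>K / 2\<close> are reproduced exactly, and the
  others are bounded, before and after extrapolation, by the tail of an absolutely convergent
  series that depends on neither \<open>n\<close> nor the vectors. So \<open>n\<close> may be chosen after \<open>K\<close>, which
  shrinks the nodes \<open>\<epsilon> * (j + 1)\<close> with \<open>j < K\<close> as much as desired.
\<close>

lemma entire_extrapolation:
  assumes G: "entire_on_reals G" and e: "e > 0" and R: "R \<ge> 0"
  obtains K0 where "\<And>K n \<epsilon> y z. K \<ge> K0 \<Longrightarrow> \<epsilon> \<ge> 0 \<Longrightarrow> (real n + 1) * \<epsilon> = R \<Longrightarrow>
     norm (y::'a::real_inner) \<le> 1 \<Longrightarrow> norm (z::'a) \<le> 1 \<Longrightarrow>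
     \<bar>(\<Sum>i<K. \<Sum>j<K. extrapolation_weight n K i * extrapolation_weight n K j *
         G ((norm ((\<epsilon> * (real i + 1)) *\<^sub>R y + (\<epsilon> * (real j + 1)) *\<^sub>R z))\<^sup>2)) - G ((norm (R *\<^sub>R y + R *\<^sub>R z))\<^sup>2)\<bar> \<le> e"
proof -
  obtain a where a: "\<And>s. summable (\<lambda>k. \<bar>a k * s ^ k\<bar>)" "\<And>s. G s = (\<Sum>k. a k * s ^ k)"
    using G unfolding entire_on_reals_def by blast
  define b where "b k = 2 * \<bar>a k * (4 * R\<^sup>2) ^ k\<bar>" for k
  have b: "summable b" unfolding b_def by (intro summable_mult a)
  obtain k0 where k0: "\<And>k. k \<ge> k0 \<Longrightarrow> norm (\<Sum>i. b (i + k)) < e"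
    using suminf_exist_split[OF e b] by blast
  show ?thesis
  proof (rule that[of "2 * k0"])
    fix K n :: nat and \<epsilon> :: real and y z :: 'a
    assume K: "K \<ge> 2 * k0" and \<epsilon>: "\<epsilon> \<ge> 0" "(real n + 1) * \<epsilon> = R" and yz: "norm y \<le> 1" "norm z \<le> 1"
    define w where "w = extrapolation_weight n K"
    define f where "f k \<rho> \<sigma> = ((norm (\<rho> *\<^sub>R y + \<sigma> *\<^sub>R z))\<^sup>2) ^ k" for k \<rho> \<sigma>
    define S where "S k = (\<Sum>i<K. \<Sum>j<K. w i * w j * f k (\<epsilon> * (real i + 1)) (\<epsilon> * (real j + 1)))" for k
    have f: "homogeneous_bounded (2 * k) (4 ^ k) (f k)" for k
      unfolding f_def by (rule homogeneous_bounded_norm_power[OF yz])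
    have sums: "(\<lambda>k. a k * f k \<rho> \<sigma>) sums G ((norm (\<rho> *\<^sub>R y + \<sigma> *\<^sub>R z))\<^sup>2)" for \<rho> \<sigma>
      unfolding a(2) f_def by (rule summable_sums[OF summable_rabs_cancel[OF a(1)]])
    have "(\<lambda>k. a k * S k) sums (\<Sum>i<K. \<Sum>j<K. w i * w j *
         G ((norm ((\<epsilon> * (real i + 1)) *\<^sub>R y + (\<epsilon> * (real j + 1)) *\<^sub>R z))\<^sup>2))"
    proof -
      have "(\<lambda>k. \<Sum>i<K. \<Sum>j<K. w i * w j * (a k * f k (\<epsilon> * (real i + 1)) (\<epsilon> * (real j + 1)))) sums
       (\<Sum>i<K. \<Sum>j<K. w i * w j * G ((norm ((\<epsilon> * (real i + 1)) *\<^sub>R y + (\<epsilon> * (real j + 1)) *\<^sub>R z))\<^sup>2))"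
        by (rule sums_sum, rule sums_sum, rule sums_mult, rule sums)
      moreover have "(\<Sum>i<K. \<Sum>j<K. w i * w j * (a k * f k (\<epsilon> * (real i + 1)) (\<epsilon> * (real j + 1)))) = a k * S k" for k
        unfolding S_def by (simp add: sum_distrib_left mult_ac)
      ultimately show ?thesis by (simp only:)
    qed
    then have d: "(\<lambda>k. a k * S k - a k * f k R R) sums ((\<Sum>i<K. \<Sum>j<K. w i * w j *
         G ((norm ((\<epsilon> * (real i + 1)) *\<^sub>R y + (\<epsilon> * (real j + 1)) *\<^sub>R z))\<^sup>2)) - G ((norm (R *\<^sub>R y + R *\<^sub>R z))\<^sup>2))"
      (is "_ sums ?D")
      by (rule sums_diff[OF _ sums])
    have zero: "a k * S k - a k * f k R R = 0" if "k < k0" for k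
    proof -
      have "S k = f k R R"
        unfolding S_def w_def using that K by (intro homogeneous_bounded_extrapolation(1)[OF f \<epsilon>]) auto
      then show ?thesis by simp
    qed
    have fR: "\<bar>f k R R\<bar> \<le> (4 * R\<^sup>2) ^ k" for k
    proof -
      have "norm (R *\<^sub>R y + R *\<^sub>R z) \<le> 2 * R"
        using norm_triangle_ineq[of "R *\<^sub>R y" "R *\<^sub>R z"] mult_left_mono[OF yz(1) R] mult_left_mono[OF yz(2) R] R
        by simp
      then have "(norm (R *\<^sub>R y + R *\<^sub>R z))\<^sup>2 \<le> (2 * R)\<^sup>2" by (intro power_mono) auto
      then have "((norm (R *\<^sub>R y + R *\<^sub>R z))\<^sup>2) ^ k \<le> (4 * R\<^sup>2) ^ k"
        by (intro power_mono) (auto simp: power_mult_distrib)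
      then show ?thesis by (simp add: f_def)
    qed
    have le: "norm (a k * S k - a k * f k R R) \<le> b k" for k
    proof -
      have "\<bar>S k\<bar> \<le> 4 ^ k * R ^ (2 * k)"
        unfolding S_def w_def by (rule homogeneous_bounded_extrapolation(2)[OF f \<epsilon>])
      then have "\<bar>S k\<bar> \<le> (4 * R\<^sup>2) ^ k" by (simp add: power_mult_distrib power_mult)
      then have "\<bar>S k - f k R R\<bar> \<le> 2 * (4 * R\<^sup>2) ^ k"
        using fR[of k] by linarith
      then have "\<bar>a k\<bar> * \<bar>S k - f k R R\<bar> \<le> \<bar>a k\<bar> * (2 * (4 * R\<^sup>2) ^ k)"
        by (rule mult_left_mono) auto
      then show ?thesis
        by (simp add: b_def abs_mult right_diff_distrib[symmetric])
    qed
    have "?D = (\<Sum>k. a k * S k - a k * f k R R)" using d by (rule sums_unique)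
    also have "\<dots> = (\<Sum>k. a (k + k0) * S (k + k0) - a (k + k0) * f (k + k0) R R)"
      using suminf_split_initial_segment[OF sums_summable[OF d], of k0] zero by simp
    finally have "\<bar>?D\<bar> = norm (\<Sum>k. a (k + k0) * S (k + k0) - a (k + k0) * f (k + k0) R R)" by simp
    also have "\<dots> \<le> (\<Sum>k. b (k + k0))"
      by (rule norm_suminf_le[OF le]) (use b in \<open>simp add: summable_iff_shift\<close>)
    also have "\<dots> \<le> e" using k0[of k0] by simp
    finally show "\<bar>(\<Sum>i<K. \<Sum>j<K. extrapolation_weight n K i * extrapolation_weight n K j *
         G ((norm ((\<epsilon> * (real i + 1)) *\<^sub>R y + (\<epsilon> * (real j + 1)) *\<^sub>R z))\<^sup>2)) - G ((norm (R *\<^sub>R y + R *\<^sub>R z))\<^sup>2)\<bar> \<le> e"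
      by (simp add: w_def)
  qed
qed

section \<open>Smooth functions, bumps and convolutions\<close>

lemma Ck_imp_continuous: "Ck k f \<Longrightarrow> continuous_on UNIV f"
  by (cases k) (auto simp: continuous_on_eq_continuous_at differentiable_imp_continuous_within)

lemma Ck_Suc_imp_Ck: "Ck (Suc k) f \<Longrightarrow> Ck k f"
  by (induction k arbitrary: f) (use Ck_imp_continuous in fastforce, simp)

lemma Ck_SucI:
  assumes "\<And>x. (f has_derivative f' x) (at x)" and "\<And>b. b \<in> Basis \<Longrightarrow> Ck k (\<lambda>x. f' x b)"
  shows "Ck (Suc k) f"
proof -
  have "frechet_derivative f (at x) = f' x" for x
    using frechet_derivative_at[OF assms(1)] by simp
  with assms show ?thesis by (auto intro: differentiableI)
qed

lemma Ck_SucD: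
  assumes "Ck (Suc k) f"
  shows "(f has_derivative frechet_derivative f (at x)) (at x)"
    and "b \<in> Basis \<Longrightarrow> Ck k (\<lambda>x. frechet_derivative f (at x) b)"
  using assms by (auto simp: frechet_derivative_works[symmetric])

lemma Ck_const: "Ck k (\<lambda>x::'a::euclidean_space. c)"
proof (induction k arbitrary: c)
  case (Suc k)
  show ?case by (rule Ck_SucI[where f' = "\<lambda>x v. 0"]) (auto intro: Suc)
qed auto

lemma Ck_add: "Ck k f \<Longrightarrow> Ck k g \<Longrightarrow> Ck k (\<lambda>x. f x + g x)"
proof (induction k arbitrary: f g)
  case (Suc k)
  show ?case
    by (rule Ck_SucI[OF has_derivative_add[OF Ck_SucD(1)[OF Suc.prems(1)] Ck_SucD(1)[OF Suc.prems(2)]]])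
      (intro Suc.IH Ck_SucD(2) Suc.prems)
qed (auto intro: continuous_intros)

lemma Ck_mult: "Ck k f \<Longrightarrow> Ck k g \<Longrightarrow> Ck k (\<lambda>x. f x * g x)"
proof (induction k arbitrary: f g)
  case (Suc k)
  show ?case
    by (rule Ck_SucI[OF has_derivative_mult[OF Ck_SucD(1)[OF Suc.prems(1)] Ck_SucD(1)[OF Suc.prems(2)]]])
      (intro Ck_add Suc.IH Ck_SucD(2) Suc.prems Ck_Suc_imp_Ck)
qed (auto intro: continuous_intros)

lemma Ck_inner: "Ck k (\<lambda>x. x \<bullet> b)"
proof (cases k)
  case (Suc l)
  show ?thesis unfolding Suc
    by (rule Ck_SucI[where f' = "\<lambda>x v. v \<bullet> b"]) (auto intro!: derivative_eq_intros Ck_const)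
qed (auto intro: continuous_intros)

lemma Ck_sum: "(\<And>i. i \<in> I \<Longrightarrow> Ck k (f i)) \<Longrightarrow> Ck k (\<lambda>x. \<Sum>i\<in>I. f i x)"
  by (induction I rule: infinite_finite_induct) (auto intro: Ck_const Ck_add)

text \<open>
  For \<open>j = 0\<close> this is the classical smooth function that is flat at the origin. The factors \<open>u ^ j\<close>
  make the family closed under differentiation, up to linear combinations.
\<close>

definition cutoff :: "nat \<Rightarrow> real \<Rightarrow> real" where
  "cutoff j u = (if u > 0 then exp (- (1 / u)) / u ^ j else 0)"

text \<open>
  With \<open>v = 1 / u\<close> the right-hand limit is \<open>v ^ j / exp v \<rightarrow> 0\<close>.
\<close>

lemma tendsto_cutoff_0: "(cutoff j \<longlongrightarrow> 0) (at 0)"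
proof -
  have "((\<lambda>u. (inverse u) ^ j / exp (inverse u)) \<longlongrightarrow> (0::real)) (at_right 0)"
    by (rule filterlim_compose[OF tendsto_power_div_exp_0 filterlim_inverse_at_top_right])
  then have "(cutoff j \<longlongrightarrow> 0) (at_right 0)"
  proof (rule Lim_transform_eventually)
    show "\<forall>\<^sub>F u in at_right 0. (inverse u) ^ j / exp (inverse u) = cutoff j u"
      unfolding eventually_at_right_field
      by (intro exI[of _ 1]) (auto simp: cutoff_def exp_minus field_simps)
  qed
  moreover have "(cutoff j \<longlongrightarrow> 0) (at_left 0)"
    by (rule tendsto_eventually)
      (auto simp: eventually_at_left_field cutoff_def intro!: exI[of _ "-1"])
  ultimately show ?thesis using filterlim_split_at by blast
qed

text \<open>
  At \<open>u = 0\<close> the difference quotient of \<open>cutoff j\<close> is \<open>cutoff (j + 1)\<close>, which tends to \<open>0\<close>.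
\<close>

lemma has_derivative_cutoff:
  "(cutoff j has_real_derivative (cutoff (j + 2) u - real j * cutoff (j + 1) u)) (at u)"
proof -
  consider "u > 0" | "u < 0" | "u = 0" by linarith
  then show ?thesis
  proof cases
    case 1
    have e: "((\<lambda>u. exp (- (1 / u))) has_real_derivative exp (- (1 / u)) / u\<^sup>2) (at u)"
      using 1 by (auto intro!: derivative_eq_intros simp: power2_eq_square)
    have "((\<lambda>u. inverse u) has_real_derivative - (1 / u\<^sup>2)) (at u)"
      using 1 by (auto intro!: derivative_eq_intros simp: power2_eq_square field_simps)
    from DERIV_mult[OF e DERIV_power[OF this, of j]]
    have "((\<lambda>u. exp (- (1 / u)) * inverse u ^ j) has_real_derivative (cutoff (j + 2) u - real j * cutoff (j + 1) u)) (at u)"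
      using 1 by (cases j) (simp_all add: cutoff_def field_simps power2_eq_square)
    then show ?thesis
      by (rule has_field_derivative_transform_within_open[where S = "{0<..}"]) (use 1 in \<open>auto simp: cutoff_def field_simps\<close>)
  next
    case 2
    have "((\<lambda>u. 0) has_real_derivative 0) (at u)" by simp
    then have "(cutoff j has_real_derivative 0) (at u)"
      by (rule has_field_derivative_transform_within_open[where S = "{..<0}"]) (use 2 in \<open>auto simp: cutoff_def\<close>)
    then show ?thesis using 2 by (simp add: cutoff_def)
  next
    case 3
    have "((\<lambda>h. (cutoff j h - cutoff j 0) / h) \<longlongrightarrow> 0) (at 0)"
      by (rule Lim_transform_eventually[OF tendsto_cutoff_0[of "Suc j"]])
        (auto simp: cutoff_def eventually_at_filter)
    then have "(cutoff j has_real_derivative 0) (at 0)" by (simp add: DERIV_def)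
    then show ?thesis using 3 by (simp add: cutoff_def)
  qed
qed

definition bump :: "real \<Rightarrow> 'a::euclidean_space \<Rightarrow> real" where
  "bump a x = cutoff 0 (1 - a * (x \<bullet> x))"

text \<open>
  The induction on the order of differentiability must be uniform in \<open>j\<close>, because each
  derivative raises \<open>j\<close>.
\<close>

lemma smooth_bump: "smooth (bump a)"
proof -
  have "Ck k (\<lambda>x::'a. cutoff j (1 - a * (x \<bullet> x)))" for k j
  proof (induction k arbitrary: j)
    case 0
    have "continuous_on UNIV (cutoff j)"
      using has_derivative_cutoff DERIV_isCont by (metis continuous_at_imp_continuous_on)
    then have "continuous_on UNIV (\<lambda>x::'a. cutoff j (1 - a * (x \<bullet> x)))"
      by (rule continuous_on_compose2) (auto intro!: continuous_intros)
    then show ?case by simp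
  next
    case (Suc k)
    let ?u = "\<lambda>x::'a. 1 - a * (x \<bullet> x)"
    show ?case
    proof (rule Ck_SucI)
      fix x :: 'a
      have u: "(?u has_derivative (\<lambda>v. - 2 * a * (x \<bullet> v))) (at x)"
        by (auto intro!: derivative_eq_intros simp: inner_commute)
      show "((\<lambda>x. cutoff j (?u x)) has_derivative
        (\<lambda>v. (cutoff (j + 2) (?u x) + (- real j) * cutoff (j + 1) (?u x)) * (- 2 * a * (x \<bullet> v)))) (at x)"
        using has_derivative_compose[OF u has_derivative_cutoff[of j "?u x", unfolded has_field_derivative_def]]
        by simp
    qed (intro Ck_mult Ck_add Ck_const Ck_inner Suc)
  qed
  then show ?thesis by (simp add: smooth_def bump_def[abs_def])
qed

lemma bump_nonneg: "bump a x \<ge> 0"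
  by (simp add: bump_def cutoff_def)

definition convolution :: "('a::euclidean_space \<Rightarrow> real) \<Rightarrow> ('a \<Rightarrow> real) \<Rightarrow> 'a \<Rightarrow> real" where
  "convolution H K x = (\<integral>y. H y * K (x - y) \<partial>lborel)"

lemma integrable_compact_support:
  fixes f :: "'a::euclidean_space \<Rightarrow> real"
  assumes "continuous_on UNIV f" and "\<And>x. norm x > R \<Longrightarrow> f x = 0"
  shows "integrable lborel f"
proof -
  have "integrable lborel (\<lambda>x. indicator (cball 0 R) x *\<^sub>R f x)"
    by (rule borel_integrable_compact) (auto intro: continuous_on_subset[OF assms(1)])
  also have "(\<lambda>x. indicator (cball 0 R) x *\<^sub>R f x) = f"
    using assms(2) by (force simp: indicator_def)
  finally show ?thesis .
qed

lemma lborel_integral_eq_cbox_integral: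
  fixes f :: "'a::euclidean_space \<Rightarrow> real"
  assumes "continuous_on UNIV f" and "\<And>x. x \<notin> cbox a b \<Longrightarrow> f x = 0"
  shows "(\<integral>x. f x \<partial>lborel) = integral (cbox a b) f"
proof -
  have "integrable lborel (\<lambda>x. indicator (cbox a b) x *\<^sub>R f x)"
    by (rule borel_integrable_compact) (auto intro: continuous_on_subset[OF assms(1)])
  then have "(LINT x : cbox a b | lborel. f x) = integral (cbox a b) f"
    by (intro set_borel_integral_eq_integral(2)) (simp add: set_integrable_def)
  moreover have "(\<lambda>x. indicator (cbox a b) x *\<^sub>R f x) = f"
    using assms(2) by (force simp: indicator_def)
  ultimately show ?thesis by (simp add: set_lebesgue_integral_def)
qed

text \<open>
  Differentiation under the integral sign. The integral extends over a fixed box containing the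
  support of \<open>H\<close>, and the derivative of the integrand is continuous in both variables jointly.
\<close>

lemma has_derivative_convolution:
  fixes H K :: "'a::euclidean_space \<Rightarrow> real"
  assumes H: "continuous_on UNIV H" "\<And>y. norm y > R \<Longrightarrow> H y = 0"
    and K: "\<And>x. (K has_derivative K' x) (at x)" and K': "\<And>b. b \<in> Basis \<Longrightarrow> continuous_on UNIV (\<lambda>x. K' x b)"
  shows "(convolution H K has_derivative (\<lambda>v. convolution H (\<lambda>x. K' x v) x)) (at x)"
proof -
  obtain c where c: "cball (0::'a) R \<subseteq> cbox (-c) c"
    using bounded_subset_cbox_symmetric[OF bounded_cball] by blast
  have H0: "H y = 0" if "y \<notin> cbox (-c) c" for y
    using H(2)[of y] that c by (meson in_mono mem_cball_0 not_le)
  have lin: "bounded_linear (K' x)" for x using K has_derivative_bounded_linear by blast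
  have contK: "continuous_on UNIV K"
    using has_derivative_continuous_on[of UNIV K K'] K by (simp add: has_derivative_at_withinI)
  have contK': "continuous_on UNIV (\<lambda>x. K' x v)" for v
  proof -
    have "K' x v = (\<Sum>b\<in>Basis. (v \<bullet> b) * K' x b)" for x
      using linear_sum[OF bounded_linear.linear[OF lin], of _ "\<lambda>b. (v \<bullet> b) *\<^sub>R b" Basis]
      by (simp add: euclidean_representation linear_scale[OF bounded_linear.linear[OF lin]])
    then show ?thesis by (auto intro!: continuous_intros K')
  qed
  have conv: "convolution H L x = integral (cbox (-c) c) (\<lambda>y. H y * L (x - y))" if "continuous_on UNIV L" for L x
    unfolding convolution_def
    by (rule lborel_integral_eq_cbox_integral)
      (auto intro!: continuous_intros continuous_on_compose2[OF that] H(1) simp: H0)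
  define fx where "fx x t = blinfun_of_matrix (\<lambda>i j. H t * K' (x - t) j * i)" for x t
  have fx: "blinfun_apply (fx x t) = (\<lambda>v. H t * K' (x - t) v)" for x t
  proof
    fix v
    have "blinfun_apply (fx x t) v = H t * (\<Sum>b\<in>Basis. (v \<bullet> b) * K' (x - t) b)"
      by (simp add: fx_def blinfun_of_matrix_apply sum_distrib_left mult_ac)
    also have "(\<Sum>b\<in>Basis. (v \<bullet> b) * K' (x - t) b) = K' (x - t) (\<Sum>b\<in>Basis. (v \<bullet> b) *\<^sub>R b)"
      using bounded_linear.linear[OF lin, of "x - t"] by (simp add: linear_sum linear_scale)
    finally show "blinfun_apply (fx x t) v = H t * K' (x - t) v" by (simp add: euclidean_representation)
  qed
  have cont: "continuous_on (UNIV \<times> cbox (-c) c) (\<lambda>(x, t). fx x t)"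
    unfolding fx_def case_prod_beta
    by (intro continuous_intros continuous_on_compose2[OF H(1)] continuous_on_compose2[OF K']) auto
  have "((\<lambda>x. integral (cbox (-c) c) (\<lambda>y. H y * K (x - y))) has_derivative integral (cbox (-c) c) (fx x)) (at x within UNIV)"
  proof (rule leibniz_rule[OF _ _ cont])
    fix x t :: 'a
    have "((\<lambda>x. x - t) has_derivative (\<lambda>v. v)) (at x)" by (auto intro!: derivative_eq_intros)
    from has_derivative_mult_right[OF has_derivative_compose[OF this K], of "H t"]
    show "((\<lambda>x. H t * K (x - t)) has_derivative blinfun_apply (fx x t)) (at x within UNIV)"
      by (simp add: fx)
    show "(\<lambda>y. H y * K (x - y)) integrable_on cbox (-c) c"
      by (intro integrable_continuous continuous_intros continuous_on_compose2[OF H(1)] continuous_on_compose2[OF contK]) auto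
  qed auto
  moreover have "blinfun_apply (integral (cbox (-c) c) (fx x)) = (\<lambda>v. convolution H (\<lambda>x. K' x v) x)"
  proof
    fix v
    have "continuous_on (cbox (-c) c) (fx x)"
      unfolding fx_def
      by (intro continuous_intros continuous_on_compose2[OF H(1)] continuous_on_compose2[OF K']) auto
    then have "integral (cbox (-c) c) ((\<lambda>l. blinfun_apply l v) \<circ> fx x) = blinfun_apply (integral (cbox (-c) c) (fx x)) v"
      by (intro integral_linear integrable_continuous blinfun.bounded_linear_left)
    then show "blinfun_apply (integral (cbox (-c) c) (fx x)) v = convolution H (\<lambda>x. K' x v) x"
      by (simp add: conv[OF contK'] o_def fx)
  qed
  moreover have "convolution H K = (\<lambda>x. integral (cbox (-c) c) (\<lambda>y. H y * K (x - y)))"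
    using conv[OF contK] by auto
  ultimately show ?thesis by simp
qed

lemma continuous_convolution:
  fixes H K :: "'a::euclidean_space \<Rightarrow> real"
  assumes H: "continuous_on UNIV H" "\<And>y. norm y > R \<Longrightarrow> H y = 0" and K: "continuous_on UNIV K"
  shows "continuous_on UNIV (convolution H K)"
proof -
  obtain c where c: "cball (0::'a) R \<subseteq> cbox (-c) c"
    using bounded_subset_cbox_symmetric[OF bounded_cball] by blast
  have H0: "H y = 0" if "y \<notin> cbox (-c) c" for y
    using H(2)[of y] that c by (meson in_mono mem_cball_0 not_le)
  have "convolution H K x = integral (cbox (-c) c) (\<lambda>y. H y * K (x - y))" for x
    unfolding convolution_def
    by (rule lborel_integral_eq_cbox_integral)
      (auto intro!: continuous_intros continuous_on_compose2[OF K] H(1) simp: H0)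
  moreover have "continuous_on UNIV (\<lambda>x. integral (cbox (-c) c) (\<lambda>y. H y * K (x - y)))"
    by (rule integral_continuous_on_param)
      (auto simp: case_prod_beta intro!: continuous_intros continuous_on_compose2[OF K] continuous_on_compose2[OF H(1)])
  ultimately show ?thesis by presburger
qed

lemma Ck_convolution:
  fixes H K :: "'a::euclidean_space \<Rightarrow> real"
  assumes H: "continuous_on UNIV H" "\<And>y. norm y > R \<Longrightarrow> H y = 0"
  shows "Ck k K \<Longrightarrow> Ck k (convolution H K)"
proof (induction k arbitrary: K)
  case 0
  then show ?case using continuous_convolution[OF H] by simp
next
  case (Suc k)
  show ?case
    by (rule Ck_SucI[OF has_derivative_convolution[OF H Ck_SucD(1)[OF Suc.prems]]])
      (use Suc Ck_SucD(2)[OF Suc.prems] Ck_imp_continuous in blast)+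
qed

lemma convolution_eq_0:
  assumes "\<And>y. norm y > R \<Longrightarrow> H y = 0" "\<And>y. norm y > S \<Longrightarrow> K y = 0" "norm x > R + S"
  shows "convolution H K x = 0"
proof -
  have "H y * K (x - y) = 0" for y
    using assms(1)[of y] assms(2)[of "x - y"] assms(3) norm_triangle_sub[of x y] by force
  then have "(\<lambda>y. H y * K (x - y)) = (\<lambda>y. 0)" by blast
  then show ?thesis by (simp add: convolution_def)
qed

section \<open>Rotation invariance, polar coordinates and positive definiteness\<close>

text \<open>
  Both measures assign \<open>unit_ball_vol d * r ^ d\<close> to \<open>{..r}\<close>, and such half-lines generate the Borel
  sets.
\<close>

lemma distr_norm_lborel:
  "distr lborel borel (norm :: 'a::euclidean_space \<Rightarrow> real) =
     density lborel (\<lambda>t. ennreal (unit_ball_vol (DIM('a)) * (real DIM('a) * t ^ (DIM('a) - 1))) * indicator {0..} t)"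
  (is "_ = density lborel ?w")
proof (rule measure_eqI_generator_eq[where E = "range (\<lambda>r. {..r})" and \<Omega> = UNIV and A = "\<lambda>i. {..real i}"])
  have distr: "emeasure (distr lborel borel (norm :: 'a \<Rightarrow> real)) {..r} = (if r \<ge> 0 then ennreal (unit_ball_vol (DIM('a)) * r ^ DIM('a)) else 0)" for r
  proof -
    have "emeasure (distr lborel borel (norm :: 'a \<Rightarrow> real)) {..r} = emeasure lborel (cball (0::'a) r)"
      by (subst emeasure_distr) (auto intro!: arg_cong[of _ _ "emeasure lborel"])
    then show ?thesis by (auto simp: emeasure_cball)
  qed
  have dens: "emeasure (density lborel ?w) {..r} = (if r \<ge> 0 then ennreal (unit_ball_vol (DIM('a)) * r ^ DIM('a)) else 0)" for r
  proof -
    have "emeasure (density lborel ?w) {..r} = (\<integral>\<^sup>+t. ?w t * indicator {..r} t \<partial>lborel)"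
      by (subst emeasure_density) auto
    also have "\<dots> = (\<integral>\<^sup>+t. ennreal (unit_ball_vol (DIM('a)) * (real DIM('a) * t ^ (DIM('a) - 1))) * indicator {0..r} t \<partial>lborel)"
      by (intro nn_integral_cong) (auto simp: indicator_def)
    also have "\<dots> = (if r \<ge> 0 then ennreal (unit_ball_vol (DIM('a)) * r ^ DIM('a)) else 0)"
    proof (cases "r \<ge> 0")
      case True
      have "(\<integral>\<^sup>+t. ennreal (unit_ball_vol (DIM('a)) * (real DIM('a) * t ^ (DIM('a) - 1))) * indicator {0..r} t \<partial>lborel)
        = ennreal (unit_ball_vol (DIM('a)) * r ^ DIM('a) - unit_ball_vol (DIM('a)) * 0 ^ DIM('a))"
        using True by (intro nn_integral_FTC_Icc) (auto intro!: derivative_eq_intros)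
      then show ?thesis using True by simp
    qed auto
    finally show ?thesis .
  qed
  show "Int_stable (range (\<lambda>r::real. {..r}))"
    by (auto simp: Int_stable_def intro!: image_eqI)
  show "X \<in> range (\<lambda>r. {..r}) \<Longrightarrow> emeasure (distr lborel borel (norm :: 'a \<Rightarrow> real)) X = emeasure (density lborel ?w) X" for X
    using distr dens by auto
  show "(\<Union>i. {..real i}) = UNIV" using real_arch_simple by auto
  show "emeasure (distr lborel borel (norm :: 'a \<Rightarrow> real)) {..real i} \<noteq> \<infinity>" for i
    using distr[of "real i"] by simp
qed (auto simp: borel_eq_atMost)

lemma polar_nn_integral:
  fixes f :: "real \<Rightarrow> ennreal"
  assumes [measurable]: "f \<in> borel_measurable borel"
  shows "(\<integral>\<^sup>+x. f (norm (x::'a::euclidean_space)) \<partial>lborel) =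
     (\<integral>\<^sup>+t. ennreal (unit_ball_vol (DIM('a)) * (real DIM('a) * t ^ (DIM('a) - 1))) * indicator {0..} t * f t \<partial>lborel)"
proof -
  have "(\<integral>\<^sup>+x. f (norm (x::'a)) \<partial>lborel) = (\<integral>\<^sup>+t. f t \<partial>distr lborel borel (norm :: 'a \<Rightarrow> real))"
    by (subst nn_integral_distr) auto
  also have "\<dots> = (\<integral>\<^sup>+t. ennreal (unit_ball_vol (DIM('a)) * (real DIM('a) * t ^ (DIM('a) - 1))) * indicator {0..} t * f t \<partial>lborel)"
    unfolding distr_norm_lborel by (subst nn_integral_density) auto
  finally show ?thesis .
qed

lemma polar_integral:
  fixes f :: "real \<Rightarrow> real"
  assumes f: "continuous_on UNIV f" and f0: "\<And>t. t > R \<Longrightarrow> f t = 0"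
  shows "(\<integral>x. f (norm (x::'a::euclidean_space)) \<partial>lborel) =
     unit_ball_vol (DIM('a)) * real DIM('a) * integral {0..R} (\<lambda>t. f t * t ^ (DIM('a) - 1))"
proof -
  have [measurable]: "f \<in> borel_measurable borel" using f by (rule borel_measurable_continuous_onI)
  let ?c = "unit_ball_vol (DIM('a)) * real DIM('a)"
  have e: "ennreal (unit_ball_vol (DIM('a)) * (real DIM('a) * t ^ (DIM('a) - 1))) * indicator {0..} t
      = ennreal (?c * t ^ (DIM('a) - 1) * indicator {0..} t)" for t :: real
    by (simp add: indicator_def mult_ac)
  have "(\<integral>x. f (norm (x::'a)) \<partial>lborel) = (\<integral>t. f t \<partial>distr lborel borel (norm :: 'a \<Rightarrow> real))"
    by (subst integral_distr) auto
  also have "\<dots> = (\<integral>t. (?c * t ^ (DIM('a) - 1) * indicator {0..} t) *\<^sub>R f t \<partial>lborel)"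
    unfolding distr_norm_lborel e
    by (subst integral_density) (auto simp: indicator_def)
  also have "\<dots> = (\<integral>t. ?c * (indicator {0..R} t *\<^sub>R (f t * t ^ (DIM('a) - 1))) \<partial>lborel)"
    by (intro Bochner_Integration.integral_cong) (auto simp: indicator_def f0)
  also have "\<dots> = ?c * (LINT t : {0..R} | lborel. f t * t ^ (DIM('a) - 1))"
    unfolding set_lebesgue_integral_def by (subst integral_mult_right_zero) simp
  also have "(LINT t : {0..R} | lborel. f t * t ^ (DIM('a) - 1)) = integral {0..R} (\<lambda>t. f t * t ^ (DIM('a) - 1))"
    by (intro set_borel_integral_eq_integral borel_integrable_atLeastAtMost')
      (auto intro!: continuous_intros continuous_on_subset[OF f])
  finally show ?thesis .
qed

lemma lborel_integral_affine:
  fixes f :: "'a::euclidean_space \<Rightarrow> real"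
  assumes [measurable]: "f \<in> borel_measurable borel" and c: "c \<noteq> 0"
  shows "(\<integral>x. f x \<partial>lborel) = \<bar>c\<bar> ^ DIM('a) * (\<integral>x. f (t + c *\<^sub>R x) \<partial>lborel)"
proof -
  have "(\<integral>x. f x \<partial>lborel) = (\<integral>x. f x \<partial>density (distr lborel borel (\<lambda>x. t + c *\<^sub>R x)) (\<lambda>_. ennreal (\<bar>c\<bar> ^ DIM('a))))"
    using lborel_affine[OF c, of t] by simp
  also have "\<dots> = (\<integral>x. \<bar>c\<bar> ^ DIM('a) *\<^sub>R f (t + c *\<^sub>R x) \<partial>lborel)"
    by (subst integral_density; (subst integral_distr)?) auto
  finally show ?thesis by simp
qed

lemma nn_integral_lborel_translate:
  fixes f :: "'a::euclidean_space \<Rightarrow> ennreal"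
  assumes [measurable]: "f \<in> borel_measurable borel"
  shows "(\<integral>\<^sup>+x. f (x + a) \<partial>lborel) = (\<integral>\<^sup>+x. f x \<partial>lborel)"
proof -
  have "(\<integral>\<^sup>+x. f x \<partial>lborel) = (\<integral>\<^sup>+x. f x \<partial>distr lborel borel ((+) a))"
    by (simp add: lborel_distr_plus)
  then show ?thesis by (subst (asm) nn_integral_distr) (auto simp: add.commute)
qed

text \<open>
  Uniqueness of translation invariant measures, in the form of a double integral. For \<open>g\<close> the
  indicator of the unit ball, with volume \<open>V\<close>, translate \<open>x\<close> in \<open>\<integral>\<integral> g y * f (T x)\<close> to get
  \<open>f (T x + y)\<close>, then translate \<open>y\<close> to get \<open>\<integral>\<integral> g (y - T x) * f y\<close>. Since \<open>T\<close> preserves norms, the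
  integral over \<open>x\<close> is again \<open>V\<close>.
\<close>

lemma nn_integral_orthogonal:
  fixes T :: "'a::euclidean_space \<Rightarrow> 'a" and f :: "'a \<Rightarrow> ennreal"
  assumes T: "orthogonal_transformation T" and f[measurable]: "f \<in> borel_measurable borel"
  shows "(\<integral>\<^sup>+x. f (T x) \<partial>lborel) = (\<integral>\<^sup>+x. f x \<partial>lborel)"
proof -
  have lin: "linear T" using T by (rule orthogonal_transformation_linear)
  have [measurable]: "T \<in> borel_measurable borel"
    using lin by (intro borel_measurable_continuous_onI linear_continuous_on) (simp add: linear_conv_bounded_linear)
  obtain T' where T': "\<And>x. T (T' x) = x"
    using orthogonal_transformation_surj[OF T] by (metis surj_def)
  define g :: "'a \<Rightarrow> ennreal" where "g = indicator (ball 0 1)"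
  have [measurable]: "g \<in> borel_measurable borel" unfolding g_def by (intro borel_measurable_indicator) auto
  define V where "V = emeasure lborel (ball (0::'a) 1)"
  have V: "V \<noteq> 0" "V \<noteq> \<infinity>"
    using unit_ball_vol_pos[of "real DIM('a)"] by (simp_all add: V_def emeasure_ball less_imp_neq[symmetric])
  have gV0: "(\<integral>\<^sup>+x. g x \<partial>lborel) = V"
    unfolding g_def V_def by (rule nn_integral_indicator) simp
  have gV: "(\<integral>\<^sup>+x. g (y - T x) \<partial>lborel) = V" for y
  proof -
    have "g (y - T x) = indicator (ball (T' y) 1) x" for x
    proof -
      have "y - T x = T (T' y - x)" using T'[of y] linear_diff[OF lin] by metis
      then have "norm (y - T x) = norm (T' y - x)" using orthogonal_transformation_norm[OF T] by metis
      then show ?thesis by (simp add: g_def indicator_def dist_norm norm_minus_commute[of "T x" y])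
    qed
    then show ?thesis by (simp add: V_def emeasure_ball)
  qed
  have "V * (\<integral>\<^sup>+x. f (T x) \<partial>lborel) = (\<integral>\<^sup>+y. g y * (\<integral>\<^sup>+x. f (T x) \<partial>lborel) \<partial>lborel)"
    by (subst nn_integral_multc) (auto simp: gV0)
  also have "\<dots> = (\<integral>\<^sup>+y. (\<integral>\<^sup>+x. g y * f (T x + y) \<partial>lborel) \<partial>lborel)"
  proof (intro nn_integral_cong)
    fix y :: 'a
    have "(\<integral>\<^sup>+x. f (T x) \<partial>lborel) = (\<integral>\<^sup>+x. f (T (x + T' y)) \<partial>lborel)"
      by (subst nn_integral_lborel_translate[where f = "\<lambda>x. f (T x)"]) auto
    then show "g y * (\<integral>\<^sup>+x. f (T x) \<partial>lborel) = (\<integral>\<^sup>+x. g y * f (T x + y) \<partial>lborel)"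
      by (subst nn_integral_cmult) (auto simp: linear_add[OF lin] T')
  qed
  also have "\<dots> = (\<integral>\<^sup>+x. (\<integral>\<^sup>+y. g y * f (T x + y) \<partial>lborel) \<partial>lborel)"
    by (rule lborel_pair.Fubini') measurable
  also have "\<dots> = (\<integral>\<^sup>+x. (\<integral>\<^sup>+y. g (y - T x) * f y \<partial>lborel) \<partial>lborel)"
  proof (rule nn_integral_cong)
    fix x :: 'a
    show "(\<integral>\<^sup>+y. g y * f (T x + y) \<partial>lborel) = (\<integral>\<^sup>+y. g (y - T x) * f y \<partial>lborel)"
      using nn_integral_lborel_translate[of "\<lambda>y. g (y - T x) * f y" "T x"] by (simp add: add.commute)
  qed
  also have "\<dots> = (\<integral>\<^sup>+y. (\<integral>\<^sup>+x. g (y - T x) * f y \<partial>lborel) \<partial>lborel)"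
    by (rule lborel_pair.Fubini') measurable
  also have "\<dots> = (\<integral>\<^sup>+y. V * f y \<partial>lborel)"
    by (rule nn_integral_cong, subst nn_integral_multc) (auto simp: gV)
  also have "\<dots> = V * (\<integral>\<^sup>+y. f y \<partial>lborel)"
    by (subst nn_integral_cmult) auto
  finally show ?thesis using V by (simp add: ennreal_mult_cancel_left)
qed

lemma distr_orthogonal_lborel:
  fixes T :: "'a::euclidean_space \<Rightarrow> 'a"
  assumes T: "orthogonal_transformation T"
  shows "distr lborel borel T = lborel"
proof (rule measure_eqI)
  have [measurable]: "T \<in> borel_measurable borel"
    using orthogonal_transformation_linear[OF T]
    by (intro borel_measurable_continuous_onI linear_continuous_on) (simp add: linear_conv_bounded_linear)
  fix A assume "A \<in> sets (distr lborel borel T)"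
  then have [measurable]: "A \<in> sets borel" by simp
  have "emeasure (distr lborel borel T) A = (\<integral>\<^sup>+x. indicator A (T x) \<partial>lborel)"
    by (subst nn_integral_indicator[symmetric], simp, subst nn_integral_distr) auto
  also have "\<dots> = emeasure lborel A" by (subst nn_integral_orthogonal[OF T]) auto
  finally show "emeasure (distr lborel borel T) A = emeasure lborel A" .
qed simp

lemma integral_orthogonal:
  fixes T :: "'a::euclidean_space \<Rightarrow> 'a" and f :: "'a \<Rightarrow> real"
  assumes T: "orthogonal_transformation T" and [measurable]: "f \<in> borel_measurable borel"
  shows "(\<integral>x. f (T x) \<partial>lborel) = (\<integral>x. f x \<partial>lborel)"
proof -
  have [measurable]: "T \<in> borel_measurable borel"
    using orthogonal_transformation_linear[OF T]
    by (intro borel_measurable_continuous_onI linear_continuous_on) (simp add: linear_conv_bounded_linear)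
  have "(\<integral>x. f x \<partial>lborel) = (\<integral>x. f x \<partial>distr lborel borel T)"
    by (simp add: distr_orthogonal_lborel[OF T])
  then show ?thesis by (subst (asm) integral_distr) auto
qed

lemma isotropic_convolution:
  fixes H K :: "real^'n::finite \<Rightarrow> real"
  assumes H: "isotropic H" and K: "isotropic K"
    and [measurable]: "H \<in> borel_measurable borel" "K \<in> borel_measurable borel"
  shows "isotropic (convolution H K)"
  unfolding isotropic_def
proof (intro allI impI)
  fix x x' :: "real^'n" assume "norm x = norm x'"
  then obtain T where T: "orthogonal_transformation T" "T x = x'"
    by (rule orthogonal_transformation_exists)
  have "convolution H K x' = (\<integral>y. H (T y) * K (T x - T y) \<partial>lborel)"
    unfolding convolution_def T(2)[symmetric] by (subst integral_orthogonal[OF T(1)]) auto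
  also have "\<dots> = convolution H K x"
  proof -
    have "H (T y) = H y" "K (T x - T y) = K (x - y)" for y
    proof -
      show "H (T y) = H y" using H orthogonal_transformation_norm[OF T(1)] unfolding isotropic_def by blast
      have "T x - T y = T (x - y)"
        using linear_diff[OF orthogonal_transformation_linear[OF T(1)]] by metis
      then show "K (T x - T y) = K (x - y)"
        using K orthogonal_transformation_norm[OF T(1)] unfolding isotropic_def by metis
    qed
    then show ?thesis by (simp add: convolution_def)
  qed
  finally show "convolution H K x = convolution H K x'" by simp
qed

text \<open>
  After a reflection the quadratic form becomes \<open>\<integral> cmod (\<Sum>j. c j * H (x j - z)) ^ 2\<close> over \<open>z\<close>.
\<close>

lemma positive_definite_autoconvolution:
  fixes H :: "'a::euclidean_space \<Rightarrow> real"
  assumes H: "continuous_on UNIV H" "\<And>y. norm y > R \<Longrightarrow> H y = 0" and even: "\<And>x. H (- x) = H x"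
  shows "positive_definite (\<lambda>x. complex_of_real (convolution H H x))"
  unfolding positive_definite_def
proof (intro allI impI)
  fix N :: nat and x :: "nat \<Rightarrow> 'a" and c :: "nat \<Rightarrow> complex"
  have [measurable]: "H \<in> borel_measurable borel" using H(1) by (rule borel_measurable_continuous_onI)
  have int: "integrable lborel (\<lambda>z. H (u - z) * H (v - z))" for u v :: 'a
  proof (rule integrable_compact_support[where R = "R + norm u"])
    show "continuous_on UNIV (\<lambda>z. H (u - z) * H (v - z))"
      by (intro continuous_intros continuous_on_compose2[OF H(1)]) auto
    fix z :: 'a assume "norm z > R + norm u"
    then have "norm (u - z) > R" using norm_triangle_sub[of z u] by (simp add: norm_minus_commute)
    then show "H (u - z) * H (v - z) = 0" using H(2) by simp
  qed
  have conv: "convolution H H (u - v) = (\<integral>z. H (u - z) * H (v - z) \<partial>lborel)" for u v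
  proof -
    have "convolution H H (u - v) = (\<integral>z. H (u + (-1) *\<^sub>R z) * H (u - v - (u + (-1) *\<^sub>R z)) \<partial>lborel)"
      unfolding convolution_def
      by (subst lborel_integral_affine[where c = "-1" and t = u]) auto
    moreover have "H (u - v - (u + (-1) *\<^sub>R z)) = H (v - z)" for z
      using even[of "v - z"] by (simp add: algebra_simps)
    ultimately show ?thesis by simp
  qed
  have "(\<Sum>i<N. \<Sum>j<N. cnj (c i) * c j * complex_of_real (convolution H H (x i - x j)))
     = (\<Sum>i<N. \<Sum>j<N. (\<integral>z. cnj (c i) * c j * complex_of_real (H (x i - z) * H (x j - z)) \<partial>lborel))"
    unfolding conv by (subst integral_mult_right_zero) (simp only: integral_complex_of_real)
  also have "\<dots> = (\<integral>z. (\<Sum>i<N. \<Sum>j<N. cnj (c i) * c j * complex_of_real (H (x i - z) * H (x j - z))) \<partial>lborel)"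
    by (subst Bochner_Integration.integral_sum; (subst Bochner_Integration.integral_sum)?)
      (auto intro!: Bochner_Integration.integrable_sum integrable_mult_right integrable_of_real int simp del: of_real_mult)
  also have "\<dots> = (\<integral>z. complex_of_real ((cmod (\<Sum>j<N. c j * complex_of_real (H (x j - z))))\<^sup>2) \<partial>lborel)"
  proof (intro Bochner_Integration.integral_cong refl)
    fix z :: 'a
    show "(\<Sum>i<N. \<Sum>j<N. cnj (c i) * c j * complex_of_real (H (x i - z) * H (x j - z)))
      = complex_of_real ((cmod (\<Sum>j<N. c j * complex_of_real (H (x j - z))))\<^sup>2)"
      unfolding complex_norm_square
      by (subst sum.swap) (simp add: sum_product mult_ac)
  qed
  also have "\<dots> = complex_of_real (\<integral>z. (cmod (\<Sum>j<N. c j * complex_of_real (H (x j - z))))\<^sup>2 \<partial>lborel)"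
    by (rule integral_complex_of_real)
  also have "\<dots> \<in> \<real>\<^sub>\<ge>\<^sub>0" by simp
  finally show "(\<Sum>i<N. \<Sum>j<N. cnj (c i) * c j * complex_of_real (convolution H H (x i - x j))) \<in> \<real>\<^sub>\<ge>\<^sub>0" .
qed

lemma positive_definite_real_sum:
  fixes F :: "'a::real_normed_vector \<Rightarrow> real" and N :: nat
  assumes "positive_definite (\<lambda>x. complex_of_real (F x))" "N \<ge> 1"
  shows "(\<Sum>i<N. \<Sum>j<N. c i * c j * F (x i - x j)) \<ge> 0"
proof -
  have "(\<Sum>i<N. \<Sum>j<N. cnj (complex_of_real (c i)) * complex_of_real (c j) * complex_of_real (F (x i - x j))) \<in> \<real>\<^sub>\<ge>\<^sub>0"
    using assms(1)[unfolded positive_definite_def, rule_format, OF assms(2), of "\<lambda>i. complex_of_real (c i)" x] by simp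
  also have "(\<Sum>i<N. \<Sum>j<N. cnj (complex_of_real (c i)) * complex_of_real (c j) * complex_of_real (F (x i - x j)))
    = complex_of_real (\<Sum>i<N. \<Sum>j<N. c i * c j * F (x i - x j))" by simp
  finally show ?thesis by (simp only: nonneg_Reals_of_real_iff)
qed

lemma positive_definite_bound:
  fixes F :: "'a::real_normed_vector \<Rightarrow> real"
  assumes F: "positive_definite (\<lambda>x. complex_of_real (F x))" and even: "F (- x) = F x"
  shows "\<bar>F x\<bar> \<le> F 0"
proof -
  have s: "{..<2::nat} = {0, 1}" by auto
  show ?thesis
    using positive_definite_real_sum[OF F, of 2 "\<lambda>i. 1" "\<lambda>i. if i = 0 then 0 else x"]
      positive_definite_real_sum[OF F, of 2 "\<lambda>i. if i = 0 then 1 else - 1" "\<lambda>i. if i = 0 then 0 else x"] even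
    by (simp add: s)
qed

text \<open>
  The quadratic form at the points \<open>0\<close>, \<open>x\<close>, \<open>2 x\<close> with the coefficients \<open>1\<close>, \<open>- 2\<close>, \<open>1\<close> of a second
  difference.
\<close>

lemma positive_definite_doubling:
  fixes F :: "'a::real_normed_vector \<Rightarrow> real"
  assumes F: "positive_definite (\<lambda>x. complex_of_real (F x))" and even: "\<And>x. F (- x) = F x"
  shows "F 0 - F (2 *\<^sub>R x) \<le> 4 * (F 0 - F x)"
proof -
  have s: "{..<3::nat} = {0, 1, 2}" by auto
  have "x - 2 *\<^sub>R x = - x" "2 *\<^sub>R x - x = x" by (simp_all add: scaleR_2)
  then show ?thesis
    using positive_definite_real_sum[OF F, of 3 "\<lambda>i. if i = 1 then - 2 else 1" "\<lambda>i. real i *\<^sub>R x"] even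
    by (simp add: s)
qed

section \<open>The zonal integral at large scale\<close>

text \<open>
  The zonal spherical harmonic of degree two on \<open>\<S>\<^sup>2\<^sup>m\<close>, as a function of the polar angle, times the
  density of the polar angle up to a constant factor.
\<close>

definition zonal_weight :: "nat \<Rightarrow> real \<Rightarrow> real" where
  "zonal_weight m t = gegenbauer_normalized (real m - 1/2) 2 (cos t) * sin t ^ (2 * m - 1)"

lemma zonal_weight_eq:
  assumes "m \<ge> 1"
  shows "zonal_weight m t = ((2 * real m + 1) * (cos t)\<^sup>2 - 1) / (2 * real m) * sin t ^ (2 * m - 1)"
  using gegenbauer_normalized_2[OF assms] by (simp add: zonal_weight_def)

text \<open>
  Odd powers of the sine are trigonometric polynomials without constant term, so they have
  bounded second antiderivatives. These are built from
  \<open>(sin ^ (n + 2))'' = (n + 2) * (n + 1) * sin ^ n - (n + 2)\<^sup>2 * sin ^ (n + 2)\<close>, and the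
  recursion multiplies the slope at the origin by \<open>(n + 1) / (n + 2)\<close>, which preserves its sign.
  For even powers, and hence in odd dimensions, the antiderivatives grow.
\<close>

lemma odd_sin_power_second_antiderivative:
  obtains p q B where "\<And>t. (p has_real_derivative q t) (at t)"
    "\<And>t. (q has_real_derivative sin t ^ (2 * m + 1)) (at t)"
    "\<And>t. \<bar>p t\<bar> \<le> B" "p 0 = 0" "q 0 < 0"
proof -
  have "\<exists>p q B. (\<forall>t. (p has_real_derivative q t) (at t)) \<and>
    (\<forall>t. (q has_real_derivative sin t ^ (2 * m + 1)) (at t)) \<and> (\<forall>t. \<bar>p t\<bar> \<le> B) \<and> p 0 = 0 \<and> q 0 < 0"
  proof (induction m)
    case 0
    show ?case
      by (intro exI[of _ "\<lambda>t. - sin t"] exI[of _ "\<lambda>t. - cos t"] exI[of _ 1])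
        (auto intro!: derivative_eq_intros)
  next
    case (Suc m)
    then obtain p q B where p: "\<And>t. (p has_real_derivative q t) (at t)"
      and q: "\<And>t. (q has_real_derivative sin t ^ (2 * m + 1)) (at t)"
      and B: "\<And>t. \<bar>p t\<bar> \<le> B" and 0: "p 0 = 0" "q 0 < 0" by blast
    define n where "n = 2 * m + 1"
    \<comment> \<open>The coefficients of the recursion are \<open>(n + 1) / (n + 2)\<close> and \<open>1 / (n + 2)\<^sup>2\<close>.\<close>
    define r where "r = 1 / (real n + 2)"
    have r: "r > 0" "(real n + 2) * r = 1" by (simp_all add: r_def add_pos_nonneg)
    show ?case
    proof (intro exI conjI allI)
      fix t
      show "((\<lambda>t. (real n + 1) * r * p t - r\<^sup>2 * sin t ^ (n + 2)) has_real_derivative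
          ((real n + 1) * r * q t - r * (sin t ^ (n + 1) * cos t))) (at t)"
      proof -
        have "r\<^sup>2 * ((real n + 2) * (sin t ^ (n + 1) * cos t)) = r * (((real n + 2) * r) * (sin t ^ (n + 1) * cos t))"
          by (simp add: power2_eq_square mult_ac)
        then have e: "r\<^sup>2 * ((real n + 2) * (sin t ^ (n + 1) * cos t)) = r * (sin t ^ (n + 1) * cos t)"
          by (simp add: r)
        have "((\<lambda>t. (real n + 1) * r * p t - r\<^sup>2 * sin t ^ (n + 2)) has_real_derivative
          ((real n + 1) * r * q t - r\<^sup>2 * ((real n + 2) * (sin t ^ (n + 1) * cos t)))) (at t)"
          by (rule derivative_eq_intros p refl | simp)+
        then show ?thesis unfolding e .
      qed
      show "((\<lambda>t. (real n + 1) * r * q t - r * (sin t ^ (n + 1) * cos t)) has_real_derivative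
          sin t ^ (2 * Suc m + 1)) (at t)"
      proof -
        have c: "cos t * cos t = 1 - sin t * sin t"
          using sin_cos_squared_add3[of t] by linarith
        have "(real n + 1) * r * sin t ^ n - r * ((real n + 1) * sin t ^ n * (cos t * cos t) - sin t ^ (n + 1) * sin t)
            = ((real n + 2) * r) * (sin t ^ n * (sin t * sin t))"
          unfolding c by (simp add: algebra_simps)
        then have e: "(real n + 1) * r * sin t ^ n - r * ((real n + 1) * sin t ^ n * (cos t * cos t) - sin t ^ (n + 1) * sin t)
            = sin t ^ (2 * Suc m + 1)"
          unfolding r(2) by (simp add: n_def mult_ac)
        have "((\<lambda>t. (real n + 1) * r * q t - r * (sin t ^ (n + 1) * cos t)) has_real_derivative
          ((real n + 1) * r * sin t ^ n - r * ((real n + 1) * sin t ^ n * (cos t * cos t) - sin t ^ (n + 1) * sin t))) (at t)"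
        proof -
          have "((\<lambda>t. sin t ^ (n + 1) * cos t) has_real_derivative
              ((real n + 1) * sin t ^ n * (cos t * cos t) - sin t ^ (n + 1) * sin t)) (at t)"
            using DERIV_mult[OF DERIV_power[OF DERIV_sin, of "n + 1" t] DERIV_cos] by (simp add: algebra_simps)
          from DERIV_diff[OF DERIV_cmult[OF q[folded n_def], of "(real n + 1) * r"] DERIV_cmult[OF this, of r]]
          show ?thesis .
        qed
        then show ?thesis unfolding e .
      qed
      show "\<bar>(real n + 1) * r * p t - r\<^sup>2 * sin t ^ (n + 2)\<bar> \<le> (real n + 1) * r * B + r\<^sup>2"
      proof -
        have "\<bar>(real n + 1) * r * p t\<bar> \<le> (real n + 1) * r * B"
          using r(1) B[of t] by (simp add: abs_mult)
        moreover have "\<bar>r\<^sup>2 * sin t ^ (n + 2)\<bar> \<le> r\<^sup>2"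
        proof -
          have "\<bar>sin t ^ (n + 2)\<bar> \<le> 1" unfolding power_abs by (rule power_le_one) auto
          then have "r\<^sup>2 * \<bar>sin t ^ (n + 2)\<bar> \<le> r\<^sup>2 * 1" by (rule mult_left_mono) simp
          then show ?thesis by (simp add: abs_mult)
        qed
        ultimately show ?thesis by linarith
      qed
    qed (use r(1) 0 in \<open>auto simp: mult_pos_neg\<close>)
  qed
  then show ?thesis using that by blast
qed

text \<open>
  Four integrations by parts. The boundary terms at \<open>L\<close> vanish. Of those at \<open>0\<close> only
  \<open>- f2 0 * q 0 / \<rho> ^ 3\<close> survives, because \<open>p\<close>, \<open>sin ^ (2 * m + 1)\<close> and its derivative vanish there.
  The remaining integral is of order \<open>\<rho> ^ (- 4)\<close>.
\<close>

lemma oscillatory_integral_negative: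
  fixes f0 f1 f2 f3 f4 :: "real \<Rightarrow> real"
  assumes m: "m \<ge> 1"
    and f0: "\<And>t. (f0 has_real_derivative f1 t) (at t)" and f1: "\<And>t. (f1 has_real_derivative f2 t) (at t)"
    and f2: "\<And>t. (f2 has_real_derivative f3 t) (at t)" and f3: "\<And>t. (f3 has_real_derivative f4 t) (at t)"
    and f4: "continuous_on UNIV f4"
    and L: "f0 L = 0" "f1 L = 0" "f2 L = 0" "f3 L = 0" "L \<ge> 0" and neg: "f2 0 < 0"
  obtains \<rho> where "\<rho> > 0" "integral {0..L} (\<lambda>t. f0 t * zonal_weight m (\<rho> * t)) < 0"
proof -
  obtain p q B where p: "\<And>t. (p has_real_derivative q t) (at t)"
    and q: "\<And>t. (q has_real_derivative sin t ^ (2 * m + 1)) (at t)"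
    and B: "\<And>t. \<bar>p t\<bar> \<le> B" and p0: "p 0 = 0" and q0: "q 0 < 0"
    using odd_sin_power_second_antiderivative[of m] by blast
  define s where "s t = (2 * real m + 1) * (sin t ^ (2 * m) * cos t)" for t
  define \<kappa> where "\<kappa> = 2 * real m * (2 * real m + 1)"
  have \<kappa>: "\<kappa> > 0" using m by (simp add: \<kappa>_def)
  have s: "((\<lambda>t. sin t ^ (2 * m + 1)) has_real_derivative s t) (at t)" for t
    using DERIV_power[OF DERIV_sin, of "2 * m + 1" t] by (simp add: s_def mult_ac add_ac)
  have ds: "(s has_real_derivative \<kappa> * zonal_weight m t) (at t)" for t
  proof -
    obtain k where k: "2 * m = Suc (Suc k)" using m by (cases m) auto
    have "((\<lambda>t. (2 * real m + 1) * (sin t ^ (2 * m) * cos t)) has_real_derivative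
        (2 * real m + 1) * ((2 * real m) * (sin t ^ (2 * m - 1) * cos t) * cos t - sin t * sin t ^ (2 * m))) (at t)"
      by (auto intro!: derivative_eq_intros)
    also have "(2 * real m) * (sin t ^ (2 * m - 1) * cos t) * cos t - sin t * sin t ^ (2 * m)
       = sin t ^ (2 * m - 1) * ((2 * real m + 1) * (cos t)\<^sup>2 - 1)"
    proof -
      have "sin t * sin t ^ (2 * m) = sin t ^ (2 * m - 1) * (1 - (cos t)\<^sup>2)"
        unfolding sin_squared_eq[symmetric] by (simp add: k power2_eq_square)
      then show ?thesis by (simp add: algebra_simps power2_eq_square)
    qed
    also have "(2 * real m + 1) * (sin t ^ (2 * m - 1) * ((2 * real m + 1) * (cos t)\<^sup>2 - 1)) = \<kappa> * zonal_weight m t"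
      using m by (simp add: zonal_weight_eq[OF m] \<kappa>_def)
    finally show ?thesis by (simp add: s_def[abs_def])
  qed
  have contw: "continuous_on UNIV (zonal_weight m)"
    unfolding zonal_weight_eq[OF m, abs_def] using m by (intro continuous_intros) auto
  have contp: "continuous_on UNIV p" and contf0: "continuous_on UNIV f0"
    by (auto intro!: continuous_at_imp_continuous_on DERIV_isCont p f0)
  have cont: "continuous_on {0..L} (\<lambda>t. f0 t * (\<kappa> * zonal_weight m (\<rho> * t)))" "continuous_on {0..L} (\<lambda>t. f4 t * p (\<rho> * t))" for \<rho>
    by (intro continuous_intros continuous_on_compose2[OF contw] continuous_on_compose2[OF contp]
        continuous_on_subset[OF contf0] continuous_on_subset[OF f4] subset_UNIV)+
  have "bounded (f4 ` {0..L})"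
    by (intro compact_imp_bounded compact_continuous_image continuous_on_subset[OF f4]) auto
  then obtain M where "\<forall>t\<in>{0..L}. \<bar>f4 t\<bar> \<le> M"
    by (auto simp: bounded_iff)
  then have M: "\<bar>f4 t\<bar> \<le> M" if "t \<in> {0..L}" for t using that by blast
  have M0: "M \<ge> 0" using M[of 0] L(5) by auto
  have B0: "B \<ge> 0" using B[of 0] by auto
  have key: "\<rho> ^ 3 * integral {0..L} (\<lambda>t. f0 t * (\<kappa> * zonal_weight m (\<rho> * t))) \<le> - (f2 0 * q 0) + M * B * L / \<rho>"
    if \<rho>: "\<rho> > 0" for \<rho>
  proof -
    \<comment> \<open>The boundary terms of four integrations by parts, as a single antiderivative.\<close>
    let ?A = "\<lambda>t. f0 t * s (\<rho> * t) / \<rho> - f1 t * sin (\<rho> * t) ^ (2 * m + 1) / \<rho> ^ 2 + f2 t * q (\<rho> * t) / \<rho> ^ 3 - f3 t * p (\<rho> * t) / \<rho> ^ 4"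
    have comp: "((\<lambda>t. g (\<rho> * t)) has_real_derivative g' * \<rho>) (at t)" if "(g has_real_derivative g') (at (\<rho> * t))" for g g' t
      by (rule DERIV_chain2[OF that DERIV_cmult_Id])
    have "(?A has_real_derivative (f0 t * (\<kappa> * zonal_weight m (\<rho> * t)) - f4 t * p (\<rho> * t) / \<rho> ^ 4)) (at t)" for t
    proof -
      have "(?A has_real_derivative
         (f1 t * s (\<rho> * t) + (\<kappa> * zonal_weight m (\<rho> * t) * \<rho>) * f0 t) / \<rho>
       - (f2 t * sin (\<rho> * t) ^ (2 * m + 1) + (s (\<rho> * t) * \<rho>) * f1 t) / \<rho> ^ 2
       + (f3 t * q (\<rho> * t) + (sin (\<rho> * t) ^ (2 * m + 1) * \<rho>) * f2 t) / \<rho> ^ 3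
       - (f4 t * p (\<rho> * t) + (q (\<rho> * t) * \<rho>) * f3 t) / \<rho> ^ 4) (at t)"
        by (intro DERIV_add DERIV_diff DERIV_cdivide DERIV_mult f0 f1 f2 f3 comp[OF ds] comp[OF s] comp[OF p] comp[OF q])
      also have "(f1 t * s (\<rho> * t) + (\<kappa> * zonal_weight m (\<rho> * t) * \<rho>) * f0 t) / \<rho>
       - (f2 t * sin (\<rho> * t) ^ (2 * m + 1) + (s (\<rho> * t) * \<rho>) * f1 t) / \<rho> ^ 2
       + (f3 t * q (\<rho> * t) + (sin (\<rho> * t) ^ (2 * m + 1) * \<rho>) * f2 t) / \<rho> ^ 3
       - (f4 t * p (\<rho> * t) + (q (\<rho> * t) * \<rho>) * f3 t) / \<rho> ^ 4
       = f0 t * (\<kappa> * zonal_weight m (\<rho> * t)) - f4 t * p (\<rho> * t) / \<rho> ^ 4"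
        using \<rho> by (simp add: add_divide_distrib power2_eq_square power3_eq_cube power4_eq_xxxx)
      finally show ?thesis .
    qed
    then have "((\<lambda>t. f0 t * (\<kappa> * zonal_weight m (\<rho> * t)) - f4 t * p (\<rho> * t) / \<rho> ^ 4) has_integral ?A L - ?A 0) {0..L}"
      using L(5) by (intro fundamental_theorem_of_calculus)
        (auto simp: has_real_derivative_iff_has_vector_derivative[symmetric] intro: has_field_derivative_at_within)
    moreover have "((\<lambda>t. f4 t * p (\<rho> * t)) has_integral integral {0..L} (\<lambda>t. f4 t * p (\<rho> * t))) {0..L}"
      using cont(2)[of \<rho>] by (intro integrable_integral integrable_continuous_real)
    from has_integral_divide[OF this, of "\<rho> ^ 4"]
    have "((\<lambda>t. f4 t * p (\<rho> * t) / \<rho> ^ 4) has_integral integral {0..L} (\<lambda>t. f4 t * p (\<rho> * t)) / \<rho> ^ 4) {0..L}" .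
    ultimately have "((\<lambda>t. f0 t * (\<kappa> * zonal_weight m (\<rho> * t)) - f4 t * p (\<rho> * t) / \<rho> ^ 4 + f4 t * p (\<rho> * t) / \<rho> ^ 4)
       has_integral (?A L - ?A 0 + integral {0..L} (\<lambda>t. f4 t * p (\<rho> * t)) / \<rho> ^ 4)) {0..L}"
      by (rule has_integral_add)
    then have I: "integral {0..L} (\<lambda>t. f0 t * (\<kappa> * zonal_weight m (\<rho> * t))) = ?A L - ?A 0 + integral {0..L} (\<lambda>t. f4 t * p (\<rho> * t)) / \<rho> ^ 4"
      by (simp add: integral_unique)
    have A: "?A L = 0" "?A 0 = f2 0 * q 0 / \<rho> ^ 3"
      using L m by (auto simp: s_def p0)
    have "\<bar>integral {0..L} (\<lambda>t. f4 t * p (\<rho> * t))\<bar> \<le> M * B * (L - 0)"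
    proof (rule integral_bound[where f = "\<lambda>t. f4 t * p (\<rho> * t)", simplified real_norm_def])
      show "\<bar>f4 t * p (\<rho> * t)\<bar> \<le> M * B" if "t \<in> {0..L}" for t
        unfolding abs_mult using M[OF that] B M0 by (intro mult_mono) auto
    qed (use L(5) cont(2) in auto)
    then have "integral {0..L} (\<lambda>t. f4 t * p (\<rho> * t)) / \<rho> \<le> M * B * L / \<rho>"
      using \<rho> by (intro divide_right_mono) auto
    moreover have "\<rho> ^ 3 * (?A L - ?A 0 + integral {0..L} (\<lambda>t. f4 t * p (\<rho> * t)) / \<rho> ^ 4)
       = - (f2 0 * q 0) + integral {0..L} (\<lambda>t. f4 t * p (\<rho> * t)) / \<rho>"
      unfolding A using \<rho> by (simp add: field_simps power4_eq_xxxx power3_eq_cube)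
    ultimately show ?thesis unfolding I by linarith
  qed
  have pos: "f2 0 * q 0 > 0" using neg q0 by (simp add: mult_neg_neg)
  define \<rho> where "\<rho> = (M * B * L + 1) / (f2 0 * q 0)"
  have MBL: "M * B * L \<ge> 0" using M0 B0 L(5) by simp
  have \<rho>: "\<rho> > 0" unfolding \<rho>_def using pos MBL by (intro divide_pos_pos) auto
  have "\<rho> * (f2 0 * q 0) = M * B * L + 1"
    unfolding \<rho>_def by (rule nonzero_eq_divide_eq[THEN iffD1, OF less_imp_neq[OF pos, symmetric] refl])
  then have "M * B * L / \<rho> < f2 0 * q 0"
    using \<rho> by (simp add: divide_less_eq mult.commute)
  then have "\<rho> ^ 3 * integral {0..L} (\<lambda>t. f0 t * (\<kappa> * zonal_weight m (\<rho> * t))) < 0"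
    using key[OF \<rho>] by linarith
  then have "integral {0..L} (\<lambda>t. f0 t * (\<kappa> * zonal_weight m (\<rho> * t))) < 0"
    using \<rho> by (simp add: mult_less_0_iff)
  moreover have "integral {0..L} (\<lambda>t. f0 t * (\<kappa> * zonal_weight m (\<rho> * t))) = \<kappa> * integral {0..L} (\<lambda>t. f0 t * zonal_weight m (\<rho> * t))"
    by (simp add: mult.left_commute)
  ultimately have "integral {0..L} (\<lambda>t. f0 t * zonal_weight m (\<rho> * t)) < 0"
    using \<kappa> by (simp add: mult_less_0_iff)
  then show ?thesis using that \<rho> by blast
qed

lemma smooth_directional:
  fixes F :: "'a::euclidean_space \<Rightarrow> real"
  assumes F: "smooth F" and e: "e \<in> Basis"
  obtains G where "smooth G" "\<And>t. ((\<lambda>t. F (t *\<^sub>R e)) has_real_derivative G (t *\<^sub>R e)) (at t)"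
proof (rule that)
  let ?G = "\<lambda>x. frechet_derivative F (at x) e"
  show "smooth ?G"
    using F e Ck_SucD(2) unfolding smooth_def by blast
  fix t
  have d: "(F has_derivative frechet_derivative F (at (t *\<^sub>R e))) (at (t *\<^sub>R e))"
    using F Ck_SucD(1) unfolding smooth_def by blast
  have "((\<lambda>t. t *\<^sub>R e) has_derivative (\<lambda>h. h *\<^sub>R e)) (at t)"
    by (auto intro!: derivative_eq_intros)
  from has_derivative_compose[OF this d]
  show "((\<lambda>t. F (t *\<^sub>R e)) has_real_derivative ?G (t *\<^sub>R e)) (at t)"
    unfolding has_field_derivative_def
    using linear_scale[OF bounded_linear.linear[OF has_derivative_bounded_linear[OF d]]]
    by (simp add: mult_commute_abs)
qed

lemma derivative_eq_0_beyond:
  assumes "\<And>t. (f has_real_derivative f' t) (at t)" "\<And>t. t > R \<Longrightarrow> f t = 0" "t > R"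
  shows "f' t = (0::real)"
proof -
  have "((\<lambda>t. 0) has_real_derivative f' t) (at t)"
    by (rule has_field_derivative_transform_within_open[OF assms(1), where S = "{R<..}"]) (use assms in auto)
  then show ?thesis using DERIV_unique[OF _ DERIV_const] by blast
qed

text \<open>
  Iterating the doubling inequality shows that \<open>f0 0 - f0 t\<close> is at least a fixed positive multiple
  of \<open>t\<^sup>2\<close> along \<open>t = L / 2 ^ n\<close>. If \<open>f2 0 \<ge> 0\<close>, Taylor's formula would bound it by a multiple of
  \<open>t ^ 3\<close>.
\<close>

lemma second_derivative_negative:
  fixes f0 f1 f2 f3 :: "real \<Rightarrow> real"
  assumes f0: "\<And>t. (f0 has_real_derivative f1 t) (at t)" and f1: "\<And>t. (f1 has_real_derivative f2 t) (at t)"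
    and f2: "\<And>t. (f2 has_real_derivative f3 t) (at t)" and f3: "continuous_on UNIV f3"
    and max: "\<And>t. f0 t \<le> f0 0" and doubling: "\<And>t. f0 0 - f0 (2 * t) \<le> 4 * (f0 0 - f0 t)"
    and L: "L > 0" "f0 L < f0 0"
  shows "f2 0 < 0"
proof (rule ccontr)
  assume "\<not> f2 0 < 0"
  then have f20: "f2 0 \<ge> 0" by simp
  have f10: "f1 0 = 0"
    by (rule DERIV_local_max[OF f0 zero_less_one]) (use max in auto)
  have "bounded (f3 ` {0..L})"
    by (intro compact_imp_bounded compact_continuous_image continuous_on_subset[OF f3]) auto
  then obtain M where "\<forall>t\<in>{0..L}. \<bar>f3 t\<bar> \<le> M"
    by (auto simp: bounded_iff)
  then have M: "\<bar>f3 t\<bar> \<le> M" if "t \<in> {0..L}" for t using that by blast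
  have upper: "f0 0 - f0 t \<le> M / 6 * t ^ 3" if t: "0 < t" "t \<le> L" for t
  proof -
    \<comment> \<open>Maclaurin's theorem expects the derivatives as a sequence.\<close>
    define diff where "diff k = (if k = 0 then f0 else if k = 1 then f1 else if k = 2 then f2 else f3)" for k :: nat
    have "\<exists>u>0. u < t \<and> f0 t = (\<Sum>k<3. diff k 0 / fact k * t ^ k) + diff 3 u / fact 3 * t ^ 3"
    proof (rule Maclaurin[OF t(1)])
      have "k = 0 \<or> k = 1 \<or> k = 2" if "k < 3" for k :: nat using that by arith
      then show "\<forall>k u. k < 3 \<and> 0 \<le> u \<and> u \<le> t \<longrightarrow> (diff k has_real_derivative diff (Suc k) u) (at u)"
        unfolding diff_def using f0 f1 f2 by (auto simp: numeral_2_eq_2)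
    qed (auto simp: diff_def)
    then obtain u where u: "0 < u" "u < t" "f0 t = (\<Sum>k<3. diff k 0 / fact k * t ^ k) + diff 3 u / fact 3 * t ^ 3" by blast
    have "f0 t = f0 0 + f2 0 / 2 * t\<^sup>2 + f3 u / 6 * t ^ 3"
      using u(3) by (simp add: diff_def f10 numeral_3_eq_3 fact_numeral power2_eq_square)
    moreover have "f3 u \<ge> - M" using M[of u] u t by auto
    then have "f3 u / 6 * t ^ 3 \<ge> - (M / 6 * t ^ 3)"
      using mult_right_mono[of "- M" "f3 u" "t ^ 3"] t by simp
    moreover have "f2 0 / 2 * t\<^sup>2 \<ge> 0" using f20 by simp
    ultimately show ?thesis by linarith
  qed
  have lower: "f0 0 - f0 L \<le> 4 ^ n * (f0 0 - f0 (L / 2 ^ n))" for n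
  proof (induction n)
    case (Suc n)
    have "4 ^ n * (f0 0 - f0 (L / 2 ^ n)) \<le> 4 ^ n * (4 * (f0 0 - f0 (L / 2 ^ Suc n)))"
      using doubling[of "L / 2 ^ Suc n"] by (intro mult_left_mono) auto
    also have "\<dots> = 4 ^ Suc n * (f0 0 - f0 (L / 2 ^ Suc n))"
      by (simp only: power_Suc mult_ac)
    finally show ?case using Suc by linarith
  qed simp
  have "f0 0 - f0 L \<le> M * L ^ 3 / 6 * (1 / 2) ^ n" for n
  proof -
    have "L / 2 ^ n \<le> L / 1" using L(1) by (intro divide_left_mono) auto
    then have "f0 0 - f0 (L / 2 ^ n) \<le> M / 6 * (L / 2 ^ n) ^ 3"
      using L(1) by (intro upper) auto
    then have "4 ^ n * (f0 0 - f0 (L / 2 ^ n)) \<le> 4 ^ n * (M / 6 * (L / 2 ^ n) ^ 3)"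
      by (rule mult_left_mono) simp
    also have "\<dots> = M * L ^ 3 / 6 * (4 ^ n / (2 ^ n) ^ 3)" by (simp add: power_divide)
    also have "(4::real) ^ n / (2 ^ n) ^ 3 = (1 / 2) ^ n"
    proof -
      have "((2::real) ^ n) ^ 3 = (2 ^ 3) ^ n"
        unfolding power_mult[symmetric] by (simp only: mult.commute)
      then show ?thesis by (simp add: power_divide[symmetric])
    qed
    finally show ?thesis using lower[of n] by linarith
  qed
  moreover have "(\<lambda>n. M * L ^ 3 / 6 * (1 / 2) ^ n) \<longlonglongrightarrow> M * L ^ 3 / 6 * 0"
    by (intro tendsto_mult tendsto_const LIMSEQ_power_zero) auto
  ultimately have "f0 0 - f0 L \<le> 0"
    by (intro LIMSEQ_le_const[of "\<lambda>n. M * L ^ 3 / 6 * (1 / 2) ^ n"]) auto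
  then show False using L(2) by simp
qed

lemma dilate_zonal_integral_negative:
  fixes F :: "'a::euclidean_space \<Rightarrow> real"
  assumes m: "m \<ge> 1" and F: "smooth F" and pd: "positive_definite (\<lambda>x. complex_of_real (F x))"
    and even: "\<And>x. F (- x) = F x" and supp: "\<And>x. norm x > R \<Longrightarrow> F x = 0" and F0: "F 0 > 0"
    and e: "e \<in> Basis" and L: "L > R" "R \<ge> 0"
  obtains \<rho> where "\<rho> > 0" "integral {0..L} (\<lambda>t. F (t *\<^sub>R e) * zonal_weight m (\<rho> * t)) < 0"
proof -
  obtain G1 where G1: "smooth G1" "\<And>t. ((\<lambda>t. F (t *\<^sub>R e)) has_real_derivative G1 (t *\<^sub>R e)) (at t)"
    using smooth_directional[OF F e] by blast
  obtain G2 where G2: "smooth G2" "\<And>t. ((\<lambda>t. G1 (t *\<^sub>R e)) has_real_derivative G2 (t *\<^sub>R e)) (at t)"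
    using smooth_directional[OF G1(1) e] by blast
  obtain G3 where G3: "smooth G3" "\<And>t. ((\<lambda>t. G2 (t *\<^sub>R e)) has_real_derivative G3 (t *\<^sub>R e)) (at t)"
    using smooth_directional[OF G2(1) e] by blast
  obtain G4 where G4: "smooth G4" "\<And>t. ((\<lambda>t. G3 (t *\<^sub>R e)) has_real_derivative G4 (t *\<^sub>R e)) (at t)"
    using smooth_directional[OF G3(1) e] by blast
  have cont: "continuous_on UNIV (\<lambda>t. G (t *\<^sub>R e))" if "smooth G" for G :: "'a \<Rightarrow> real"
  proof -
    have "continuous_on UNIV G" using that Ck_imp_continuous unfolding smooth_def by blast
    then show ?thesis by (rule continuous_on_compose2) (auto intro!: continuous_intros)
  qed
  have ne: "norm e = 1" using e by simp
  have z0: "F (t *\<^sub>R e) = 0" if "t > R" for t using that L(2) by (intro supp) (simp add: ne)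
  have z1: "G1 (t *\<^sub>R e) = 0" if "t > R" for t using derivative_eq_0_beyond[OF G1(2) z0 that] .
  have z2: "G2 (t *\<^sub>R e) = 0" if "t > R" for t using derivative_eq_0_beyond[OF G2(2) z1 that] .
  have z3: "G3 (t *\<^sub>R e) = 0" if "t > R" for t using derivative_eq_0_beyond[OF G3(2) z2 that] .
  have "G2 (0 *\<^sub>R e) < 0"
  proof (rule second_derivative_negative[OF G1(2) G2(2) G3(2) cont[OF G3(1)], of L])
    show "F (t *\<^sub>R e) \<le> F (0 *\<^sub>R e)" for t
      using positive_definite_bound[OF pd even, of "t *\<^sub>R e"] by simp
    show "F (0 *\<^sub>R e) - F ((2 * t) *\<^sub>R e) \<le> 4 * (F (0 *\<^sub>R e) - F (t *\<^sub>R e))" for t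
      using positive_definite_doubling[OF pd even, of "t *\<^sub>R e"] by simp
  qed (use L F0 z0[of L] in auto)
  then show ?thesis
    using oscillatory_integral_negative[OF m G1(2) G2(2) G3(2) G4(2) cont[OF G4(1)], of L] that
      z0[of L] z1[of L] z2[of L] z3[of L] L by auto
qed

section \<open>Positive definite functions of small support with negative zonal integral\<close>

text \<open>
  Both \<open>cos t\<close> and \<open>sin t / t\<close> are entire functions of \<open>t\<^sup>2\<close>, and \<open>R\<^sub>2\<close> is an even polynomial.
\<close>

lemma zonal_weight_entire:
  assumes m: "m \<ge> 1"
  obtains G where "entire_on_reals G" "\<And>t. zonal_weight m t = t ^ (2 * m - 1) * G (t\<^sup>2)"
proof -
  obtain C where C: "entire_on_reals C" "\<And>t. cos t = C (t\<^sup>2)" using entire_cos by blast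
  obtain S where S: "entire_on_reals S" "\<And>t. sin t = t * S (t\<^sup>2)" using entire_sinc by blast
  show ?thesis
  proof (rule that)
    show "entire_on_reals (\<lambda>s. ((2 * real m + 1) / (2 * real m) * (C s * C s) + - (1 / (2 * real m))) * S s ^ (2 * m - 1))"
      by (intro entire_on_reals_mult entire_on_reals_add entire_on_reals_const entire_on_reals_power C(1) S(1))
    fix t
    have "zonal_weight m t = ((2 * real m + 1) / (2 * real m) * (cos t * cos t) + - (1 / (2 * real m))) * sin t ^ (2 * m - 1)"
      by (simp add: zonal_weight_eq[OF m] diff_divide_distrib power2_eq_square)
    then show "zonal_weight m t = t ^ (2 * m - 1) *
      (((2 * real m + 1) / (2 * real m) * (C (t\<^sup>2) * C (t\<^sup>2)) + - (1 / (2 * real m))) * S (t\<^sup>2) ^ (2 * m - 1))"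
      unfolding C(2) S(2)[of t] power_mult_distrib by (simp add: mult_ac)
  qed
qed

lemma entire_on_reals_continuous:
  assumes "entire_on_reals f"
  shows "continuous_on UNIV f"
proof -
  obtain a where a: "\<And>s. summable (\<lambda>k. \<bar>a k * s ^ k\<bar>)" "\<And>s. f s = (\<Sum>k. a k * s ^ k)"
    using assms unfolding entire_on_reals_def by blast
  have "isCont (\<lambda>s. \<Sum>k. a k * s ^ k) s" for s
    by (rule isCont_powser_converges_everywhere) (rule summable_rabs_cancel[OF a(1)])
  moreover have "f = (\<lambda>s. \<Sum>k. a k * s ^ k)" using a(2) by blast
  ultimately show ?thesis by (simp add: continuous_at_imp_continuous_on)
qed

lemma integrable_pair_compact_support:
  fixes f :: "'a::euclidean_space \<times> 'a \<Rightarrow> real"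
  assumes f: "continuous_on UNIV f" and 0: "\<And>x y. norm x > R \<or> norm y > R \<Longrightarrow> f (x, y) = 0"
  shows "integrable lborel f"
proof (rule integrable_compact_support[OF f])
  fix p :: "'a \<times> 'a" assume p: "norm p > 2 * R"
  obtain x y where xy: "p = (x, y)" by fastforce
  have "norm p \<le> norm x + norm y" unfolding xy by (rule norm_Pair_le)
  with p have "norm x > R \<or> norm y > R" by linarith
  then show "f p = 0" unfolding xy by (rule 0)
qed

lemma pair_integral_eq_iterated:
  fixes f :: "'a::euclidean_space \<times> 'a \<Rightarrow> real"
  assumes "integrable lborel f"
  shows "(\<integral>p. f p \<partial>lborel) = (\<integral>x. \<integral>y. f (x, y) \<partial>lborel \<partial>lborel)"
    and "(\<integral>p. f p \<partial>lborel) = (\<integral>y. \<integral>x. f (x, y) \<partial>lborel \<partial>lborel)"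
proof -
  have f: "integrable (lborel \<Otimes>\<^sub>M lborel) (\<lambda>(x, y). f (x, y))"
    using assms by (simp add: lborel_prod)
  show 1: "(\<integral>p. f p \<partial>lborel) = (\<integral>x. \<integral>y. f (x, y) \<partial>lborel \<partial>lborel)"
    using lborel_pair.integral_fst[OF f] by (simp add: lborel_prod)
  show "(\<integral>p. f p \<partial>lborel) = (\<integral>y. \<integral>x. f (x, y) \<partial>lborel \<partial>lborel)"
    unfolding 1 using lborel_pair.Fubini_integral[OF f] by simp
qed

lemma integral_convolution:
  fixes H K g :: "'a::euclidean_space \<Rightarrow> real"
  assumes H: "continuous_on UNIV H" "\<And>y. norm y > R \<Longrightarrow> H y = 0"
    and K: "continuous_on UNIV K" "\<And>y. norm y > R \<Longrightarrow> K y = 0" and g: "continuous_on UNIV g" and R: "R \<ge> 0"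
  shows "(\<integral>x. convolution H K x * g x \<partial>lborel) = (\<integral>p. H (fst p) * K (snd p) * g (fst p + snd p) \<partial>lborel)"
proof -
  have [measurable]: "H \<in> borel_measurable borel" "K \<in> borel_measurable borel" "g \<in> borel_measurable borel"
    using H(1) K(1) g by (auto intro: borel_measurable_continuous_onI)
  have i1: "integrable lborel (\<lambda>p. H (fst p) * K (snd p - fst p) * g (snd p))"
  proof (rule integrable_pair_compact_support[where R = "2 * R"])
    show "continuous_on UNIV (\<lambda>p. H (fst p) * K (snd p - fst p) * g (snd p))"
      by (intro continuous_intros continuous_on_compose2[OF H(1)] continuous_on_compose2[OF K(1)] continuous_on_compose2[OF g]) auto
    fix x y :: 'a assume "norm x > 2 * R \<or> norm y > 2 * R"
    then have "norm x > R \<or> norm (y - x) > R"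
      using R norm_triangle_sub[of y x] by linarith
    then show "H (fst (x, y)) * K (snd (x, y) - fst (x, y)) * g (snd (x, y)) = 0" using H(2) K(2) by auto
  qed
  have i2: "integrable lborel (\<lambda>p. H (fst p) * K (snd p) * g (fst p + snd p))"
    by (rule integrable_pair_compact_support[where R = R],
       intro continuous_intros continuous_on_compose2[OF H(1)] continuous_on_compose2[OF K(1)] continuous_on_compose2[OF g])
      (use H(2) K(2) in auto)
  have "(\<integral>x. convolution H K x * g x \<partial>lborel) = (\<integral>x. \<integral>y. H y * K (x - y) * g x \<partial>lborel \<partial>lborel)"
    unfolding convolution_def by simp
  also have "\<dots> = (\<integral>y. \<integral>x. H y * K (x - y) * g x \<partial>lborel \<partial>lborel)"
    using pair_integral_eq_iterated[OF i1] by simp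
  also have "\<dots> = (\<integral>y. \<integral>z. H y * K z * g (y + z) \<partial>lborel \<partial>lborel)"
  proof (rule Bochner_Integration.integral_cong[OF refl])
    fix y :: 'a
    show "(\<integral>x. H y * K (x - y) * g x \<partial>lborel) = (\<integral>z. H y * K z * g (y + z) \<partial>lborel)"
      by (subst lborel_integral_affine[where c = 1 and t = y]) auto
  qed
  also have "\<dots> = (\<integral>p. H (fst p) * K (snd p) * g (fst p + snd p) \<partial>lborel)"
    using pair_integral_eq_iterated(1)[OF i2] by simp
  finally show ?thesis .
qed

lemma bump_eq_0: "\<rho> > 0 \<Longrightarrow> norm x \<ge> \<rho> \<Longrightarrow> bump (1 / \<rho>\<^sup>2) x = 0"
proof -
  assume "\<rho> > 0" "norm x \<ge> \<rho>"
  then have "1 \<le> 1 / \<rho>\<^sup>2 * (norm x)\<^sup>2" by (simp add: field_simps power_mono)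
  then show ?thesis by (simp add: bump_def cutoff_def power2_norm_eq_inner)
qed

lemma bump_1_eq_0: "norm x > 1 \<Longrightarrow> bump 1 x = 0"
  using bump_eq_0[of 1 x] by simp

lemma bump_scale: "\<rho> > 0 \<Longrightarrow> bump (1 / \<rho>\<^sup>2) (\<rho> *\<^sub>R x) = bump 1 x"
  by (simp add: bump_def power2_eq_square)

lemma continuous_bump: "continuous_on UNIV (bump a)"
  using smooth_bump[of a] Ck_imp_continuous unfolding smooth_def by blast

lemma isotropic_bump: "isotropic (bump a)"
  by (simp add: isotropic_def bump_def norm_eq_sqrt_inner)

lemma isotropic_even: "isotropic F \<Longrightarrow> F (- x) = F x"
  unfolding isotropic_def using norm_minus_cancel by blast

lemma bump_pair_integral_scale:
  fixes g :: "'a::euclidean_space \<Rightarrow> real"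
  assumes \<rho>: "\<rho> > 0" and \<sigma>: "\<sigma> > 0" and g: "continuous_on UNIV g"
  shows "(\<integral>p. bump (1 / \<rho>\<^sup>2) (fst p) * bump (1 / \<sigma>\<^sup>2) (snd p) * g (fst p + snd p) \<partial>lborel)
     = \<rho> ^ DIM('a) * \<sigma> ^ DIM('a) * (\<integral>p. bump 1 (fst p) * bump 1 (snd p) * g (\<rho> *\<^sub>R fst p + \<sigma> *\<^sub>R snd p) \<partial>lborel)"
proof -
  have [measurable]: "bump a \<in> borel_measurable borel" "g \<in> borel_measurable borel" for a :: real
    using continuous_bump g by (auto intro: borel_measurable_continuous_onI)
  have i1: "integrable lborel (\<lambda>p. bump (1 / \<rho>\<^sup>2) (fst p) * bump (1 / \<sigma>\<^sup>2) (snd p) * g (fst p + snd p))"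
    by (rule integrable_pair_compact_support[where R = "max \<rho> \<sigma>"],
       intro continuous_intros continuous_on_compose2[OF continuous_bump] continuous_on_compose2[OF g])
      (use \<rho> \<sigma> in \<open>auto simp: bump_eq_0\<close>)
  have i2: "integrable lborel (\<lambda>p. bump 1 (fst p) * bump 1 (snd p) * g (\<rho> *\<^sub>R fst p + \<sigma> *\<^sub>R snd p))"
    by (rule integrable_pair_compact_support[where R = 1],
       intro continuous_intros continuous_on_compose2[OF continuous_bump] continuous_on_compose2[OF g])
      (auto simp: bump_1_eq_0)
  have "(\<integral>p. bump (1 / \<rho>\<^sup>2) (fst p) * bump (1 / \<sigma>\<^sup>2) (snd p) * g (fst p + snd p) \<partial>lborel)
     = (\<integral>x. \<integral>y. bump (1 / \<rho>\<^sup>2) x * bump (1 / \<sigma>\<^sup>2) y * g (x + y) \<partial>lborel \<partial>lborel)"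
    using pair_integral_eq_iterated(1)[OF i1] by simp
  also have "\<dots> = (\<integral>x. \<sigma> ^ DIM('a) * (\<integral>y. bump (1 / \<rho>\<^sup>2) x * bump 1 y * g (x + \<sigma> *\<^sub>R y) \<partial>lborel) \<partial>lborel)"
    by (subst (2) lborel_integral_affine[where c = \<sigma> and t = 0]) (use \<sigma> in \<open>auto simp: bump_scale\<close>)
  also have "\<dots> = \<sigma> ^ DIM('a) * (\<integral>x. (\<integral>y. bump (1 / \<rho>\<^sup>2) x * bump 1 y * g (x + \<sigma> *\<^sub>R y) \<partial>lborel) \<partial>lborel)"
    by simp
  also have "(\<integral>x. (\<integral>y. bump (1 / \<rho>\<^sup>2) x * bump 1 y * g (x + \<sigma> *\<^sub>R y) \<partial>lborel) \<partial>lborel)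
     = \<rho> ^ DIM('a) * (\<integral>x. (\<integral>y. bump 1 x * bump 1 y * g (\<rho> *\<^sub>R x + \<sigma> *\<^sub>R y) \<partial>lborel) \<partial>lborel)"
    by (subst lborel_integral_affine[where c = \<rho> and t = 0]) (use \<rho> in \<open>auto simp: bump_scale\<close>)
  also have "(\<integral>x. (\<integral>y. bump 1 x * bump 1 y * g (\<rho> *\<^sub>R x + \<sigma> *\<^sub>R y) \<partial>lborel) \<partial>lborel)
     = (\<integral>p. bump 1 (fst p) * bump 1 (snd p) * g (\<rho> *\<^sub>R fst p + \<sigma> *\<^sub>R snd p) \<partial>lborel)"
    using pair_integral_eq_iterated(1)[OF i2] by simp
  finally show ?thesis by simp
qed

lemma bump_autoconvolution_pos: "convolution (bump 1) (bump 1) (0::'a::euclidean_space) > 0"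
proof -
  let ?h = "bump 1 :: 'a \<Rightarrow> real"
  have h: "?h (- y) = ?h y" for y by (simp add: bump_def)
  have int: "integrable lborel (\<lambda>y. ?h y * ?h (0 - y))"
    by (rule integrable_compact_support[where R = 1], intro continuous_intros continuous_on_compose2[OF continuous_bump])
      (auto simp: bump_1_eq_0)
  have low: "exp (- 2) \<le> ?h y" if "norm y \<le> 1 / sqrt 2" for y
  proof -
    have "(norm y)\<^sup>2 \<le> (1 / sqrt 2)\<^sup>2" using that by (intro power_mono) auto
    then have u: "1 / 2 \<le> 1 - y \<bullet> y" by (simp add: power2_norm_eq_inner power_divide)
    then have "1 / (1 - y \<bullet> y) \<le> 1 / (1 / 2)" by (intro divide_left_mono) auto
    with u show ?thesis by (simp add: bump_def cutoff_def)
  qed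
  have "0 < measure lborel (cball (0::'a) (1 / sqrt 2)) * (exp (- 2) * exp (- 2))"
    using content_cball_pos[of "1 / sqrt 2" "0::'a"] by simp
  also have "\<dots> = (\<integral>y. indicator (cball (0::'a) (1 / sqrt 2)) y * (exp (- 2) * exp (- 2)) \<partial>lborel)"
    by simp
  also have "\<dots> \<le> (\<integral>y. ?h y * ?h (0 - y) \<partial>lborel)"
  proof (rule integral_mono[OF _ int])
    have "integrable lborel (indicator (cball (0::'a) (1 / sqrt 2)) :: 'a \<Rightarrow> real)"
      by (rule integrable_real_indicator) (auto simp: emeasure_cball)
    then show "integrable lborel (\<lambda>y. indicator (cball (0::'a) (1 / sqrt 2)) y * (exp (- 2) * exp (- 2) :: real))"
      by (intro integrable_mult_left)
    fix y :: 'a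
    show "indicator (cball (0::'a) (1 / sqrt 2)) y * (exp (- 2) * exp (- 2)) \<le> ?h y * ?h (0 - y)"
      using mult_mono[OF low low, of y y] by (auto simp: indicator_def h bump_nonneg)
  qed
  finally show ?thesis by (simp add: convolution_def)
qed

text \<open>
  The construction of \<open>F = H * H\<close> (convolution) described at the beginning. The number \<open>q\<close> below is
  \<open>B R R\<close> for a scale \<open>R\<close> at which it is negative. The order of choices is: first \<open>K\<close>, so large that
  the extrapolation error integrates to less than \<open>\<bar>q\<bar>\<close>, then \<open>n\<close>, so large that the nodes lie below
  \<open>\<theta> / 2\<close>.
\<close>

proposition exists_positive_definite_with_negative_zonal_integral:
  fixes i1 :: "'n::finite"
  assumes m: "m \<ge> 1" and d: "CARD('n) = 2 * m" and \<theta>: "\<theta> > 0"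
  obtains F :: "real^'n \<Rightarrow> real" where "smooth F" "isotropic F"
    "positive_definite (\<lambda>x. complex_of_real (F x))" "\<And>x. norm x > \<theta> \<Longrightarrow> F x = 0"
    "integral {0..\<theta>} (\<lambda>t. F (t *\<^sub>R axis i1 1) * zonal_weight m t) < 0"
proof -
  define e where "e = (axis i1 1 :: real^'n)"
  have e: "e \<in> Basis" "norm e = 1" by (simp_all add: e_def axis_in_Basis_iff)
  have DIM: "DIM(real^'n) = 2 * m" using d by simp
  obtain G where G: "entire_on_reals G" and Gw: "\<And>t. zonal_weight m t = t ^ (2 * m - 1) * G (t\<^sup>2)"
    using zonal_weight_entire[OF m] by blast
  have contG: "continuous_on UNIV G" by (rule entire_on_reals_continuous[OF G])
  define c where "c = unit_ball_vol (2 * real m) * (2 * real m)"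
  have c: "c > 0" unfolding c_def using m by simp
  have polar: "(\<integral>x. F x * G ((norm (a *\<^sub>R x))\<^sup>2) \<partial>lborel) * a ^ (2 * m - 1)
      = c * integral {0..L} (\<lambda>t. F (t *\<^sub>R e) * zonal_weight m (a * t))"
    if F: "isotropic F" "continuous_on UNIV F" "\<And>x. norm x > L \<Longrightarrow> F x = 0" and a: "a > 0" and L: "L \<ge> 0" for F :: "real^'n \<Rightarrow> real" and a L
  proof -
    have rad: "F x * G ((norm (a *\<^sub>R x))\<^sup>2) = F (norm x *\<^sub>R e) * G ((a * norm x)\<^sup>2)" for x
    proof -
      have "F x = F (norm x *\<^sub>R e)" using F(1) e(2) unfolding isotropic_def by (metis abs_norm_cancel mult.right_neutral norm_scaleR)
      then show ?thesis using a by simp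
    qed
    have "(\<integral>x. F x * G ((norm (a *\<^sub>R x))\<^sup>2) \<partial>lborel) = (\<integral>x. F (norm (x::real^'n) *\<^sub>R e) * G ((a * norm x)\<^sup>2) \<partial>lborel)"
      unfolding rad ..
    also have "\<dots> = c * integral {0..L} (\<lambda>t. F (t *\<^sub>R e) * G ((a * t)\<^sup>2) * t ^ (2 * m - 1))"
    proof (subst polar_integral[where f = "\<lambda>t. F (t *\<^sub>R e) * G ((a * t)\<^sup>2)" and R = L])
      show "continuous_on UNIV (\<lambda>t. F (t *\<^sub>R e) * G ((a * t)\<^sup>2))"
        by (intro continuous_intros continuous_on_compose2[OF F(2)] continuous_on_compose2[OF contG]) auto
      show "F (t *\<^sub>R e) * G ((a * t)\<^sup>2) = 0" if "t > L" for t
        using F(3)[of "t *\<^sub>R e"] that L e(2) by simp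
    qed (use d in \<open>simp add: c_def\<close>)
    finally have "(\<integral>x. F x * G ((norm (a *\<^sub>R x))\<^sup>2) \<partial>lborel) * a ^ (2 * m - 1)
       = c * (integral {0..L} (\<lambda>t. F (t *\<^sub>R e) * G ((a * t)\<^sup>2) * t ^ (2 * m - 1)) * a ^ (2 * m - 1))" by simp
    also have "integral {0..L} (\<lambda>t. F (t *\<^sub>R e) * G ((a * t)\<^sup>2) * t ^ (2 * m - 1)) * a ^ (2 * m - 1)
       = integral {0..L} (\<lambda>t. F (t *\<^sub>R e) * G ((a * t)\<^sup>2) * t ^ (2 * m - 1) * a ^ (2 * m - 1))"
      by simp
    also have "(\<lambda>t. F (t *\<^sub>R e) * G ((a * t)\<^sup>2) * t ^ (2 * m - 1) * a ^ (2 * m - 1)) = (\<lambda>t. F (t *\<^sub>R e) * zonal_weight m (a * t))"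
      unfolding Gw by (auto simp: power_mult_distrib mult_ac)
    finally show ?thesis .
  qed

  define h where "h = (bump 1 :: real^'n \<Rightarrow> real)"
  have h: "continuous_on UNIV h" "\<And>y. norm y > 1 \<Longrightarrow> h y = 0" "\<And>y. h y \<ge> 0"
    by (auto simp: h_def continuous_bump bump_nonneg bump_1_eq_0)
  have smooth_conv: "smooth (convolution H H)" if "smooth H" "\<And>y. norm y > R \<Longrightarrow> H y = 0" for H :: "real^'n \<Rightarrow> real" and R
    using that Ck_convolution[of H R] Ck_imp_continuous unfolding smooth_def by blast
  define F1 where "F1 = convolution h h"
  have F1_smooth: "smooth F1" unfolding F1_def by (rule smooth_conv[OF _ h(2)]) (simp_all add: h_def smooth_bump)
  have F1_iso: "isotropic F1" unfolding F1_def
    by (intro isotropic_convolution borel_measurable_continuous_onI h(1)) (simp_all add: h_def isotropic_bump)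
  have F1_cont: "continuous_on UNIV F1" using F1_smooth Ck_imp_continuous unfolding smooth_def by blast
  have F1_pd: "positive_definite (\<lambda>x. complex_of_real (F1 x))" unfolding F1_def
    by (rule positive_definite_autoconvolution[OF h(1,2)]) (simp_all add: h_def isotropic_even isotropic_bump)
  have F1_0: "F1 x = 0" if "norm x > 2" for x
    unfolding F1_def by (rule convolution_eq_0[of 1 h 1 h]) (use that h(2) in auto)
  have F1_pos: "F1 0 > 0" unfolding F1_def h_def by (rule bump_autoconvolution_pos)
  obtain R where R: "R > 0" and neg: "integral {0..3} (\<lambda>t. F1 (t *\<^sub>R e) * zonal_weight m (R * t)) < 0"
    by (rule dilate_zonal_integral_negative[where R = 2 and L = 3, OF m F1_smooth F1_pd isotropic_even[OF F1_iso] F1_0 F1_pos e(1)]) auto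
  define q where "q = (\<integral>p. h (fst p) * h (snd p) * G ((norm (R *\<^sub>R fst p + R *\<^sub>R snd p))\<^sup>2) \<partial>lborel)"
  have "q = (\<integral>x. F1 x * G ((norm (R *\<^sub>R x))\<^sup>2) \<partial>lborel)"
    unfolding q_def F1_def
    by (subst integral_convolution[OF h(1,2) h(1,2)])
      (auto simp: scaleR_add_right intro!: continuous_intros continuous_on_compose2[OF contG])
  moreover have "(\<integral>x. F1 x * G ((norm (R *\<^sub>R x))\<^sup>2) \<partial>lborel) * R ^ (2 * m - 1) < 0"
    using polar[OF F1_iso F1_cont F1_0 R, of 3] neg c by (simp add: mult_pos_neg)
  ultimately have q: "q < 0" using R by (simp add: mult_less_0_iff)

  define mass where "mass = (\<integral>p. h (fst p) * h (snd p) \<partial>lborel)"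
  have mass: "mass \<ge> 0" unfolding mass_def using h(3) by simp
  \<comment> \<open>The total mass of the bump times this tolerance is at most half of \<open>- q\<close>; adding 1 avoids dividing by zero.\<close>
  define \<eta> where "\<eta> = - q / (2 * (mass + 1))"
  have \<eta>: "\<eta> > 0" unfolding \<eta>_def using q mass by (intro divide_pos_pos) auto
  obtain K0 where K0: "\<And>K n \<epsilon> y z. K \<ge> K0 \<Longrightarrow> \<epsilon> \<ge> 0 \<Longrightarrow> (real n + 1) * \<epsilon> = R \<Longrightarrow>
     norm (y::real^'n) \<le> 1 \<Longrightarrow> norm z \<le> 1 \<Longrightarrow>
     \<bar>(\<Sum>i<K. \<Sum>j<K. extrapolation_weight n K i * extrapolation_weight n K j *
         G ((norm ((\<epsilon> * (real i + 1)) *\<^sub>R y + (\<epsilon> * (real j + 1)) *\<^sub>R z))\<^sup>2)) - G ((norm (R *\<^sub>R y + R *\<^sub>R z))\<^sup>2)\<bar> \<le> \<eta>"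
    by (rule entire_extrapolation[OF G \<eta> less_imp_le[OF R]]) (rule that)
  define K where "K = K0"
  obtain n :: nat where n: "2 * real K * R / \<theta> \<le> real n" using real_arch_simple by blast
  define \<epsilon> where "\<epsilon> = R / (real n + 1)"
  have \<epsilon>: "\<epsilon> > 0" "(real n + 1) * \<epsilon> = R"
    unfolding \<epsilon>_def using R by (auto simp: add_nonneg_pos add_pos_nonneg field_simps)
  have \<epsilon>K: "\<epsilon> * real K \<le> \<theta> / 2"
  proof -
    have "2 * real K * R \<le> \<theta> * (real n + 1)" using n \<theta> by (simp add: field_simps)
    then show ?thesis unfolding \<epsilon>_def by (simp add: field_simps add_pos_nonneg)
  qed
  define w where "w = extrapolation_weight n K"
  define \<rho> where "\<rho> j = \<epsilon> * (real j + 1)" for j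
  have \<rho>: "\<rho> j > 0" for j using \<epsilon>(1) by (simp add: \<rho>_def add_nonneg_pos)
  have \<rho>_le: "\<rho> j \<le> \<theta> / 2" if "j < K" for j
  proof -
    have "\<epsilon> * (real j + 1) \<le> \<epsilon> * real K" using that \<epsilon>(1) by (intro mult_left_mono) auto
    then show ?thesis using \<epsilon>K by (simp add: \<rho>_def)
  qed
  \<comment> \<open>Dividing by \<open>\<rho> j ^ (2 * m)\<close> makes the mass of each dilate independent of \<open>\<rho> j\<close>, so that the dilation factors appear only in the argument of \<open>G\<close>.\<close>
  define H where "H x = (\<Sum>j<K. (w j / \<rho> j ^ (2 * m)) * bump (1 / (\<rho> j)\<^sup>2) x)" for x :: "real^'n"
  have H_smooth: "smooth H" unfolding smooth_def H_def
    by (intro allI Ck_sum Ck_mult Ck_const smooth_bump[unfolded smooth_def, rule_format])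
  have H_cont: "continuous_on UNIV H" using H_smooth Ck_imp_continuous unfolding smooth_def by blast
  have H_iso: "isotropic H"
    unfolding isotropic_def H_def
    by (intro allI impI sum.cong refl arg_cong2[where f = "(*)"]) (rule isotropic_bump[unfolded isotropic_def, rule_format])
  have H_0: "H x = 0" if "norm x > \<theta> / 2" for x
    unfolding H_def
  proof (intro sum.neutral ballI)
    fix j assume "j \<in> {..<K}"
    then have "bump (1 / (\<rho> j)\<^sup>2) x = 0" using \<rho>_le[of j] that by (intro bump_eq_0 \<rho>) auto
    then show "(w j / \<rho> j ^ (2 * m)) * bump (1 / (\<rho> j)\<^sup>2) x = 0" by simp
  qed
  define F where "F = convolution H H"
  have F_iso: "isotropic F" unfolding F_def
    by (intro isotropic_convolution borel_measurable_continuous_onI H_cont H_iso)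
  have F_smooth: "smooth F" unfolding F_def by (rule smooth_conv[OF H_smooth H_0])
  have F_cont: "continuous_on UNIV F" using F_smooth Ck_imp_continuous unfolding smooth_def by blast
  have F_pd: "positive_definite (\<lambda>x. complex_of_real (F x))" unfolding F_def
    by (rule positive_definite_autoconvolution[OF H_cont H_0 isotropic_even[OF H_iso]])
  have F_0: "F x = 0" if "norm x > \<theta>" for x
    unfolding F_def by (rule convolution_eq_0[of "\<theta> / 2" H "\<theta> / 2" H]) (use that H_0 in auto)

  define g where "g x = G ((norm x)\<^sup>2)" for x :: "real^'n"
  have g: "continuous_on UNIV g" unfolding g_def
    by (intro continuous_on_compose2[OF contG] continuous_intros) auto
  have int_hh: "integrable lborel (\<lambda>p. h (fst p) * h (snd p) * g (a *\<^sub>R fst p + b *\<^sub>R snd p))" for a b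
    by (rule integrable_pair_compact_support[where R = 1],
       intro continuous_intros continuous_on_compose2[OF h(1)] continuous_on_compose2[OF g])
      (use h(2) in auto)
  have int_mass: "integrable lborel (\<lambda>p. h (fst p) * h (snd p))"
    by (rule integrable_pair_compact_support[where R = 1],
       intro continuous_intros continuous_on_compose2[OF h(1)])
      (use h(2) in auto)
  have int_bb: "integrable lborel (\<lambda>p. bump (1 / (\<rho> i)\<^sup>2) (fst p) * bump (1 / (\<rho> j)\<^sup>2) (snd p) * g (fst p + snd p))" for i j
    by (rule integrable_pair_compact_support[where R = "max (\<rho> i) (\<rho> j)"],
       intro continuous_intros continuous_on_compose2[OF continuous_bump] continuous_on_compose2[OF g])
      (use \<rho> in \<open>auto simp: bump_eq_0\<close>)
  have "(\<integral>x. F x * g x \<partial>lborel) = (\<integral>p. H (fst p) * H (snd p) * g (fst p + snd p) \<partial>lborel)"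
    unfolding F_def using \<theta> by (intro integral_convolution[OF H_cont _ H_cont _ g, of "\<theta> / 2"] H_0) auto
  also have "\<dots> = (\<integral>p. (\<Sum>i<K. \<Sum>j<K. (w i / \<rho> i ^ (2 * m)) * (w j / \<rho> j ^ (2 * m)) *
       (bump (1 / (\<rho> i)\<^sup>2) (fst p) * bump (1 / (\<rho> j)\<^sup>2) (snd p) * g (fst p + snd p))) \<partial>lborel)"
    unfolding H_def sum_product unfolding sum_distrib_right
    by (intro Bochner_Integration.integral_cong refl sum.cong) (simp add: mult_ac)
  also have "\<dots> = (\<Sum>i<K. \<Sum>j<K. (w i / \<rho> i ^ (2 * m)) * (w j / \<rho> j ^ (2 * m)) *
       (\<integral>p. bump (1 / (\<rho> i)\<^sup>2) (fst p) * bump (1 / (\<rho> j)\<^sup>2) (snd p) * g (fst p + snd p) \<partial>lborel))"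
    by (subst Bochner_Integration.integral_sum; (subst Bochner_Integration.integral_sum)?)
      (auto intro!: Bochner_Integration.integrable_sum integrable_mult_right int_bb)
  also have "\<dots> = (\<Sum>i<K. \<Sum>j<K. w i * w j * (\<integral>p. h (fst p) * h (snd p) * g (\<rho> i *\<^sub>R fst p + \<rho> j *\<^sub>R snd p) \<partial>lborel))"
    unfolding bump_pair_integral_scale[OF \<rho> \<rho> g] h_def[symmetric] DIM
    using \<rho> by (intro sum.cong refl) (simp add: less_imp_neq[symmetric])
  also have "\<dots> = (\<integral>p. (\<Sum>i<K. \<Sum>j<K. w i * w j * (h (fst p) * h (snd p) * g (\<rho> i *\<^sub>R fst p + \<rho> j *\<^sub>R snd p))) \<partial>lborel)"
    by (subst Bochner_Integration.integral_sum; (subst Bochner_Integration.integral_sum)?)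
      (auto intro!: Bochner_Integration.integrable_sum integrable_mult_right int_hh)
  also have "\<dots> \<le> (\<integral>p. h (fst p) * h (snd p) * g (R *\<^sub>R fst p + R *\<^sub>R snd p) + \<eta> * (h (fst p) * h (snd p)) \<partial>lborel)"
  proof (rule integral_mono)
    fix p :: "(real^'n) \<times> (real^'n)"
    define S where "S = (\<Sum>i<K. \<Sum>j<K. w i * w j * g (\<rho> i *\<^sub>R fst p + \<rho> j *\<^sub>R snd p))"
    have "(\<Sum>i<K. \<Sum>j<K. w i * w j * (h (fst p) * h (snd p) * g (\<rho> i *\<^sub>R fst p + \<rho> j *\<^sub>R snd p))) = h (fst p) * h (snd p) * S"
      unfolding S_def by (simp add: sum_distrib_left mult_ac)
    also have "\<dots> \<le> h (fst p) * h (snd p) * (g (R *\<^sub>R fst p + R *\<^sub>R snd p) + \<eta>)"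
    proof (cases "norm (fst p) \<le> 1 \<and> norm (snd p) \<le> 1")
      case True
      then have "\<bar>S - g (R *\<^sub>R fst p + R *\<^sub>R snd p)\<bar> \<le> \<eta>"
        using K0[of K \<epsilon> n "fst p" "snd p"] \<epsilon> unfolding S_def w_def \<rho>_def g_def K_def by simp
      then show ?thesis using h(3) by (intro mult_left_mono) auto
    next
      case False
      then have "h (fst p) * h (snd p) = 0" using h(2) by (metis mult_eq_0_iff not_le)
      then show ?thesis by auto
    qed
    finally show "(\<Sum>i<K. \<Sum>j<K. w i * w j * (h (fst p) * h (snd p) * g (\<rho> i *\<^sub>R fst p + \<rho> j *\<^sub>R snd p)))
      \<le> h (fst p) * h (snd p) * g (R *\<^sub>R fst p + R *\<^sub>R snd p) + \<eta> * (h (fst p) * h (snd p))"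
      by (simp add: algebra_simps)
  qed (intro Bochner_Integration.integrable_sum Bochner_Integration.integrable_add integrable_mult_right int_hh int_mass)+
  also have "\<dots> = q + \<eta> * mass"
    using int_hh[of R R] int_mass by (simp add: q_def mass_def g_def)
  also have "\<dots> < 0"
  proof -
    have "\<eta> * mass \<le> \<eta> * (mass + 1)" using \<eta> by (intro mult_left_mono) auto
    also have "\<dots> = - q / 2" using mass by (simp add: \<eta>_def field_simps)
    finally show ?thesis using q by simp
  qed
  finally have "(\<integral>x. F x * g x \<partial>lborel) < 0" .
  then have "c * integral {0..\<theta>} (\<lambda>t. F (t *\<^sub>R e) * zonal_weight m t) < 0"
    using polar[OF F_iso F_cont F_0 zero_less_one less_imp_le[OF \<theta>]] by (simp add: g_def)
  then have "integral {0..\<theta>} (\<lambda>t. F (t *\<^sub>R e) * zonal_weight m t) < 0" using c by (simp add: mult_less_0_iff)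
  then show ?thesis using that[OF F_smooth F_iso F_pd F_0] by (simp add: e_def)
qed

section \<open>Zonal integrals over the ball\<close>

definition vec_cons :: "real \<times> (real^'n) \<Rightarrow> real^('n::finite option)" where
  "vec_cons p = (\<chi> i. case i of None \<Rightarrow> fst p | Some j \<Rightarrow> snd p $ j)"

lemma vec_cons_nth [simp]: "vec_cons p $ None = fst p" "vec_cons p $ Some j = snd p $ j"
  by (simp_all add: vec_cons_def)

lemma all_option: "(\<forall>i. P i) \<longleftrightarrow> P None \<and> (\<forall>j. P (Some j))"
  by (metis option.exhaust)

lemma sum_UNIV_option: "(\<Sum>i\<in>UNIV. f i) = f None + (\<Sum>j\<in>UNIV. f (Some (j::'n::finite)))"
  by (simp add: UNIV_option_conv sum.reindex)

lemma norm_vec_cons: "norm (vec_cons p) = sqrt ((fst p)\<^sup>2 + (norm (snd p))\<^sup>2)"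
  by (simp add: norm_vec_def L2_set_def sum_UNIV_option sum_nonneg)

lemma continuous_vec_cons: "continuous_on UNIV (vec_cons :: _ \<Rightarrow> real^('n::finite option))"
proof -
  have "continuous_on UNIV (\<lambda>p :: real \<times> (real^'n). case i of None \<Rightarrow> fst p | Some j \<Rightarrow> snd p $ j)" for i
    by (cases i) (auto intro!: continuous_intros)
  then show ?thesis unfolding vec_cons_def[abs_def] by (intro continuous_on_vec_lambda)
qed

lemma prod_Basis_vec:
  fixes x :: "real^'k::finite"
  shows "(\<Prod>b\<in>Basis. x \<bullet> b) = (\<Prod>i\<in>UNIV. x $ i)"
proof -
  have B: "Basis = range (\<lambda>i::'k. axis i (1::real))" by (auto simp: Basis_vec_def)
  show ?thesis unfolding B
    by (subst prod.reindex) (auto simp: inj_on_def axis_eq_axis inner_axis)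
qed

lemma emeasure_lborel_box_vec:
  fixes l u :: "real^'k::finite"
  assumes "\<And>i. l $ i \<le> u $ i"
  shows "emeasure lborel (box l u) = ennreal (\<Prod>i\<in>UNIV. u $ i - l $ i)"
proof -
  have "emeasure lborel (box l u) = ennreal (\<Prod>b\<in>Basis. (u - l) \<bullet> b)"
    using assms by (intro emeasure_lborel_box) (auto simp: Basis_vec_def inner_axis)
  then show ?thesis by (simp add: prod_Basis_vec)
qed

lemma distr_vec_cons:
  "distr (lborel \<Otimes>\<^sub>M lborel) borel vec_cons = (lborel :: (real^('n::finite option)) measure)"
proof (rule lborel_eqI[symmetric])
  have [measurable]: "vec_cons \<in> borel_measurable (borel :: (real \<times> (real^'n)) measure)"
    by (intro borel_measurable_continuous_onI continuous_vec_cons)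
  fix l u :: "real^('n option)" assume lu: "\<And>b. b \<in> Basis \<Longrightarrow> l \<bullet> b \<le> u \<bullet> b"
  have le: "l $ i \<le> u $ i" for i using lu[of "axis i 1"] by (simp add: inner_axis axis_in_Basis_iff)
  let ?l = "\<chi> j. l $ Some j" and ?u = "\<chi> j. u $ Some j"
  have pre: "vec_cons -` box l u = box (l $ None) (u $ None) \<times> box ?l ?u"
    by (auto simp: mem_box_cart all_option)
  have "emeasure (distr (lborel \<Otimes>\<^sub>M lborel) borel vec_cons) (box l u)
     = emeasure (lborel \<Otimes>\<^sub>M lborel) (box (l $ None) (u $ None) \<times> box ?l ?u)"
    by (subst emeasure_distr) (auto simp: pre lborel_prod space_pair_measure)
  also have "\<dots> = emeasure lborel (box (l $ None) (u $ None)) * emeasure lborel (box ?l ?u)"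
    by (subst lborel.emeasure_pair_measure_Times) auto
  also have "\<dots> = ennreal (u $ None - l $ None) * ennreal (\<Prod>j\<in>UNIV. u $ Some j - l $ Some j)"
    using le[of None] le by (simp add: emeasure_lborel_box_vec)
  also have "\<dots> = ennreal (\<Prod>b\<in>Basis. (u - l) \<bullet> b)"
    using le by (subst prod_Basis_vec) (simp add: UNIV_option_conv prod.reindex ennreal_mult prod_nonneg)
  finally show "emeasure (distr (lborel \<Otimes>\<^sub>M lborel) borel vec_cons) (box l u) = ennreal (\<Prod>b\<in>Basis. (u - l) \<bullet> b)" .
qed simp

text \<open>
  The substitution \<open>a = - r * cot t\<close>, where \<open>t\<close> is the angle at the origin between \<open>(a, r)\<close> and the
  negative first axis. It turns \<open>a\<^sup>2 + r\<^sup>2\<close> into \<open>(r / sin t)\<^sup>2\<close>, so the unit disc becomes \<open>r \<le> sin t\<close>.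
\<close>

lemma half_plane_substitution:
  fixes \<Theta> :: "real \<Rightarrow> real"
  assumes \<Theta>[measurable]: "\<Theta> \<in> borel_measurable borel" and nn: "\<And>s. \<Theta> s \<ge> 0" and r: "0 < r"
  shows "(\<integral>\<^sup>+a. ennreal (\<Theta> (- a / sqrt (a\<^sup>2 + r\<^sup>2))) * indicator {a. a\<^sup>2 + r\<^sup>2 \<le> 1} a \<partial>lborel)
     = (\<integral>\<^sup>+t. ennreal (\<Theta> (cos t) * (r / (sin t)\<^sup>2)) * indicator {t. 0 \<le> t \<and> t \<le> pi \<and> r \<le> sin t} t \<partial>lborel)"
proof (cases "r \<le> 1")
  case False
  have "a\<^sup>2 + r\<^sup>2 > 1" for a
    using False one_less_power[of r 2] by (smt (verit) zero_le_power2 zero_less_numeral)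
  then have e1: "indicator {a. a\<^sup>2 + r\<^sup>2 \<le> 1} a = (0::ennreal)" for a by (simp add: indicator_def not_le)
  have e2: "indicator {t. 0 \<le> t \<and> t \<le> pi \<and> r \<le> sin t} t = (0::ennreal)" for t
    using order.strict_trans1[OF sin_le_one[of t], of r] False by (auto simp: indicator_def)
  show ?thesis unfolding e1 e2 by simp
next
  case True
  define \<tau> where "\<tau> = arcsin r"
  have \<tau>: "0 < \<tau>" "\<tau> \<le> pi / 2" "sin \<tau> = r" "cos \<tau> = sqrt (1 - r\<^sup>2)"
    unfolding \<tau>_def using r True arcsin_lt_bounded[of r] arcsin_bounded[of r] arcsin_less_mono[of 0 r]
    by (auto simp: cos_arcsin)
  define g where "g t = - r * cos t / sin t" for t
  define g' where "g' t = r / (sin t)\<^sup>2" for t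
  have sin_pos: "sin t > 0" if "t \<in> {\<tau>..pi - \<tau>}" for t
    using that \<tau> by (intro sin_gt_zero) auto
  have iff: "t \<in> {\<tau>..pi - \<tau>} \<longleftrightarrow> 0 \<le> t \<and> t \<le> pi \<and> r \<le> sin t" for t
  proof
    assume t: "t \<in> {\<tau>..pi - \<tau>}"
    have "sin \<tau> \<le> sin t"
    proof (cases "t \<le> pi / 2")
      case True then show ?thesis using t \<tau> by (intro sin_monotone_2pi_le) auto
    next
      case False
      then have "sin \<tau> \<le> sin (pi - t)" using t \<tau> by (intro sin_monotone_2pi_le) auto
      then show ?thesis by simp
    qed
    then show "0 \<le> t \<and> t \<le> pi \<and> r \<le> sin t" using t \<tau> by auto
  next
    assume t: "0 \<le> t \<and> t \<le> pi \<and> r \<le> sin t"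
    have "\<not> t < \<tau>"
    proof
      assume "t < \<tau>" then have "sin t < sin \<tau>" using t \<tau> by (intro sin_monotone_2pi) auto
      then show False using t \<tau> by simp
    qed
    moreover have "\<not> pi - t < \<tau>"
    proof
      assume "pi - t < \<tau>" then have "sin (pi - t) < sin \<tau>" using t \<tau> by (intro sin_monotone_2pi) auto
      then show False using t \<tau> by simp
    qed
    ultimately show "t \<in> {\<tau>..pi - \<tau>}" by auto
  qed
  have ends: "g \<tau> = - sqrt (1 - r\<^sup>2)" "g (pi - \<tau>) = sqrt (1 - r\<^sup>2)"
    using r \<tau> by (simp_all add: g_def)
  have ind: "a \<in> {g \<tau>..g (pi - \<tau>)} \<longleftrightarrow> a\<^sup>2 + r\<^sup>2 \<le> 1" for a
  proof -
    have "a \<in> {g \<tau>..g (pi - \<tau>)} \<longleftrightarrow> \<bar>a\<bar> \<le> sqrt (1 - r\<^sup>2)" unfolding ends by auto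
    also have "\<dots> \<longleftrightarrow> a\<^sup>2 \<le> 1 - r\<^sup>2"
      by (metis abs_ge_zero power2_abs real_sqrt_abs real_sqrt_le_iff)
    finally show ?thesis by linarith
  qed
  let ?f = "\<lambda>a. \<Theta> (- a / sqrt (a\<^sup>2 + r\<^sup>2))"
  have fg: "?f (g t) = \<Theta> (cos t)" if t: "t \<in> {\<tau>..pi - \<tau>}" for t
  proof -
    have "(g t)\<^sup>2 + r\<^sup>2 = r\<^sup>2 * ((cos t)\<^sup>2 + (sin t)\<^sup>2) / (sin t)\<^sup>2"
      using sin_pos[OF t] by (simp add: g_def field_simps) (simp add: distrib_left[symmetric])
    then have "(g t)\<^sup>2 + r\<^sup>2 = (r / sin t)\<^sup>2" by (simp add: power_divide)
    then have "sqrt ((g t)\<^sup>2 + r\<^sup>2) = r / sin t" using r sin_pos[OF t] by simp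
    then show ?thesis using r sin_pos[OF t] by (simp add: g_def)
  qed
  have "(\<integral>\<^sup>+a. ennreal (?f a) * indicator {a. a\<^sup>2 + r\<^sup>2 \<le> 1} a \<partial>lborel) = (\<integral>\<^sup>+a. ?f a * indicator {g \<tau>..g (pi - \<tau>)} a \<partial>lborel)"
    by (intro nn_integral_cong) (auto simp: indicator_def ind simp del: atLeastAtMost_iff)
  also have "\<dots> = (\<integral>\<^sup>+t. ?f (g t) * g' t * indicator {\<tau>..pi - \<tau>} t \<partial>lborel)"
  proof (rule nn_integral_substitution)
    show "set_borel_measurable borel {g \<tau>..g (pi - \<tau>)} ?f"
      unfolding set_borel_measurable_def by measurable
    show "(g has_real_derivative g' t) (at t)" if "t \<in> {\<tau>..pi - \<tau>}" for t
    proof -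
      have "- r * - sin t * sin t - - r * cos t * cos t = r"
        using sin_cos_squared_add3[of t] by algebra
      moreover have "sin t \<noteq> 0" using sin_pos[OF that] by simp
      ultimately have "((\<lambda>t. - r * cos t / sin t) has_real_derivative r / (sin t * sin t)) (at t)"
        using DERIV_divide[OF DERIV_cmult[OF DERIV_cos, of "- r" t] DERIV_sin] by metis
      then show ?thesis by (simp add: g_def[abs_def] g'_def power2_eq_square)
    qed
    show "continuous_on {\<tau>..pi - \<tau>} g'"
      unfolding g'_def using sin_pos by (intro continuous_intros) (auto simp: less_imp_neq[symmetric])
    show "0 \<le> g' t" for t using r by (simp add: g'_def)
    show "\<tau> \<le> pi - \<tau>" using \<tau> by simp
  qed
  also have "\<dots> = (\<integral>\<^sup>+t. ennreal (\<Theta> (cos t) * (r / (sin t)\<^sup>2)) * indicator {t. 0 \<le> t \<and> t \<le> pi \<and> r \<le> sin t} t \<partial>lborel)"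
  proof (intro nn_integral_cong)
    fix t
    show "ennreal (?f (g t) * g' t * indicator {\<tau>..pi - \<tau>} t) = ennreal (\<Theta> (cos t) * (r / (sin t)\<^sup>2)) * indicator {t. 0 \<le> t \<and> t \<le> pi \<and> r \<le> sin t} t"
      using iff[of t] fg[of t] by (cases "t \<in> {\<tau>..pi - \<tau>}") (auto simp: g'_def indicator_def)
  qed
  finally show ?thesis .
qed

text \<open>
  Split off the first coordinate \<open>a\<close>, use polar coordinates of radius \<open>r\<close> in the others, and pass
  from \<open>a\<close> to the polar angle \<open>t\<close>. The integral of \<open>r ^ n / (sin t)\<^sup>2\<close> over \<open>0 \<le> r \<le> sin t\<close> yields the
  density \<open>sin t ^ (n - 1)\<close>. Working in the solid ball replaces surface measure on the sphere.
\<close>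

lemma zonal_nn_integral:
  fixes \<Theta> :: "real \<Rightarrow> real"
  assumes \<Theta>[measurable]: "\<Theta> \<in> borel_measurable borel" and nn: "\<And>s. \<Theta> s \<ge> 0" and d: "CARD('n::finite) \<ge> 2"
  shows "(\<integral>\<^sup>+y. ennreal (\<Theta> (- (y $ None) / norm y)) * indicator (cball 0 1) y \<partial>(lborel :: (real^('n option)) measure))
    = (\<integral>\<^sup>+t. ennreal (unit_ball_vol (CARD('n)) * real CARD('n) / (real CARD('n) + 1)) * ennreal (\<Theta> (cos t) * sin t ^ (CARD('n) - 1)) * indicator {0..pi} t \<partial>lborel)"
proof -
  define n where "n = CARD('n)"
  define c where "c = unit_ball_vol n * real n"
  have c: "c > 0" unfolding c_def n_def by simp
  let ?\<Psi> = "\<lambda>a r. ennreal (\<Theta> (- a / sqrt (a\<^sup>2 + r\<^sup>2))) * indicator {a. a\<^sup>2 + r\<^sup>2 \<le> 1} a"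
  have meas[measurable]: "(\<lambda>p. ?\<Psi> (f p) (h p)) \<in> borel_measurable M"
    if [measurable]: "f \<in> borel_measurable M" "h \<in> borel_measurable M" for f h :: "'z \<Rightarrow> real" and M
    unfolding indicator_def by measurable
  have [measurable]: "vec_cons \<in> borel_measurable (borel :: (real \<times> (real^'n)) measure)"
    by (intro borel_measurable_continuous_onI continuous_vec_cons)
  have [measurable]: "(\<lambda>y. y $ i) \<in> borel_measurable borel" for i :: "'n option"
    by (intro borel_measurable_continuous_onI continuous_intros)
  have [measurable]: "(indicator (cball 0 1) :: real^('n option) \<Rightarrow> ennreal) \<in> borel_measurable borel"
    by (intro borel_measurable_indicator) auto
  have "(\<integral>\<^sup>+y. ennreal (\<Theta> (- (y $ None) / norm y)) * indicator (cball 0 1) y \<partial>(lborel :: (real^('n option)) measure))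
     = (\<integral>\<^sup>+p. ennreal (\<Theta> (- (vec_cons p $ None) / norm (vec_cons p))) * indicator (cball 0 1) (vec_cons p :: real^('n option)) \<partial>(lborel \<Otimes>\<^sub>M lborel))"
    unfolding distr_vec_cons[symmetric]
    by (subst nn_integral_distr) (auto simp: lborel_prod)
  also have "\<dots> = (\<integral>\<^sup>+p. ?\<Psi> (fst p) (norm (snd p :: real^'n)) \<partial>(lborel \<Otimes>\<^sub>M lborel))"
    by (intro nn_integral_cong) (auto simp: norm_vec_cons indicator_def)
  also have "\<dots> = (\<integral>\<^sup>+x. \<integral>\<^sup>+a. ?\<Psi> a (norm (x :: real^'n)) \<partial>lborel \<partial>lborel)"
    by (subst lborel_pair.nn_integral_snd[symmetric]) (auto simp del: mult_minus_left)
  also have "\<dots> = (\<integral>\<^sup>+r. ennreal (c * r ^ (n - 1)) * indicator {0..} r * (\<integral>\<^sup>+a. ?\<Psi> a r \<partial>lborel) \<partial>lborel)"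
    by (subst polar_nn_integral[where f = "\<lambda>r. \<integral>\<^sup>+a. ?\<Psi> a r \<partial>lborel"]) (auto simp: c_def n_def mult.assoc)
  also have "\<dots> = (\<integral>\<^sup>+r. (\<integral>\<^sup>+t. ennreal (c * (\<Theta> (cos t) / (sin t)\<^sup>2 * r ^ n)) * indicator {p. 0 \<le> snd p \<and> snd p \<le> pi \<and> 0 \<le> fst p \<and> fst p \<le> sin (snd p)} (r, t) \<partial>lborel) \<partial>lborel)"
  proof (rule nn_integral_cong)
    fix r :: real
    show "ennreal (c * r ^ (n - 1)) * indicator {0..} r * (\<integral>\<^sup>+a. ?\<Psi> a r \<partial>lborel)
       = (\<integral>\<^sup>+t. ennreal (c * (\<Theta> (cos t) / (sin t)\<^sup>2 * r ^ n)) * indicator {p. 0 \<le> snd p \<and> snd p \<le> pi \<and> 0 \<le> fst p \<and> fst p \<le> sin (snd p)} (r, t) \<partial>lborel)"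
    proof (cases "r > 0")
      case True
      obtain k where k: "n = Suc k" using d unfolding n_def by (cases "CARD('n)") auto
      have "ennreal (c * r ^ (n - 1)) * indicator {0..} r * (\<integral>\<^sup>+a. ?\<Psi> a r \<partial>lborel)
        = (\<integral>\<^sup>+t. ennreal (c * r ^ (n - 1)) * (ennreal (\<Theta> (cos t) * (r / (sin t)\<^sup>2)) * indicator {t. 0 \<le> t \<and> t \<le> pi \<and> r \<le> sin t} t) \<partial>lborel)"
        unfolding half_plane_substitution[OF \<Theta> nn True] using True
        by (subst nn_integral_cmult) (auto simp: indicator_def[abs_def])
      also have "\<dots> = (\<integral>\<^sup>+t. ennreal (c * (\<Theta> (cos t) / (sin t)\<^sup>2 * r ^ n)) * indicator {p. 0 \<le> snd p \<and> snd p \<le> pi \<and> 0 \<le> fst p \<and> fst p \<le> sin (snd p)} (r, t) \<partial>lborel)"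
        using True c nn by (intro nn_integral_cong) (auto simp: indicator_def k ennreal_mult[symmetric] mult_ac)
      finally show ?thesis .
    next
      case False
      have z: "ennreal (c * (\<Theta> (cos t) / (sin t)\<^sup>2 * r ^ n)) * indicator {p. 0 \<le> snd p \<and> snd p \<le> pi \<and> 0 \<le> fst p \<and> fst p \<le> sin (snd p)} (r, t) = 0" for t
        using False d by (cases "r = 0") (auto simp: indicator_def n_def zero_power)
      have "ennreal (c * r ^ (n - 1)) * indicator {0..} r = 0"
        using False d by (cases "r = 0") (auto simp: indicator_def n_def zero_power)
      then show ?thesis unfolding z by simp
    qed
  qed
  also have "\<dots> = (\<integral>\<^sup>+t. (\<integral>\<^sup>+r. ennreal (c * (\<Theta> (cos t) / (sin t)\<^sup>2 * r ^ n)) * indicator {p. 0 \<le> snd p \<and> snd p \<le> pi \<and> 0 \<le> fst p \<and> fst p \<le> sin (snd p)} (r, t) \<partial>lborel) \<partial>lborel)"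
    by (rule lborel_pair.Fubini') (simp add: indicator_def)
  also have "\<dots> = (\<integral>\<^sup>+t. ennreal (c / (real n + 1)) * ennreal (\<Theta> (cos t) * sin t ^ (n - 1)) * indicator {0..pi} t \<partial>lborel)"
  proof (rule nn_integral_cong)
    fix t :: real
    show "(\<integral>\<^sup>+r. ennreal (c * (\<Theta> (cos t) / (sin t)\<^sup>2 * r ^ n)) * indicator {p. 0 \<le> snd p \<and> snd p \<le> pi \<and> 0 \<le> fst p \<and> fst p \<le> sin (snd p)} (r, t) \<partial>lborel)
      = ennreal (c / (real n + 1)) * ennreal (\<Theta> (cos t) * sin t ^ (n - 1)) * indicator {0..pi} t"
    proof (cases "t \<in> {0..pi}")
      case True
      then have s: "sin t \<ge> 0" by (intro sin_ge_zero) auto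
      define A where "A = c * (\<Theta> (cos t) / (sin t)\<^sup>2)"
      have A: "A \<ge> 0" using c nn by (simp add: A_def)
      have "(\<integral>\<^sup>+r. ennreal (c * (\<Theta> (cos t) / (sin t)\<^sup>2 * r ^ n)) * indicator {p. 0 \<le> snd p \<and> snd p \<le> pi \<and> 0 \<le> fst p \<and> fst p \<le> sin (snd p)} (r, t) \<partial>lborel)
        = (\<integral>\<^sup>+r. ennreal (A * r ^ n) * indicator {0..sin t} r \<partial>lborel)"
        using True by (intro nn_integral_cong) (auto simp: indicator_def A_def mult_ac)
      also have "\<dots> = ennreal (A / (real n + 1) * sin t ^ (n + 1) - A / (real n + 1) * 0 ^ (n + 1))"
      proof (rule nn_integral_FTC_Icc)
        show "((\<lambda>r. A / (real n + 1) * r ^ (n + 1)) has_real_derivative A * r ^ n) (at r)" for r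
          using DERIV_cmult[OF DERIV_pow[of "n + 1" r UNIV], of "A / (real n + 1)"] by (simp add: add.commute)
      qed (use A s in auto)
      also have "A / (real n + 1) * sin t ^ (n + 1) - A / (real n + 1) * 0 ^ (n + 1) = c / (real n + 1) * (\<Theta> (cos t) * sin t ^ (n - 1))"
      proof -
        obtain k where k: "n = Suc (Suc k)" using d unfolding n_def by (metis Suc_le_D numeral_2_eq_2 Suc_le_mono)
        show ?thesis by (cases "sin t = 0") (auto simp: k power2_eq_square A_def)
      qed
      finally show ?thesis using True c by (simp add: ennreal_mult'[symmetric])
    next
      case False
      then show ?thesis by (auto simp: indicator_def)
    qed
  qed
  finally show ?thesis by (simp add: c_def n_def)
qed


text \<open>
  Rotate \<open>\<xi>\<close> to the coordinate direction of the previous lemma. The identity for nonnegative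
  integrands says that two measures on the line agree, which gives it for signed integrands.
\<close>

lemma zonal_integral:
  fixes \<Theta> :: "real \<Rightarrow> real" and \<xi> :: "real^('n::finite option)"
  assumes \<Theta>: "continuous_on UNIV \<Theta>" and d: "CARD('n) \<ge> 2" and \<xi>: "norm \<xi> = 1"
  defines "C \<equiv> unit_ball_vol (CARD('n)) * real CARD('n) / (real CARD('n) + 1)"
  shows "(\<integral>y. \<Theta> (\<xi> \<bullet> sgn y) * indicator (cball 0 1) y \<partial>lborel)
    = C * integral {0..pi} (\<lambda>t. \<Theta> (cos t) * sin t ^ (CARD('n) - 1))"
proof -
  have \<Theta>m[measurable]: "\<Theta> \<in> borel_measurable borel" using \<Theta> by (rule borel_measurable_continuous_onI)
  have C: "C > 0" unfolding C_def by simp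
  define e where "e = (axis None (-1) :: real^('n option))"
  have e: "norm e = 1" "e \<bullet> y = - (y $ None)" for y
    by (simp_all add: e_def norm_eq_sqrt_inner inner_axis')
  obtain T where T: "orthogonal_transformation T" "T e = \<xi>"
    using orthogonal_transformation_exists_1[OF e(1) \<xi>] by blast
  have [measurable]: "(indicator (cball 0 1) :: real^('n option) \<Rightarrow> real) \<in> borel_measurable borel"
    "(indicator (cball 0 1) :: real^('n option) \<Rightarrow> ennreal) \<in> borel_measurable borel"
    by (intro borel_measurable_indicator; simp)+
  have [measurable]: "(\<lambda>y. y $ i) \<in> borel_measurable borel" for i :: "'n option"
    by (intro borel_measurable_continuous_onI continuous_intros)
  have [measurable]: "(\<lambda>y :: real^('n option). \<xi> \<bullet> sgn y) \<in> borel_measurable borel"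
    unfolding sgn_div_norm by measurable
  let ?s = "\<lambda>y :: real^('n option). - (y $ None) / norm y"
  let ?M = "density lborel (indicator (cball 0 1) :: real^('n option) \<Rightarrow> ennreal)"
  let ?w = "\<lambda>t. C * sin t ^ (CARD('n) - 1) * indicator {0..pi} t"
  have w: "?w t \<ge> 0" for t using C sin_ge_zero[of t] by (auto simp: indicator_def)
  have eq: "distr ?M borel ?s = distr (density lborel (\<lambda>t. ennreal (?w t))) borel cos"
  proof (rule measure_eqI)
    fix A :: "real set" assume "A \<in> sets (distr ?M borel ?s)"
    then have A[measurable]: "A \<in> sets borel" by simp
    have "emeasure (distr ?M borel ?s) A = (\<integral>\<^sup>+y. indicator A (?s y) \<partial>?M)"
      by (subst nn_integral_indicator[symmetric], simp, subst nn_integral_distr) auto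
    also have "\<dots> = (\<integral>\<^sup>+y. indicator (cball 0 1) y * indicator A (?s y) \<partial>lborel)"
      by (subst nn_integral_density) auto
    also have "\<dots> = (\<integral>\<^sup>+y. ennreal (indicator A (?s y)) * indicator (cball 0 1) y \<partial>lborel)"
      by (intro nn_integral_cong) (auto simp: indicator_def)
    also have "\<dots> = (\<integral>\<^sup>+t. ennreal C * ennreal (indicator A (cos t) * sin t ^ (CARD('n) - 1)) * indicator {0..pi} t \<partial>lborel)"
      unfolding C_def by (rule zonal_nn_integral) (use d in auto)
    also have "\<dots> = (\<integral>\<^sup>+t. ennreal (?w t) * indicator A (cos t) \<partial>lborel)"
      using C by (intro nn_integral_cong) (auto simp: indicator_def ennreal_mult')
    also have "\<dots> = (\<integral>\<^sup>+t. indicator A (cos t) \<partial>density lborel (\<lambda>t. ennreal (?w t)))"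
      by (subst nn_integral_density) auto
    also have "\<dots> = emeasure (distr (density lborel (\<lambda>t. ennreal (?w t))) borel cos) A"
      by (subst nn_integral_indicator[symmetric], simp, subst nn_integral_distr) auto
    finally show "emeasure (distr ?M borel ?s) A = emeasure (distr (density lborel (\<lambda>t. ennreal (?w t))) borel cos) A" .
  qed simp
  have Tsgn: "\<xi> \<bullet> sgn (T y) = ?s y" for y
  proof -
    have "\<xi> \<bullet> sgn (T y) = (T e \<bullet> T y) / norm (T y)" by (simp add: T(2) sgn_div_norm divide_inverse mult.commute)
    also have "\<dots> = (e \<bullet> y) / norm y"
      using T(1) orthogonal_transformation_norm[OF T(1)] by (simp add: orthogonal_transformation_def)
    finally show ?thesis by (simp add: e)
  qed
  have "(\<integral>y. \<Theta> (\<xi> \<bullet> sgn y) * indicator (cball 0 1) y \<partial>lborel) = (\<integral>y. \<Theta> (\<xi> \<bullet> sgn (T y)) * indicator (cball 0 1) (T y) \<partial>lborel)"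
    by (subst integral_orthogonal[OF T(1), where f = "\<lambda>y. \<Theta> (\<xi> \<bullet> sgn y) * indicator (cball 0 1) y"]) auto
  also have "\<dots> = (\<integral>y. indicator (cball 0 1) y *\<^sub>R \<Theta> (?s y) \<partial>lborel)"
    unfolding Tsgn using orthogonal_transformation_norm[OF T(1)]
    by (intro Bochner_Integration.integral_cong) (auto simp: indicator_def)
  also have "\<dots> = (\<integral>y. \<Theta> (?s y) \<partial>density lborel (\<lambda>y. ennreal (indicator (cball 0 1) y)))"
    by (subst integral_density) auto
  also have "\<dots> = (\<integral>s. \<Theta> s \<partial>distr ?M borel ?s)"
    by (subst integral_distr) (auto simp: ennreal_indicator)
  also have "\<dots> = (\<integral>t. \<Theta> (cos t) \<partial>density lborel (\<lambda>t. ennreal (?w t)))"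
    unfolding eq by (subst integral_distr) auto
  also have "\<dots> = (\<integral>t. ?w t *\<^sub>R \<Theta> (cos t) \<partial>lborel)"
    using w by (subst integral_density) auto
  also have "\<dots> = (\<integral>t. C * (indicator {0..pi} t *\<^sub>R (\<Theta> (cos t) * sin t ^ (CARD('n) - 1))) \<partial>lborel)"
    by (intro Bochner_Integration.integral_cong) auto
  also have "\<dots> = C * (LINT t : {0..pi} | lborel. \<Theta> (cos t) * sin t ^ (CARD('n) - 1))"
    unfolding set_lebesgue_integral_def by (subst integral_mult_right_zero) simp
  also have "(LINT t : {0..pi} | lborel. \<Theta> (cos t) * sin t ^ (CARD('n) - 1)) = integral {0..pi} (\<lambda>t. \<Theta> (cos t) * sin t ^ (CARD('n) - 1))"
    by (intro set_borel_integral_eq_integral borel_integrable_atLeastAtMost')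
      (auto intro!: continuous_intros continuous_on_compose2[OF \<Theta>])
  finally show ?thesis .
qed

section \<open>Positive definite functions on the sphere\<close>

lemma Psi_finite_sum_nonneg:
  fixes w :: "real^('n::finite option) \<Rightarrow> real"
  assumes \<psi>: "\<psi> \<in> Psi TYPE('n)" and A: "finite A" "A \<subseteq> sphere 0 1"
  shows "(\<Sum>a\<in>A. \<Sum>b\<in>A. w a * w b * \<psi> (arccos (a \<bullet> b))) \<ge> 0"
proof (cases "A = {}")
  case False
  define N where "N = card A"
  have N: "N \<ge> 1" using False A(1) by (simp add: N_def Suc_le_eq card_gt_0_iff)
  obtain f where f: "bij_betw f {..<N} A"
    using ex_bij_betw_nat_finite[OF A(1)] unfolding N_def atLeast0LessThan by blast
  have fA: "\<forall>i<N. f i \<in> sphere 0 1" using f A(2) by (auto simp: bij_betw_def)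
  have "(\<Sum>i<N. \<Sum>j<N. cnj (complex_of_real (w (f i))) * complex_of_real (w (f j)) * complex_of_real (\<psi> (arccos (f i \<bullet> f j)))) \<in> \<real>\<^sub>\<ge>\<^sub>0"
  proof -
    have "\<forall>N\<ge>1. \<forall>(\<xi> :: nat \<Rightarrow> real^('n option)) (c :: nat \<Rightarrow> complex). (\<forall>i<N. \<xi> i \<in> sphere 0 1) \<longrightarrow>
        (\<Sum>i<N. \<Sum>j<N. cnj (c i) * c j * complex_of_real (\<psi> (arccos (\<xi> i \<bullet> \<xi> j)))) \<in> \<real>\<^sub>\<ge>\<^sub>0"
      using \<psi> unfolding Psi_def mem_Collect_eq by (elim conjE)
    from this[rule_format, OF N, of f "\<lambda>i. complex_of_real (w (f i))"] fA show ?thesis by blast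
  qed
  also have "(\<Sum>i<N. \<Sum>j<N. cnj (complex_of_real (w (f i))) * complex_of_real (w (f j)) * complex_of_real (\<psi> (arccos (f i \<bullet> f j))))
    = complex_of_real (\<Sum>i<N. \<Sum>j<N. w (f i) * w (f j) * \<psi> (arccos (f i \<bullet> f j)))" by simp
  finally have "(\<Sum>i<N. \<Sum>j<N. w (f i) * w (f j) * \<psi> (arccos (f i \<bullet> f j))) \<ge> 0"
    by (simp only: nonneg_Reals_of_real_iff)
  also have "(\<Sum>i<N. \<Sum>j<N. w (f i) * w (f j) * \<psi> (arccos (f i \<bullet> f j))) = (\<Sum>i<N. \<Sum>b\<in>A. w (f i) * w b * \<psi> (arccos (f i \<bullet> b)))"
    by (intro sum.cong refl sum.reindex_bij_betw[OF f])
  also have "\<dots> = (\<Sum>a\<in>A. \<Sum>b\<in>A. w a * w b * \<psi> (arccos (a \<bullet> b)))"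
    by (rule sum.reindex_bij_betw[OF f, where g = "\<lambda>a. \<Sum>b\<in>A. w a * w b * \<psi> (arccos (a \<bullet> b))"])
  finally show ?thesis .
qed simp

text \<open>
  The addition formula for harmonics of degree two, written with the spanning family of the
  trace-free quadratic forms \<open>a $ i * a $ j - \<delta> / d\<close> instead of an orthonormal basis.
\<close>

lemma degree_two_addition_formula:
  fixes a b :: "real^'k::finite"
  assumes "norm a = 1" "norm b = 1"
  defines "Y \<equiv> \<lambda>i j a. a $ i * a $ j - (if i = j then 1 / real CARD('k) else 0)"
  shows "(a \<bullet> b)\<^sup>2 - 1 / real CARD('k) = (\<Sum>i\<in>UNIV. \<Sum>j\<in>UNIV. Y i j a * Y i j b)"
proof -
  let ?D = "1 / real CARD('k)"
  have sq: "(\<Sum>i\<in>UNIV. x $ i * x $ i) = 1" if "norm x = 1" for x :: "real^'k"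
    using that by (simp add: norm_eq_1 inner_vec_def)
  have "(\<Sum>i\<in>UNIV. \<Sum>j\<in>UNIV. Y i j a * Y i j b)
     = (\<Sum>i\<in>UNIV. \<Sum>j\<in>UNIV. (a $ i * b $ i) * (a $ j * b $ j)
         + (if i = j then ?D * ?D - ?D * (a $ i * a $ i) - ?D * (b $ i * b $ i) else 0))"
    unfolding Y_def by (intro sum.cong refl) (auto simp: algebra_simps)
  also have "\<dots> = (\<Sum>i\<in>UNIV. \<Sum>j\<in>UNIV. (a $ i * b $ i) * (a $ j * b $ j))
     + (\<Sum>i\<in>UNIV. ?D * ?D - ?D * (a $ i * a $ i) - ?D * (b $ i * b $ i))"
    by (simp add: sum.distrib)
  also have "(\<Sum>i\<in>UNIV. \<Sum>j\<in>UNIV. (a $ i * b $ i) * (a $ j * b $ j)) = (a \<bullet> b)\<^sup>2"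
    by (simp add: inner_vec_def power2_eq_square sum_product)
  also have "(\<Sum>i\<in>UNIV. ?D * ?D - ?D * (a $ i * a $ i) - ?D * (b $ i * b $ i)) = - ?D"
    unfolding sum_subtractf sum_distrib_left[symmetric] sq[OF assms(1)] sq[OF assms(2)] by simp
  finally show ?thesis by simp
qed

text \<open>
  By the addition formula the form is a sum, over pairs of coordinates, of forms of \<open>\<psi>\<close> with the
  coefficients \<open>w a * Y i j a\<close>.
\<close>

lemma Psi_weighted_sum_nonneg:
  fixes w :: "real^('n::finite option) \<Rightarrow> real"
  assumes \<psi>: "\<psi> \<in> Psi TYPE('n)" and A: "finite A" "A \<subseteq> sphere 0 1"
  shows "(\<Sum>a\<in>A. \<Sum>b\<in>A. w a * w b * (\<psi> (arccos (a \<bullet> b)) * ((a \<bullet> b)\<^sup>2 - 1 / real CARD('n option)))) \<ge> 0"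
proof -
  define Y where "Y i j a = a $ i * a $ j - (if i = j then 1 / real CARD('n option) else 0)"
    for i j and a :: "real^('n option)"
  have "(\<Sum>a\<in>A. \<Sum>b\<in>A. w a * w b * (\<psi> (arccos (a \<bullet> b)) * ((a \<bullet> b)\<^sup>2 - 1 / real CARD('n option))))
    = (\<Sum>a\<in>A. \<Sum>b\<in>A. \<Sum>i\<in>UNIV. \<Sum>j\<in>UNIV. (w a * Y i j a) * (w b * Y i j b) * \<psi> (arccos (a \<bullet> b)))"
  proof (intro sum.cong refl)
    fix a b assume "a \<in> A" "b \<in> A"
    then have "norm a = 1" "norm b = 1" using A(2) by auto
    from degree_two_addition_formula[OF this, folded Y_def]
    show "w a * w b * (\<psi> (arccos (a \<bullet> b)) * ((a \<bullet> b)\<^sup>2 - 1 / real CARD('n option)))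
      = (\<Sum>i\<in>UNIV. \<Sum>j\<in>UNIV. (w a * Y i j a) * (w b * Y i j b) * \<psi> (arccos (a \<bullet> b)))"
      by (simp only: sum_distrib_left mult_ac)
  qed
  also have "\<dots> = (\<Sum>i\<in>UNIV. \<Sum>j\<in>UNIV. \<Sum>a\<in>A. \<Sum>b\<in>A. (w a * Y i j a) * (w b * Y i j b) * \<psi> (arccos (a \<bullet> b)))"
  proof -
    have "(\<Sum>a\<in>A. \<Sum>b\<in>A. \<Sum>i\<in>UNIV. \<Sum>j\<in>UNIV. Z a b i j) = (\<Sum>i\<in>UNIV. \<Sum>j\<in>UNIV. \<Sum>a\<in>A. \<Sum>b\<in>A. Z a b i j)"
      for Z :: "_ \<Rightarrow> _ \<Rightarrow> 'n option \<Rightarrow> 'n option \<Rightarrow> real"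
    proof -
      have "(\<Sum>a\<in>A. \<Sum>b\<in>A. \<Sum>i\<in>UNIV. \<Sum>j\<in>UNIV. Z a b i j) = (\<Sum>a\<in>A. \<Sum>i\<in>UNIV. \<Sum>b\<in>A. \<Sum>j\<in>UNIV. Z a b i j)"
        by (rule sum.cong[OF refl], rule sum.swap)
      also have "\<dots> = (\<Sum>a\<in>A. \<Sum>i\<in>UNIV. \<Sum>j\<in>UNIV. \<Sum>b\<in>A. Z a b i j)"
        by (rule sum.cong[OF refl], rule sum.cong[OF refl], rule sum.swap)
      also have "\<dots> = (\<Sum>i\<in>UNIV. \<Sum>a\<in>A. \<Sum>j\<in>UNIV. \<Sum>b\<in>A. Z a b i j)"
        by (rule sum.swap)
      also have "\<dots> = (\<Sum>i\<in>UNIV. \<Sum>j\<in>UNIV. \<Sum>a\<in>A. \<Sum>b\<in>A. Z a b i j)"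
        by (rule sum.cong[OF refl], rule sum.swap)
      finally show ?thesis .
    qed
    then show ?thesis .
  qed
  also have "\<dots> \<ge> 0"
    by (intro sum_nonneg Psi_finite_sum_nonneg[OF \<psi> A])
  finally show ?thesis .
qed

lemma integral_simple_range:
  fixes h :: "'b \<Rightarrow> real"
  assumes "finite_measure M" and v: "simple_function M v"
  shows "(\<integral>x. h (v x) \<partial>M) = (\<Sum>a\<in>v ` space M. measure M (v -` {a} \<inter> space M) * h a)"
proof -
  interpret finite_measure M by fact
  have fin: "finite (v ` space M)" by (rule simple_functionD(1)[OF v])
  have sets: "v -` {a} \<inter> space M \<in> sets M" for a by (rule simple_functionD(2)[OF v])
  have "(\<integral>x. h (v x) \<partial>M) = (\<integral>x. (\<Sum>a\<in>v ` space M. indicator (v -` {a} \<inter> space M) x * h a) \<partial>M)"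
  proof (intro Bochner_Integration.integral_cong refl)
    fix x assume x: "x \<in> space M"
    have "(\<Sum>a\<in>v ` space M. indicator (v -` {a} \<inter> space M) x * h a) = (\<Sum>a\<in>v ` space M. if a = v x then h a else 0)"
      using x by (intro sum.cong) (auto simp: indicator_def)
    also have "\<dots> = h (v x)" using x fin by simp
    finally show "h (v x) = (\<Sum>a\<in>v ` space M. indicator (v -` {a} \<inter> space M) x * h a)" by simp
  qed
  also have "\<dots> = (\<Sum>a\<in>v ` space M. (\<integral>x. indicator (v -` {a} \<inter> space M) x * h a \<partial>M))"
    using sets by (intro Bochner_Integration.integral_sum integrable_mult_left integrable_real_indicator) (auto simp: less_top[symmetric])
  also have "\<dots> = (\<Sum>a\<in>v ` space M. measure M (v -` {a} \<inter> space M) * h a)"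
    using sets by (intro sum.cong refl) (simp add: Int_absorb2 sets.sets_into_space)
  finally show ?thesis .
qed

text \<open>
  Approximate \<open>sgn\<close>, which is \<open>x / norm x\<close>, by functions \<open>v i\<close> with finitely many values on the sphere.
  For these the double integral of \<open>\<Theta> (v i x \<bullet> v i y)\<close> over the unit ball is one of the given finite
  sums. Dominated convergence, once in each variable, passes to the limit, where the inner
  integral no longer depends on \<open>x\<close> by rotation invariance.
\<close>

lemma sphere_kernel_integral_nonneg:
  fixes \<Theta> :: "real \<Rightarrow> real"
  assumes \<Theta>: "continuous_on UNIV \<Theta>" and d: "CARD('n::finite) \<ge> 2"
    and pd: "\<And>A (w :: real^('n option) \<Rightarrow> real). finite A \<Longrightarrow> A \<subseteq> sphere 0 1 \<Longrightarrow>
       (\<Sum>a\<in>A. \<Sum>b\<in>A. w a * w b * \<Theta> (a \<bullet> b)) \<ge> 0"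
  shows "integral {0..pi} (\<lambda>t. \<Theta> (cos t) * sin t ^ (CARD('n) - 1)) \<ge> 0"
proof -
  define C where "C = unit_ball_vol (CARD('n)) * real CARD('n) / (real CARD('n) + 1)"
  have C: "C > 0" unfolding C_def by simp
  define I where "I = integral {0..pi} (\<lambda>t. \<Theta> (cos t) * sin t ^ (CARD('n) - 1))"
  define M where "M = density lborel (\<lambda>y :: real^('n option). ennreal (indicator (cball 0 1) y))"
  have [measurable]: "(indicator (cball 0 1) :: real^('n option) \<Rightarrow> real) \<in> borel_measurable borel"
    "(indicator (cball 0 1) :: real^('n option) \<Rightarrow> ennreal) \<in> borel_measurable borel"
    by (intro borel_measurable_indicator; simp)+
  have sM[simp]: "sets M = sets borel" "space M = UNIV" by (simp_all add: M_def)
  have [measurable_cong]: "sets M = sets borel" by simp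
  have eM: "emeasure M UNIV = emeasure lborel (cball (0 :: real^('n option)) 1)"
    unfolding M_def by (subst emeasure_density) (auto simp: ennreal_indicator)
  have fM: "finite_measure M" by (rule finite_measureI) (simp add: eM emeasure_cball)
  interpret M: finite_measure M by (rule fM)
  have mM: "measure M UNIV > 0"
    unfolding measure_def eM using unit_ball_vol_pos[of "real (DIM(real^('n option)))"] by (simp add: emeasure_cball)
  have AE0: "AE x in M. x \<noteq> 0"
    unfolding M_def by (subst AE_density) (auto intro: eventually_mono[OF AE_lborel_singleton[of 0]])
  have "bounded (\<Theta> ` {-1..1})"
    by (intro compact_imp_bounded compact_continuous_image continuous_on_subset[OF \<Theta>]) auto
  then obtain B where B: "\<forall>s\<in>{-1..1}. \<bar>\<Theta> s\<bar> \<le> B" by (auto simp: bounded_iff)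
  have dot: "a \<bullet> b \<in> {-1..1}" if "norm a = 1" "norm b = 1" for a b :: "real^('n option)"
    using Cauchy_Schwarz_ineq2[of a b] that by auto
  obtain e :: "real^('n option)" where e: "norm e = 1" using vector_choose_size[of 1] by auto
  \<comment> \<open>The approximating simple functions need not have unit values; \<open>N\<close> normalises them, and sends \<open>0\<close> to an arbitrary unit vector.\<close>
  define N where "N z = (if z = 0 then e else sgn z)" for z :: "real^('n option)"
  have N: "norm (N z) = 1" for z by (simp add: N_def e norm_sgn)
  have [measurable]: "sgn \<in> borel_measurable (borel :: (real^('n option)) measure)"
    unfolding sgn_div_norm[abs_def] by measurable
  obtain F :: "nat \<Rightarrow> real^('n option) \<Rightarrow> real^('n option)"
    where F: "\<And>i. simple_function M (F i)" "\<And>x. (\<lambda>i. F i x) \<longlonglongrightarrow> sgn x"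
    using borel_measurable_implies_sequence_metric[of sgn M 0] by auto
  define v where "v i x = N (F i x)" for i x
  have v: "simple_function M (v i)" for i
    unfolding v_def[abs_def] using simple_function_compose1[OF F(1)] by blast
  have nv: "norm (v i x) = 1" for i x by (simp add: v_def N)
  have lim: "(\<lambda>i. v i x) \<longlonglongrightarrow> sgn x" if "x \<noteq> 0" for x
  proof -
    have "sgn x \<noteq> 0" using that by (simp add: sgn_zero_iff)
    have A: "(\<lambda>i. sgn (F i x)) \<longlonglongrightarrow> sgn (sgn x)"
      unfolding sgn_div_norm using \<open>sgn x \<noteq> 0\<close> F(2)[of x]
      by (intro tendsto_intros) (auto simp: sgn_div_norm)
    have "eventually (\<lambda>i. F i x \<noteq> 0) sequentially"
      using tendsto_imp_eventually_ne[OF F(2) \<open>sgn x \<noteq> 0\<close>] .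
    then have B: "eventually (\<lambda>i. sgn (F i x) = v i x) sequentially"
      by eventually_elim (simp add: v_def N_def)
    show ?thesis using Lim_transform_eventually[OF A B] that by (simp add: sgn_div_norm[of "sgn x"] norm_sgn)
  qed
  have meas_v: "(\<lambda>y. h (v i y)) \<in> borel_measurable M" for h :: "real^('n option) \<Rightarrow> real" and i
    by (rule borel_measurable_simple_function[OF simple_function_compose1[OF v]])
  define J where "J i x = (\<integral>y. \<Theta> (v i x \<bullet> v i y) \<partial>M)" for i x
  have J_bound: "\<bar>J i x\<bar> \<le> B * measure M UNIV" for i x
  proof -
    have "\<bar>J i x\<bar> \<le> (\<integral>y. \<bar>\<Theta> (v i x \<bullet> v i y)\<bar> \<partial>M)" unfolding J_def by (rule integral_abs_bound)
    also have "\<dots> \<le> (\<integral>y. B \<partial>M)"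
    proof (rule integral_mono)
      show "integrable M (\<lambda>y. \<bar>\<Theta> (v i x \<bullet> v i y)\<bar>)"
        by (rule M.integrable_const_bound[where B = B]) (use B dot nv in simp, rule meas_v)
    qed (use B dot nv in auto)
    finally show ?thesis by (simp add: mult.commute)
  qed
  have J_lim: "(\<lambda>i. J i x) \<longlonglongrightarrow> C * I" if x: "x \<noteq> 0" for x
  proof -
    have [measurable]: "\<Theta> \<in> borel_measurable borel" using \<Theta> by (rule borel_measurable_continuous_onI)
    have nx: "norm (sgn x) = 1" using x by (simp add: norm_sgn)
    have "(\<lambda>i. J i x) \<longlonglongrightarrow> (\<integral>y. \<Theta> (sgn x \<bullet> sgn y) \<partial>M)"
      unfolding J_def
    proof (rule integral_dominated_convergence[where w = "\<lambda>_. B"])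
      show "(\<lambda>y. \<Theta> (v i x \<bullet> v i y)) \<in> borel_measurable M" for i by (rule meas_v)
      show "AE y in M. (\<lambda>i. \<Theta> (v i x \<bullet> v i y)) \<longlonglongrightarrow> \<Theta> (sgn x \<bullet> sgn y)"
        using AE0
      proof eventually_elim
        case (elim y)
        have "isCont \<Theta> (sgn x \<bullet> sgn y)" using \<Theta> by (simp add: continuous_on_eq_continuous_at)
        then show ?case by (rule isCont_tendsto_compose) (intro tendsto_inner lim x elim)
      qed
      show "AE y in M. norm (\<Theta> (v i x \<bullet> v i y)) \<le> B" for i using B dot nv by auto
    qed auto
    also have "(\<integral>y. \<Theta> (sgn x \<bullet> sgn y) \<partial>M) = (\<integral>y. \<Theta> (sgn x \<bullet> sgn y) * indicator (cball 0 1) y \<partial>lborel)"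
      unfolding M_def by (subst integral_density) (auto simp: mult.commute)
    also have "\<dots> = C * I" unfolding C_def I_def by (rule zonal_integral[OF \<Theta> d nx])
    finally show ?thesis .
  qed
  have J_meas: "J i \<in> borel_measurable M" for i
    unfolding J_def using meas_v[of "\<lambda>a. \<integral>y. \<Theta> (a \<bullet> v i y) \<partial>M" i] by simp
  have "(\<lambda>i. \<integral>x. J i x \<partial>M) \<longlonglongrightarrow> (\<integral>x. C * I \<partial>M)"
    by (rule integral_dominated_convergence[where w = "\<lambda>_. B * measure M UNIV"])
      (use AE0 J_lim J_bound J_meas in auto)
  moreover have "(\<integral>x. J i x \<partial>M) \<ge> 0" for i
  proof -
    let ?A = "v i ` space M" and ?p = "\<lambda>a. measure M (v i -` {a} \<inter> space M)"
    have "(\<integral>x. J i x \<partial>M) = (\<Sum>a\<in>?A. ?p a * (\<Sum>b\<in>?A. ?p b * \<Theta> (a \<bullet> b)))"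
      unfolding J_def
      by (subst integral_simple_range[OF fM v, where h = "\<lambda>a. \<integral>y. \<Theta> (a \<bullet> v i y) \<partial>M"],
          subst integral_simple_range[OF fM v]) (rule refl)
    also have "\<dots> = (\<Sum>a\<in>?A. \<Sum>b\<in>?A. ?p a * ?p b * \<Theta> (a \<bullet> b))"
      by (simp add: sum_distrib_left mult.assoc)
    also have "\<dots> \<ge> 0" using nv simple_functionD(1)[OF v] by (intro pd) auto
    finally show ?thesis .
  qed
  ultimately have "0 \<le> (\<integral>x. C * I \<partial>M)" by (intro LIMSEQ_le_const) auto
  then have "0 \<le> C * I * measure M UNIV" by (simp add: mult_ac)
  then show ?thesis using C mM unfolding I_def[symmetric] by (simp add: zero_le_mult_iff)
qed

lemma Psi_imp_zonal_integral_nonneg: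
  assumes m: "m \<ge> 1" and d: "CARD('n::finite) = 2 * m" and \<psi>: "\<psi> \<in> Psi TYPE('n)"
  shows "integral {0..pi} (\<lambda>t. \<psi> t * zonal_weight m t) \<ge> 0"
proof -
  \<comment> \<open>Clamping to \<open>[-1, 1]\<close> makes the kernel continuous on the whole line without changing it at inner products of unit vectors.\<close>
  define c where "c s = max (- 1) (min 1 s)" for s :: real
  define \<Theta> where "\<Theta> s = \<psi> (arccos (c s)) * ((c s)\<^sup>2 - 1 / real CARD('n option))" for s
  have c: "c s \<in> {-1..1}" "s \<in> {-1..1} \<Longrightarrow> c s = s" for s by (auto simp: c_def)
  have cc: "continuous_on UNIV c" unfolding c_def by (intro continuous_intros)
  have ac: "continuous_on UNIV (\<lambda>s. arccos (c s))"
    by (rule continuous_on_compose2[OF continuous_on_arccos' cc]) (use c(1) in auto)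
  have "continuous_on {0..pi} \<psi>" using \<psi> unfolding Psi_def mem_Collect_eq by (elim conjE)
  then have "continuous_on UNIV (\<lambda>s. \<psi> (arccos (c s)))"
    by (rule continuous_on_compose2[OF _ ac]) (use c(1) arccos_bounded in auto)
  then have \<Theta>: "continuous_on UNIV \<Theta>" unfolding \<Theta>_def by (intro continuous_intros cc)
  have \<Theta>_eq: "\<Theta> s = \<psi> (arccos s) * (s\<^sup>2 - 1 / real CARD('n option))" if "s \<in> {-1..1}" for s
    using c(2)[OF that] by (simp add: \<Theta>_def)
  have "integral {0..pi} (\<lambda>t. \<Theta> (cos t) * sin t ^ (CARD('n) - 1)) \<ge> 0"
  proof (rule sphere_kernel_integral_nonneg[OF \<Theta>])
    show "CARD('n) \<ge> 2" using m d by simp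
    fix A :: "(real^('n option)) set" and w :: "real^('n option) \<Rightarrow> real" assume A: "finite A" "A \<subseteq> sphere 0 1"
    have "(\<Sum>a\<in>A. \<Sum>b\<in>A. w a * w b * \<Theta> (a \<bullet> b))
      = (\<Sum>a\<in>A. \<Sum>b\<in>A. w a * w b * (\<psi> (arccos (a \<bullet> b)) * ((a \<bullet> b)\<^sup>2 - 1 / real CARD('n option))))"
    proof (intro sum.cong refl)
      fix a b assume "a \<in> A" "b \<in> A"
      then have "norm a = 1" "norm b = 1" using A(2) by auto
      then have "a \<bullet> b \<in> {-1..1}" using Cauchy_Schwarz_ineq2[of a b] by auto
      then show "w a * w b * \<Theta> (a \<bullet> b) = w a * w b * (\<psi> (arccos (a \<bullet> b)) * ((a \<bullet> b)\<^sup>2 - 1 / real CARD('n option)))"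
        by (simp add: \<Theta>_eq)
    qed
    then show "(\<Sum>a\<in>A. \<Sum>b\<in>A. w a * w b * \<Theta> (a \<bullet> b)) \<ge> 0" using Psi_weighted_sum_nonneg[OF \<psi> A] by simp
  qed
  also have "integral {0..pi} (\<lambda>t. \<Theta> (cos t) * sin t ^ (CARD('n) - 1))
     = integral {0..pi} (\<lambda>t. (2 * real m / (2 * real m + 1)) * (\<psi> t * zonal_weight m t))"
  proof (rule Henstock_Kurzweil_Integration.integral_cong)
    fix t assume t: "t \<in> {0..pi}"
    have "\<Theta> (cos t) = \<psi> t * ((cos t)\<^sup>2 - 1 / (2 * real m + 1))"
      using t d by (subst \<Theta>_eq) (auto simp: arccos_cos card_UNIV_option add.commute)
    moreover have "(cos t)\<^sup>2 - 1 / (2 * real m + 1)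
        = (2 * real m / (2 * real m + 1)) * (((2 * real m + 1) * (cos t)\<^sup>2 - 1) / (2 * real m))"
    proof -
      have "a - 1 / x = y / x * ((x * a - 1) / y)" if "x > 0" "y > 0" for a x y :: real
        using that by (simp add: field_simps)
      from this[of "2 * real m + 1" "2 * real m"] m show ?thesis by simp
    qed
    ultimately show "\<Theta> (cos t) * sin t ^ (CARD('n) - 1) = (2 * real m / (2 * real m + 1)) * (\<psi> t * zonal_weight m t)"
      unfolding zonal_weight_eq[OF m] d by (simp add: mult_ac)
  qed
  also have "\<dots> = (2 * real m / (2 * real m + 1)) * integral {0..pi} (\<lambda>t. \<psi> t * zonal_weight m t)"
    by simp
  finally show ?thesis using m by (simp add: zero_le_mult_iff zero_le_divide_iff)
qed

theorem theorem1p6: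
  fixes m :: nat and \<theta> :: real and i1 :: "'n::finite"
  assumes "m \<ge> 1" and "CARD('n) = 2 * m" and "0 < \<theta>" and "\<theta> \<le> pi"
  shows "\<exists>F :: real^'n \<Rightarrow> real.
    F \<noteq> (\<lambda>x. 0) \<and> isotropic F \<and> positive_definite (\<lambda>x. complex_of_real (F x)) \<and>
    F \<in> Cc_infinity \<and> F 0 > 0 \<and> supp F \<subseteq> {x. norm x \<le> \<theta>} \<and>
    (let f = (\<lambda>r. F (r *\<^sub>R axis i1 1) / F 0) in
      f \<in> Phi TYPE('n) \<and>
      integral {0..\<theta>}
        (\<lambda>t. f t * gegenbauer_normalized (real m - 1/2) 2 (cos t) * sin t ^ (2 * m - 1)) < 0 \<and>
      restrict f {0..pi} \<notin> Psi TYPE('n))"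
proof -
  define e where "e = (axis i1 1 :: real^'n)"
  have ne: "norm e = 1" by (simp add: e_def)
  obtain F :: "real^'n \<Rightarrow> real" where smooth: "smooth F" and iso: "isotropic F"
    and pd: "positive_definite (\<lambda>x. complex_of_real (F x))" and F0: "\<And>x. norm x > \<theta> \<Longrightarrow> F x = 0"
    and "integral {0..\<theta>} (\<lambda>t. F (t *\<^sub>R axis i1 1) * zonal_weight m t) < 0"
    by (rule exists_positive_definite_with_negative_zonal_integral[where ?i1.0 = i1, OF assms(1-3)]) (rule that)
  then have neg: "integral {0..\<theta>} (\<lambda>t. F (t *\<^sub>R e) * zonal_weight m t) < 0"
    by (simp add: e_def)
  have cont: "continuous_on UNIV F" using smooth Ck_imp_continuous unfolding smooth_def by blast
  have bound: "\<bar>F x\<bar> \<le> F 0" for x by (rule positive_definite_bound[OF pd isotropic_even[OF iso]])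
  have pos: "F 0 > 0"
  proof (rule ccontr)
    assume "\<not> F 0 > 0"
    then have "F x = 0" for x using bound[of x] by auto
    then show False using neg by simp
  qed
  have supp: "supp F \<subseteq> cball 0 \<theta>"
    unfolding supp_def by (rule closure_minimal) (use F0 in \<open>force simp: not_le\<close>, simp)
  then have "compact (supp F)"
    by (metis bounded_cball bounded_subset closed_closure compact_eq_bounded_closed supp_def)
  define f where "f r = F (r *\<^sub>R e) / F 0" for r
  have f_norm: "f (norm x) = F x / F 0" for x
  proof -
    have "F (norm x *\<^sub>R e) = F x" by (rule iso[unfolded isotropic_def, rule_format]) (simp add: ne)
    then show ?thesis by (simp add: f_def)
  qed
  have f_cont: "continuous_on S f" for S
    unfolding f_def[abs_def] using pos by (intro continuous_intros continuous_on_compose2[OF cont]) auto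
  have f_Phi: "f \<in> Phi TYPE('n)"
    unfolding Phi_def mem_Collect_eq
  proof (intro conjI f_cont)
    show "f 0 = 1" using pos by (simp add: f_def)
    show "positive_definite (\<lambda>x :: real^'n. complex_of_real (f (norm x)))"
      unfolding positive_definite_def
    proof (intro allI impI)
      fix N :: nat and x :: "nat \<Rightarrow> real^'n" and c :: "nat \<Rightarrow> complex" assume N: "N \<ge> 1"
      have "(\<Sum>i<N. \<Sum>j<N. cnj (c i) * c j * complex_of_real (F (x i - x j))) \<in> \<real>\<^sub>\<ge>\<^sub>0"
        using pd N unfolding positive_definite_def by blast
      then have "complex_of_real (1 / F 0) * (\<Sum>i<N. \<Sum>j<N. cnj (c i) * c j * complex_of_real (F (x i - x j))) \<in> \<real>\<^sub>\<ge>\<^sub>0"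
        using pos by (intro nonneg_Reals_mult_I) (simp_all only: nonneg_Reals_of_real_iff, simp)
      then show "(\<Sum>i<N. \<Sum>j<N. cnj (c i) * c j * complex_of_real (f (norm (x i - x j)))) \<in> \<real>\<^sub>\<ge>\<^sub>0"
        by (simp add: f_norm sum_distrib_left)
    qed
  qed
  have int: "integral {0..\<theta>} (\<lambda>t. f t * zonal_weight m t) < 0"
    using neg pos by (simp add: f_def divide_less_0_iff)
  have not_Psi: "restrict f {0..pi} \<notin> Psi TYPE('n)"
  proof
    assume "restrict f {0..pi} \<in> Psi TYPE('n)"
    then have "0 \<le> integral {0..pi} (\<lambda>t. restrict f {0..pi} t * zonal_weight m t)"
      by (rule Psi_imp_zonal_integral_nonneg[OF assms(1,2)])
    also have "\<dots> = integral {0..pi} (\<lambda>t. if t \<in> {0..\<theta>} then f t * zonal_weight m t else 0)"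
      by (rule Henstock_Kurzweil_Integration.integral_cong) (use F0 in \<open>auto simp: f_def ne\<close>)
    also have "\<dots> = integral {0..\<theta>} (\<lambda>t. f t * zonal_weight m t)"
    proof -
      have "{0..\<theta>} \<inter> {0..pi} = {0..\<theta>}" using assms(4) by auto
      then show ?thesis by (simp only: integral_restrict_Int)
    qed
    finally show False using int by simp
  qed
  show ?thesis
    unfolding Let_def e_def[symmetric] f_def[symmetric, abs_def]
  proof (intro exI[of _ F] conjI)
    show "F \<noteq> (\<lambda>x. 0)" using pos by auto
    show "F \<in> Cc_infinity" using smooth \<open>compact (supp F)\<close> by (simp add: Cc_infinity_def)
    show "supp F \<subseteq> {x. norm x \<le> \<theta>}" using supp by auto
    show "(\<lambda>r. F (r *\<^sub>R e) / F 0) \<in> Phi TYPE('n)" using f_Phi by (simp add: f_def[abs_def])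
    show "integral {0..\<theta>} (\<lambda>t. F (t *\<^sub>R e) / F 0 * gegenbauer_normalized (real m - 1/2) 2 (cos t) * sin t ^ (2 * m - 1)) < 0"
      using int by (simp add: f_def zonal_weight_def mult.assoc)
    show "restrict (\<lambda>r. F (r *\<^sub>R e) / F 0) {0..pi} \<notin> Psi TYPE('n)" using not_Psi by (simp add: f_def[abs_def])
  qed (use iso pd pos in auto)
qed

end
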